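(* There exist universal constants $M,M_5>0$ such that the following holds. Suppose that: (1) the learning rule $\Psi_\alpha$ is an empirical conditional risk minimizer, i.e. $\Psi_\alpha(S)\in\arg\min_{g\in\mathcal G}\widehat{\mathcal R}_\alpha(g,S)$ for every training index set $S$; (2) the validation sets $V_1,\dots,V_K\subset\{1,\dots,n\}$ all have the same cardinality $n_V$ and satisfy $\frac1K\sum_{j=1}^K\mathbf 1\{l\in V_j\}=\frac{n_V}{n}$ for all $l\in\{1,\dots,n\}$; (3) the class of functions $\{z\mapsto c(g,z):g\in\mathcal G\}$ has finite VC-dimension $\mathcal V_{\mathcal G}$; (4) $0\le c(g,z)\le1$ for all $(g,z)\in\mathcal G\times\mathcal Z$. Let $n_T=n-n_V$. Then for every $\delta\in(0,1)$, with probability at least $1-17\delta$, $$\Big|\widehat{\mathcal R}_{CV,\alpha}(\Psi_\alpha,V_{1:K})-\mathcal R_\alpha\big(\Psi_\alpha(S_n)\big)\Big|\le E'_{CV}(n_T,\alpha)+\frac{1}{\delta\sqrt{n_T\alpha}}\big(5M\sqrt{\mathcal V_{\mathcal G}}+M_5\big),$$ where $$E'_{CV}(n_T,\alpha)=\frac{9M\sqrt{\mathcal V_{\mathcal G}}}{\sqrt{\alpha n_T}}+\frac{9}{n_T\alpha}.$$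
   Context: Let $\mathcal X\subset\mathbb R^d$, $\mathcal Z=\mathcal X\times\{-1,1\}$, and let $\|\cdot\|$ be a norm on $\mathcal X$. Let $Z=(X,Y)$ be a random element of $\mathcal Z$ and $Z_i=(X_i,Y_i)$, $i=1,\dots,n$, i.i.d. copies of $Z$; $S_n=\{1,\dots,n\}$. Let $\alpha=k/n\in(0,1]$ with $k$ a positive integer, and let $t_\alpha$ be the $(1-\alpha)$-quantile of $\|X\|$, with $\mathbb P(\|X\|\ge t_\alpha)=\alpha$. Let $\mathcal G$ be a class of functions $g:\mathcal X\to\mathbb R$ and $c:\mathcal G\times\mathcal Z\to\mathbb R$ a cost function, with $c(g,(x,y))$ depending on $g$ through $g(x)$ (also written $c(g(x),y)$). The conditional risk is $\mathcal R_\alpha(g)=\mathbb E[c(g,Z)\mid \|X\|\ge t_\alpha]$; for a data-dependent $\hat g$, $\mathcal R_\alpha(\hat g)$ means this function evaluated at $\hat g$. With reverse order statistics $\|X_{(1)}\|\ge\dots\ge\|X_{(n)}\|$ of the full sample, the empirical risk on $S\subset\{1,\dots,n\}$, $n_S=\mathrm{card}(S)$, is $$\widehat{\mathcal R}_\alpha(g,S)=\frac1{\alpha n_S}\sum_{i\in S}c(g,Z_i)\mathbf 1\{\|X_i\|>\|X_{(\lfloor\alpha n\rfloor)}\|\}.$$ A learning rule $\Psi$ maps an index set $S\subset\{1,\dots,n\}$ to an element $\Psi(S)\in\mathcal G$ trained on $\{Z_i:i\in S\}$. For validation sets $V_{1:K}=(V_1,\dots,V_K)$ with training sets $T_j=\{1,\dots,n\}\setminus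 V_j$, the cross-validation estimator is $\widehat{\mathcal R}_{CV,\alpha}(\Psi,V_{1:K})=\frac1K\sum_{j=1}^K\widehat{\mathcal R}_\alpha(\Psi(T_j),V_j)$. The VC-dimension of a class of real functions is the VC-dimension of the family of its subgraphs $\{(x,y,t)\in\mathcal Z\times\mathbb R: t<c(g(x),y)\}$, $g\in\mathcal G$. "Universal constant" means not depending on any of the other objects ($n,\alpha,K,\delta,\mathcal G,c$, the law of $Z$).
   Formalization: Proved assuming the law of ‖X‖ has no atoms at or above t_α (the claim fails if an atom of mass α sits at t_α), the class {c(g,·)} is P-measurable, c(Ψ(S),z) is jointly measurable in sample and z, K≥1 and 1≤n_V<n. *)

theory Defs
  imports "HOL-Probability.Probability" "HOL-Library.Extended_Nat"
begin

(* The dimension d is a natural number rather than a type, so that the universal constants of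
   the theorem can be quantified before it.  A point of R^d is an extensional function on {..<d}. *)

type_synonym point = "nat \<Rightarrow> real"
type_synonym obs = "point \<times> real"

definition point_space :: "nat \<Rightarrow> point measure" where
  "point_space d = Pi\<^sub>M {..<d} (\<lambda>_. borel)"

definition norm_on_points :: "nat \<Rightarrow> (point \<Rightarrow> real) \<Rightarrow> bool" where
  "norm_on_points d N \<longleftrightarrow>
     (\<forall>x \<in> space (point_space d). 0 \<le> N x \<and> (N x = 0 \<longleftrightarrow> x = (\<lambda>i\<in>{..<d}. 0))) \<and>
     (\<forall>x \<in> space (point_space d). \<forall>a. N (\<lambda>i\<in>{..<d}. a * x i) = \<bar>a\<bar> * N x) \<and>
     (\<forall>x \<in> space (point_space d). \<forall>y \<in> space (point_space d).
        N (\<lambda>i\<in>{..<d}. x i + y i) \<le> N x + N y)"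

(* The trace sigma-algebra is used, so X need not be a Borel set. *)
definition obs_space :: "nat \<Rightarrow> point set \<Rightarrow> obs measure" where
  "obs_space d X = restrict_space (point_space d) X \<Otimes>\<^sub>M count_space {-1, 1}"

(* Canonical model of Z_1, ..., Z_n: the coordinates of z under the n-fold product of the
   law P of Z. *)
abbreviation sample_law :: "obs measure \<Rightarrow> nat \<Rightarrow> (nat \<Rightarrow> obs) measure" where
  "sample_law P n \<equiv> Pi\<^sub>M {1..n} (\<lambda>_. P)"


(* Any (1 - alpha)-quantile of the norm is allowed for t; two choices satisfying the last
   equation give tail events that differ by a null set. *)
definition tail_quantile :: "obs measure \<Rightarrow> (point \<Rightarrow> real) \<Rightarrow> real \<Rightarrow> real \<Rightarrow> bool" where
  "tail_quantile P N \<alpha> t \<longleftrightarrow>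
     \<P>(z in P. N (fst z) \<le> t) \<ge> 1 - \<alpha> \<and> \<P>(z in P. N (fst z) \<ge> t) = \<alpha>"

(* No ties above t.  Without this the strict inequality in the empirical risk can discard most of
   the tail sample: if an atom of mass alpha sits at t, the empirical risk vanishes identically
   with probability close to 1/2. *)
definition no_tail_atoms :: "obs measure \<Rightarrow> (point \<Rightarrow> real) \<Rightarrow> real \<Rightarrow> bool" where
  "no_tail_atoms P N t \<longleftrightarrow> (\<forall>r\<ge>t. \<P>(z in P. N (fst z) = r) = 0)"

definition cond_risk ::
  "obs measure \<Rightarrow> (point \<Rightarrow> real) \<Rightarrow> real \<Rightarrow> ((point \<Rightarrow> real) \<Rightarrow> obs \<Rightarrow> real) \<Rightarrow> (point \<Rightarrow> real) \<Rightarrow> real"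
  where
  "cond_risk P N t c g =
     set_lebesgue_integral P {z \<in> space P. N (fst z) \<ge> t} (c g) / \<P>(z in P. N (fst z) \<ge> t)"

(* The j-th largest of u 1, ..., u n, for 1 <= j <= n. *)
definition rev_order_stat :: "nat \<Rightarrow> (nat \<Rightarrow> real) \<Rightarrow> nat \<Rightarrow> real" where
  "rev_order_stat n u j = rev (sort (map u [1..<Suc n])) ! (j - 1)"

definition emp_threshold :: "(point \<Rightarrow> real) \<Rightarrow> nat \<Rightarrow> real \<Rightarrow> (nat \<Rightarrow> obs) \<Rightarrow> real" where
  "emp_threshold N n \<alpha> z = rev_order_stat n (\<lambda>i. N (fst (z i))) (nat \<lfloor>\<alpha> * real n\<rfloor>)"

definition emp_risk ::
  "(point \<Rightarrow> real) \<Rightarrow> nat \<Rightarrow> real \<Rightarrow> ((point \<Rightarrow> real) \<Rightarrow> obs \<Rightarrow> real) \<Rightarrow> (nat \<Rightarrow> obs) \<Rightarrow>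
   (point \<Rightarrow> real) \<Rightarrow> nat set \<Rightarrow> real" where
  "emp_risk N n \<alpha> c z g S =
     1 / (\<alpha> * real (card S)) *
     (\<Sum>i\<in>S. c g (z i) * of_bool (N (fst (z i)) > emp_threshold N n \<alpha> z))"


(* A rule takes the index set S and the sample z. *)
type_synonym learning_rule = "nat set \<Rightarrow> (nat \<Rightarrow> obs) \<Rightarrow> point \<Rightarrow> real"

(* Training on S uses the observations with index in S, and in addition only the threshold, which
   is computed from the full sample and enters the empirical risk on every S. *)
definition trained_on_subsample ::
  "obs measure \<Rightarrow> (point \<Rightarrow> real) \<Rightarrow> nat \<Rightarrow> real \<Rightarrow> learning_rule \<Rightarrow> bool" where
  "trained_on_subsample P N n \<alpha> \<Psi> \<longleftrightarrow>
     (\<forall>S \<subseteq> {1..n}. \<forall>z \<in> space (sample_law P n). \<forall>z' \<in> space (sample_law P n).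
        (\<forall>i\<in>S. z i = z' i) \<and> emp_threshold N n \<alpha> z = emp_threshold N n \<alpha> z' \<longrightarrow> \<Psi> S z = \<Psi> S z')"

definition measurable_rule ::
  "obs measure \<Rightarrow> nat \<Rightarrow> ((point \<Rightarrow> real) \<Rightarrow> obs \<Rightarrow> real) \<Rightarrow> learning_rule \<Rightarrow> bool" where
  "measurable_rule P n c \<Psi> \<longleftrightarrow>
     (\<forall>S \<subseteq> {1..n}. (\<lambda>(z, w). c (\<Psi> S z) w) \<in> borel_measurable (sample_law P n \<Otimes>\<^sub>M P))"

definition cond_erm ::
  "obs measure \<Rightarrow> (point \<Rightarrow> real) \<Rightarrow> nat \<Rightarrow> real \<Rightarrow> (point \<Rightarrow> real) set \<Rightarrow>
   ((point \<Rightarrow> real) \<Rightarrow> obs \<Rightarrow> real) \<Rightarrow> learning_rule \<Rightarrow> bool" where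
  "cond_erm P N n \<alpha> G c \<Psi> \<longleftrightarrow>
     (\<forall>S \<subseteq> {1..n}. \<forall>z \<in> space (sample_law P n).
        is_arg_min (\<lambda>g. emp_risk N n \<alpha> c z g S) (\<lambda>g. g \<in> G) (\<Psi> S z))"

definition cv_risk ::
  "(point \<Rightarrow> real) \<Rightarrow> nat \<Rightarrow> real \<Rightarrow> ((point \<Rightarrow> real) \<Rightarrow> obs \<Rightarrow> real) \<Rightarrow> learning_rule \<Rightarrow>
   nat \<Rightarrow> (nat \<Rightarrow> nat set) \<Rightarrow> (nat \<Rightarrow> obs) \<Rightarrow> real" where
  "cv_risk N n \<alpha> c \<Psi> K V z =
     1 / real K * (\<Sum>j=1..K. emp_risk N n \<alpha> c z (\<Psi> ({1..n} - V j) z) (V j))"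


definition shatters :: "'a set set \<Rightarrow> 'a set \<Rightarrow> bool" where
  "shatters \<A> B \<longleftrightarrow> (\<forall>C \<subseteq> B. \<exists>A\<in>\<A>. A \<inter> B = C)"

definition vc_dim :: "'a set set \<Rightarrow> enat" where
  "vc_dim \<A> = (SUP B \<in> {B. finite B \<and> shatters \<A> B}. enat (card B))"

definition subgraphs :: "'a set \<Rightarrow> ('a \<Rightarrow> real) set \<Rightarrow> ('a \<times> real) set set" where
  "subgraphs A F = (\<lambda>f. {(x, s). x \<in> A \<and> s < f x}) ` F"

(* P-measurability of a class of functions in the sense of empirical process theory
   (van der Vaart and Wellner, Definition 2.3.3).  It holds for countable and for pointwise
   separable classes; for general uncountable classes, uniform laws of large numbers can fail
   even when the VC dimension is 1. *)
definition P_measurable_class :: "'a measure \<Rightarrow> ('a \<Rightarrow> real) set \<Rightarrow> bool" where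
  "P_measurable_class P F \<longleftrightarrow>
     F \<subseteq> borel_measurable P \<and>
     (\<forall>(m::nat) (e :: nat \<Rightarrow> real).
        (\<lambda>z. SUP f\<in>F. \<bar>\<Sum>i<m. e i * f (z i)\<bar>) \<in> borel_measurable (completion (Pi\<^sub>M {..<m} (\<lambda>_. P))))"

end

theory Submission
  imports Defs
begin

text \<open>
Write \<open>W\<close> for the cross-validation estimate minus the conditional risk of the rule trained on the full
  sample. The theorem follows by Markov's inequality from a bound on the mean,
  \<open>E \<bar>W\<bar> \<le> 504 * sqrt (v + 1) / sqrt (\<alpha> * n\<^sub>T)\<close> (\<open>expectation_cv_error\<close>), where \<open>v\<close> is the VC dimension; this is
  where the factor \<open>1 / \<delta>\<close> comes from. Since \<open>\<bar>W\<bar> = W + 2 * max 0 (- W)\<close>, an upper bound on the mean of \<open>W\<close> and a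
  pathwise lower bound on \<open>W\<close> suffice.

  The lower bound uses minimality twice. On the whole sample the full-sample rule is at least as good as the
  fold rule, and on the training set of the fold it is at most as good; hence on the validation set it is at
  least as good. Averaging over balanced folds, the cross-validation estimate is at least the training risk of
  the full-sample rule, which is within one uniform deviation of its true risk (\<open>cv_error_ge\<close>).

  The upper bound would be immediate in mean if a rule trained on a fold were independent of the held-out
  points. It is not, because both the rule and the empirical risk use the threshold, which is an order
  statistic of the full sample. But replacing a point above the threshold by another point above it changes
  neither the threshold nor a rule that was not trained on that point. So, conditionally on lying above the
  threshold, a held-out point may be exchanged with a fresh one (\<open>swap_held_out\<close>). What remains is the
  difference between the random threshold and the population quantile. The number of sample points that lie
  between the two is controlled by the deviation of the number of tail points from its mean \<open>k\<close>, which is of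
  order \<open>sqrt k\<close>, and exchangeability spreads it evenly over the indices.

  The uniform deviation of the tail averages must be of order \<open>sqrt (v / (\<alpha> * n))\<close> without a logarithm.
  Symmetrization reduces it to Rademacher averages on the tail points only, of which there are about \<open>\<alpha> * n\<close>.
  A function with values in \<open>[0, 1]\<close> is the average of the indicators of its level sets, so it is enough to
  treat set systems of finite VC dimension (\<open>sign_avg_SUP_functions\<close>). For those, chaining along Hamming
  distances \<open>m / 4 ^ j\<close> works because the logarithm of the packing number grows only linearly in \<open>j\<close>
  (\<open>packing_bound\<close>), which in turn follows from the Sauer-Shelah lemma.
\<close>

section \<open>Shattered sets and packing in the Hamming cube\<close>

text \<open>Pajor's form of the Sauer-Shelah lemma, by induction on the ground set. Deleting a point \<open>x\<close> merges the
  members that differ only in \<open>x\<close>; the merged pairs form a second family. Sets shattered by the first family are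
  shattered by \<open>\<S>\<close>, and sets shattered by the second are still shattered after adding \<open>x\<close>, which keeps the two
  counts apart.\<close>

lemma card_le_card_shattered:
  assumes "finite J" "\<S> \<subseteq> Pow J"
  shows "card \<S> \<le> card {B. B \<subseteq> J \<and> shatters \<S> B}"
  using assms
proof (induction J arbitrary: \<S> rule: finite_induct)
  case empty
  show ?case
  proof (cases "\<S> = {}")
    case False
    with empty have "\<S> = {{}}" by auto
    moreover have "{B. B \<subseteq> {} \<and> shatters \<S> B} = {{}}"
      using False by (auto simp: shatters_def)
    ultimately show ?thesis by simp
  qed simp
next
  case (insert x J)
  define S0 where "S0 = {A \<in> \<S>. x \<notin> A}"
  define S1 where "S1 = {A \<in> \<S>. x \<in> A}"
  define S1' where "S1' = (\<lambda>A. A - {x}) ` S1"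
  have fin: "finite \<S>" using insert.prems insert.hyps(1) by (meson finite_Pow_iff finite_insert finite_subset)
  have card_S1': "card S1' = card S1"
    unfolding S1'_def by (rule card_image) (auto simp: inj_on_def S1_def)
  have "\<S> = S0 \<union> S1" "S0 \<inter> S1 = {}" by (auto simp: S0_def S1_def)
  hence "card \<S> = card S0 + card S1"
    using fin by (metis card_Un_disjoint finite_Un)
  also have "\<dots> = card (S0 \<union> S1') + card (S0 \<inter> S1')"
    using fin card_S1' by (subst card_Un_Int[symmetric]) (auto simp: S0_def S1'_def S1_def)
  also have "\<dots> \<le> card {B. B \<subseteq> J \<and> shatters (S0 \<union> S1') B} + card {B. B \<subseteq> J \<and> shatters (S0 \<inter> S1') B}"
    using insert.prems by (intro add_mono insert.IH) (auto simp: S0_def S1_def S1'_def)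
  also have "\<dots> = card {B. B \<subseteq> J \<and> shatters (S0 \<union> S1') B} +
      card (Set.insert x ` {B. B \<subseteq> J \<and> shatters (S0 \<inter> S1') B})"
    using insert.hyps(2) by (subst card_image) (auto simp: inj_on_def)
  also have "\<dots> = card ({B. B \<subseteq> J \<and> shatters (S0 \<union> S1') B} \<union>
      Set.insert x ` {B. B \<subseteq> J \<and> shatters (S0 \<inter> S1') B})"
    using insert.hyps by (subst card_Un_disjoint) auto
  also have "\<dots> \<le> card {B. B \<subseteq> insert x J \<and> shatters \<S> B}"
  proof (intro card_mono)
    show "finite {B. B \<subseteq> insert x J \<and> shatters \<S> B}" using insert.hyps by simp
    have "shatters \<S> B" if "B \<subseteq> J" "shatters (S0 \<union> S1') B" for B
      unfolding shatters_def
    proof (intro allI impI)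
      fix C assume "C \<subseteq> B"
      then obtain A where A: "A \<in> S0 \<union> S1'" "A \<inter> B = C" using \<open>shatters (S0 \<union> S1') B\<close>
        unfolding shatters_def by blast
      have "x \<notin> B" using that insert.hyps by auto
      thus "\<exists>A\<in>\<S>. A \<inter> B = C" using A by (auto simp: S0_def S1'_def S1_def)
    qed
    moreover have "shatters \<S> (insert x B)" if "B \<subseteq> J" "shatters (S0 \<inter> S1') B" for B
      unfolding shatters_def
    proof (intro allI impI)
      fix C assume C: "C \<subseteq> insert x B"
      then have "C - {x} \<subseteq> B" by auto
      then obtain A where A: "A \<in> S0 \<inter> S1'" "A \<inter> B = C - {x}" using \<open>shatters (S0 \<inter> S1') B\<close>
        unfolding shatters_def by blast
      then obtain A' where A': "A' \<in> \<S>" "x \<in> A'" "A = A' - {x}" by (auto simp: S1'_def S1_def)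
      have "x \<notin> B" using that insert.hyps by auto
      show "\<exists>A\<in>\<S>. A \<inter> insert x B = C"
      proof (cases "x \<in> C")
        case True
        thus ?thesis using A A' \<open>x \<notin> B\<close> by (intro bexI[of _ A']) auto
      next
        case False
        thus ?thesis using A \<open>x \<notin> B\<close> by (intro bexI[of _ A]) (auto simp: S0_def)
      qed
    qed
    ultimately show "{B. B \<subseteq> J \<and> shatters (S0 \<union> S1') B} \<union>
        Set.insert x ` {B. B \<subseteq> J \<and> shatters (S0 \<inter> S1') B}
      \<subseteq> {B. B \<subseteq> insert x J \<and> shatters \<S> B}" by auto
  qed
  finally show ?case .
qed

lemma sum_power_card_Pow:
  fixes y :: real
  assumes "finite J"
  shows "(\<Sum>B\<in>Pow J. y ^ card B) = (1 + y) ^ card J"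
  using assms
proof (induction J rule: finite_induct)
  case (insert x J)
  have "(\<Sum>B\<in>Pow (insert x J). y ^ card B) = (\<Sum>B\<in>Pow J. y ^ card B) + (\<Sum>B\<in>insert x ` Pow J. y ^ card B)"
    using insert.hyps by (subst Pow_insert, subst sum.union_disjoint) auto
  also have "(\<Sum>B\<in>insert x ` Pow J. y ^ card B) = (\<Sum>B\<in>Pow J. y * y ^ card B)"
    using insert.hyps
    by (subst sum.reindex) (auto simp: inj_on_def intro!: sum.cong dest: finite_subset, (subst card_insert_disjoint, auto dest: finite_subset)+)
  finally show ?case using insert by (simp add: sum_distrib_left[symmetric] algebra_simps)
qed simp

text \<open>The usual bound on the sum of binomial coefficients, in a parametric form: a set of at most \<open>v\<close> elements has
  weight at least \<open>y ^ v\<close> when every element has weight \<open>y \<le> 1\<close>. The free parameter \<open>y\<close> can later be tuned to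
  the packing radius.\<close>

lemma sauer_shelah_exp:
  fixes y :: real
  assumes "finite J" "\<S> \<subseteq> Pow J" "\<And>B. B \<subseteq> J \<Longrightarrow> shatters \<S> B \<Longrightarrow> card B \<le> v" "0 < y" "y \<le> 1"
  shows "real (card \<S>) * y ^ v \<le> exp (y * real (card J))"
proof -
  have "real (card \<S>) * y ^ v \<le> real (card {B. B \<subseteq> J \<and> shatters \<S> B}) * y ^ v"
    using card_le_card_shattered[OF assms(1,2)] assms(4) by (intro mult_right_mono) auto
  also have "\<dots> = (\<Sum>B\<in>{B. B \<subseteq> J \<and> shatters \<S> B}. y ^ v)" by simp
  also have "\<dots> \<le> (\<Sum>B\<in>{B. B \<subseteq> J \<and> shatters \<S> B}. y ^ card B)"
    using assms by (intro sum_mono power_decreasing) auto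
  also have "\<dots> \<le> (\<Sum>B\<in>Pow J. y ^ card B)"
    using assms by (intro sum_mono2) auto
  also have "\<dots> = (1 + y) ^ card J" using assms by (simp add: sum_power_card_Pow)
  also have "\<dots> \<le> exp y ^ card J" using assms by (intro power_mono) auto
  also have "\<dots> = exp (y * real (card J))" by (simp add: exp_of_nat_mult[symmetric] mult.commute)
  finally show ?thesis .
qed

definition separated :: "real \<Rightarrow> 'a set set \<Rightarrow> bool" where
  "separated r \<S> \<longleftrightarrow> (\<forall>A\<in>\<S>. \<forall>B\<in>\<S>. A \<noteq> B \<longrightarrow> real (card (sym_diff A B)) > r)"

text \<open>First-moment argument: a uniformly random coordinate distinguishes a given pair with probability above
  \<open>\<epsilon>\<close>, so \<open>r\<close> independent coordinates fail on some pair with probability at most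
  \<open>(card \<S>)\<^sup>2 * exp (- \<epsilon> * r)\<close>.\<close>

lemma separating_coordinates:
  assumes J: "finite J" "J \<noteq> {}" and S: "\<S> \<subseteq> Pow J" "separated (\<epsilon> * real (card J)) \<S>"
    and r: "real (card \<S>)^2 * exp (- \<epsilon> * real r) < 1" and e: "0 < \<epsilon>" "\<epsilon> \<le> 1"
  shows "\<exists>I \<subseteq> J. card I \<le> r \<and> inj_on (\<lambda>A. A \<inter> I) \<S>"
proof -
  define F where "F = ({..<r} \<rightarrow>\<^sub>E J)"
  define bad where "bad = (\<lambda>(A,B). {f \<in> F. \<forall>i<r. f i \<notin> sym_diff A B})"
  define Pr where "Pr = {p \<in> \<S> \<times> \<S>. fst p \<noteq> snd p}"
  have finS: "finite \<S>" using J S by (meson finite_Pow_iff finite_subset)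
  have finP: "finite Pr" using finS by (auto simp: Pr_def)
  have finF: "finite F" using J by (auto simp: F_def intro: finite_PiE)
  have cardF: "real (card F) = real (card J) ^ r" by (simp add: F_def card_PiE)
  have cj: "real (card J) > 0" using J by (simp add: card_gt_0_iff)
  have bad_le: "real (card (bad p)) \<le> exp (- \<epsilon> * real r) * real (card F)" if pPr: "p \<in> Pr" for p
  proof -
    obtain A B where p: "p = (A,B)" "A \<in> \<S>" "B \<in> \<S>" "A \<noteq> B" using pPr by (cases p) (auto simp: Pr_def)
    have sub: "sym_diff A B \<subseteq> J" using p S by auto
    have "bad p = ({..<r} \<rightarrow>\<^sub>E (J - sym_diff A B))"
      unfolding bad_def p F_def by (fastforce simp: PiE_def Pi_def extensional_def)
    hence "real (card (bad p)) = real (card (J - sym_diff A B)) ^ r" by (simp add: card_PiE)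
    also have "real (card (J - sym_diff A B)) = real (card J) - real (card (sym_diff A B))"
      using sub J by (subst card_Diff_subset) (auto simp: of_nat_diff card_mono dest: finite_subset)
    also have "(real (card J) - real (card (sym_diff A B))) ^ r \<le> ((1 - \<epsilon>) * real (card J)) ^ r"
      using S(2) p sub J
      by (intro power_mono) (auto simp: separated_def algebra_simps card_mono less_imp_le)
    also have "\<dots> = (1 - \<epsilon>) ^ r * real (card J) ^ r" by (simp add: power_mult_distrib)
    also have "\<dots> \<le> exp (-\<epsilon>) ^ r * real (card J) ^ r"
      using e exp_ge_add_one_self[of "-\<epsilon>"] by (intro mult_right_mono power_mono) auto
    also have "exp (-\<epsilon>) ^ r = exp (- \<epsilon> * real r)" by (subst exp_of_nat_mult[symmetric]) (simp add: mult.commute)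
    finally show ?thesis by (simp add: cardF)
  qed
  have "real (card (\<Union>p\<in>Pr. bad p)) \<le> (\<Sum>p\<in>Pr. real (card (bad p)))"
    using of_nat_mono[OF card_UN_le[OF finP, of bad], where 'a = real] by (simp only: of_nat_sum)
  also have "\<dots> \<le> (\<Sum>p\<in>Pr. exp (- \<epsilon> * real r) * real (card F))" using bad_le by (intro sum_mono) auto
  also have "\<dots> = real (card Pr) * (exp (- \<epsilon> * real r) * real (card F))" by simp
  also have "\<dots> \<le> real (card \<S>)^2 * (exp (- \<epsilon> * real r) * real (card F))"
  proof (intro mult_right_mono)
    have "card Pr \<le> card (\<S> \<times> \<S>)" using finS by (intro card_mono) (auto simp: Pr_def)
    hence "card Pr \<le> card \<S> * card \<S>" by (simp only: card_cartesian_product)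
    thus "real (card Pr) \<le> real (card \<S>)^2"
      using of_nat_mono[of "card Pr" "card \<S> * card \<S>", where 'a = real]
      by (simp only: of_nat_mult power2_eq_square)
  qed auto
  also have "\<dots> = (real (card \<S>)^2 * exp (- \<epsilon> * real r)) * real (card F)" by simp
  also have "\<dots> < 1 * real (card F)"
    using r cj by (intro mult_strict_right_mono) (auto simp: cardF)
  finally have "card (\<Union>p\<in>Pr. bad p) < card F" by simp
  moreover have "finite (\<Union>p\<in>Pr. bad p)" using finP finF by (auto simp: bad_def)
  ultimately have "\<not> F \<subseteq> (\<Union>p\<in>Pr. bad p)"
    by (meson card_mono leD)
  then obtain f where f: "f \<in> F" "f \<notin> (\<Union>p\<in>Pr. bad p)" by blast
  define I where "I = f ` {..<r}"
  have "I \<subseteq> J" using f by (auto simp: I_def F_def)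
  moreover have "card I \<le> r" using card_image_le[of "{..<r}" f] by (simp add: I_def)
  moreover have "inj_on (\<lambda>A. A \<inter> I) \<S>"
  proof (rule inj_onI, rule ccontr)
    fix A B assume AB: "A \<in> \<S>" "B \<in> \<S>" "A \<inter> I = B \<inter> I" "A \<noteq> B"
    hence "(A,B) \<in> Pr" by (auto simp: Pr_def)
    hence "f \<notin> bad (A,B)" using f by auto
    then obtain i where "i < r" "f i \<in> sym_diff A B" using f by (auto simp: bad_def)
    hence "f i \<in> I" "f i \<in> sym_diff A B" by (auto simp: I_def)
    thus False using AB(3) by auto
  qed
  ultimately show ?thesis by blast
qed

text \<open>With \<open>r\<close> about \<open>2 * ln (card \<S>) / \<epsilon>\<close> coordinates the traces stay distinct, so the Sauer-Shelah bound applies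
  to a ground set of size \<open>r\<close>. The choice \<open>y = \<epsilon> / 4\<close> makes the exponent about half of \<open>ln (card \<S>)\<close>, which is
  absorbed on the left.\<close>

lemma packing_bound:
  assumes J: "finite J" "J \<noteq> {}" and S: "\<S> \<subseteq> Pow J" "\<S> \<noteq> {}" "separated (\<epsilon> * real (card J)) \<S>"
    and vc: "\<And>B. B \<subseteq> J \<Longrightarrow> shatters \<S> B \<Longrightarrow> card B \<le> v" and e: "0 < \<epsilon>" "\<epsilon> \<le> 1"
  shows "ln (real (card \<S>)) \<le> 2 * real v * ln (4 / \<epsilon>) + 1"
proof -
  define L where "L = ln (real (card \<S>))"
  \<comment> \<open>The smallest integer above \<open>2 * L / \<epsilon>\<close>, which makes the union bound strictly less than one.\<close>
  define r where "r = nat \<lfloor>2 * L / \<epsilon>\<rfloor> + 1"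
  have finS: "finite \<S>" using J S by (meson finite_Pow_iff finite_subset)
  have c1: "real (card \<S>) \<ge> 1" using finS S by (simp add: Suc_leI card_gt_0_iff)
  have L0: "L \<ge> 0" using c1 by (simp add: L_def)
  have r1: "real r > 2 * L / \<epsilon>" "real r \<le> 2 * L / \<epsilon> + 1"
    using L0 e unfolding r_def by (simp_all add: of_nat_nat) linarith+
  have expL: "exp L = real (card \<S>)" using c1 by (simp add: L_def)
  have "real (card \<S>)^2 * exp (- \<epsilon> * real r) = exp (2 * L - \<epsilon> * real r)"
    by (simp add: expL[symmetric] exp_add[symmetric] power2_eq_square)
  also have "\<dots> < 1" using r1(1) e by (simp add: field_simps)
  finally obtain I where I: "I \<subseteq> J" "card I \<le> r" "inj_on (\<lambda>A. A \<inter> I) \<S>"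
    using separating_coordinates[OF J S(1,3) _ e] by blast
  define T where "T = (\<lambda>A. A \<inter> I) ` \<S>"
  have finI: "finite I" using I J finite_subset by auto
  have cT: "card T = card \<S>" using I(3) by (simp add: T_def card_image)
  have "card B \<le> v" if B: "B \<subseteq> I" "shatters T B" for B
  proof (rule vc)
    show "B \<subseteq> J" using that I by auto
    show "shatters \<S> B" unfolding shatters_def
    proof (intro allI impI)
      fix C assume "C \<subseteq> B"
      then obtain A where "A \<in> \<S>" "A \<inter> I \<inter> B = C" using B unfolding shatters_def T_def by blast
      thus "\<exists>A\<in>\<S>. A \<inter> B = C" using B by (intro bexI[of _ A]) auto
    qed
  qed
  hence "real (card T) * (\<epsilon>/4) ^ v \<le> exp (\<epsilon>/4 * real (card I))"
    using e by (intro sauer_shelah_exp[OF finI]) (auto simp: T_def)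
  also have "\<dots> \<le> exp (\<epsilon>/4 * (2 * L / \<epsilon> + 1))"
    using I(2) r1(2) e by (auto intro!: mult_left_mono)
  finally have "ln (real (card T) * (\<epsilon>/4) ^ v) \<le> ln (exp (\<epsilon>/4 * (2 * L / \<epsilon> + 1)))"
    using c1 e cT by (subst ln_le_cancel_iff) auto
  hence "L + real v * ln (\<epsilon>/4) \<le> \<epsilon>/4 * (2 * L / \<epsilon> + 1)"
    using c1 e by (simp add: ln_mult ln_realpow cT L_def)
  also have "\<dots> = L / 2 + \<epsilon>/4" using e by (simp add: field_simps)
  also have "ln (\<epsilon>/4) = - ln (4/\<epsilon>)" using e by (simp add: ln_div)
  finally show ?thesis using e by (simp add: L_def)
qed

section \<open>Rademacher averages of VC classes\<close>

definition signs :: "'i set \<Rightarrow> ('i \<Rightarrow> real) set" where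
  "signs I = I \<rightarrow>\<^sub>E {-1, 1}"

definition sign_avg :: "'i set \<Rightarrow> (('i \<Rightarrow> real) \<Rightarrow> real) \<Rightarrow> real" where
  "sign_avg I f = (\<Sum>\<epsilon>\<in>signs I. f \<epsilon>) / 2 ^ card I"

lemma finite_signs: "finite I \<Longrightarrow> finite (signs I)"
  by (auto simp: signs_def intro: finite_PiE)

lemma card_signs: "finite I \<Longrightarrow> card (signs I) = 2 ^ card I"
  by (simp add: signs_def card_PiE numeral_2_eq_2)

lemma sign_avg_mono: "(\<And>\<epsilon>. \<epsilon> \<in> signs I \<Longrightarrow> f \<epsilon> \<le> g \<epsilon>) \<Longrightarrow> sign_avg I f \<le> sign_avg I g"
  by (auto simp: sign_avg_def intro!: divide_right_mono sum_mono)

lemma sign_avg_add: "sign_avg I (\<lambda>\<epsilon>. f \<epsilon> + g \<epsilon>) = sign_avg I f + sign_avg I g"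
  by (simp add: sign_avg_def sum.distrib add_divide_distrib)

lemma sign_avg_const: "finite I \<Longrightarrow> sign_avg I (\<lambda>_. c) = c"
  by (simp add: sign_avg_def card_signs)

lemma sign_avg_cmult: "sign_avg I (\<lambda>\<epsilon>. c * f \<epsilon>) = c * sign_avg I f"
  by (simp add: sign_avg_def sum_distrib_left)

lemma sign_avg_sum: "sign_avg I (\<lambda>\<epsilon>. \<Sum>q\<in>Q. f q \<epsilon>) = (\<Sum>q\<in>Q. sign_avg I (f q))"
  unfolding sign_avg_def by (subst sum.swap) (simp add: sum_divide_distrib)

lemma sign_avg_prod:
  "finite I \<Longrightarrow> sign_avg I (\<lambda>\<epsilon>. \<Prod>i\<in>I. h i (\<epsilon> i)) = (\<Prod>i\<in>I. (h i (-1) + h i 1) / 2)"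
proof -
  assume I: "finite I"
  have "(\<Sum>\<epsilon>\<in>signs I. \<Prod>i\<in>I. h i (\<epsilon> i)) = (\<Prod>i\<in>I. h i (-1) + h i 1)"
    unfolding signs_def using I by (subst prod_sum_PiE[symmetric]) auto
  thus ?thesis by (simp add: sign_avg_def prod_dividef)
qed

text \<open>The moment generating function of a random sign is at most that of a standard Gaussian. Both steps compare
  derivatives, first for \<open>sinh y \<le> y * cosh y\<close>.\<close>

lemma cosh_le_exp_half_square: "cosh x \<le> exp (x^2 / 2)" for x :: real
proof -
  have sinh_le: "sinh y \<le> y * cosh y" if "0 \<le> y" for y :: real
  proof -
    have "(\<lambda>y. y * cosh y - sinh y) 0 \<le> (\<lambda>y. y * cosh y - sinh y) y"
    proof (rule DERIV_nonneg_imp_nondecreasing[OF that])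
      fix u :: real assume "0 \<le> u" "u \<le> y"
      thus "\<exists>d. ((\<lambda>y. y * cosh y - sinh y) has_real_derivative d) (at u) \<and> 0 \<le> d"
        by (intro exI[of _ "u * sinh u"]) (auto intro!: derivative_eq_intros)
    qed
    thus ?thesis by simp
  qed
  have *: "cosh y \<le> exp (y^2 / 2)" if "0 \<le> y" for y :: real
  proof -
    have "(\<lambda>y. cosh y * exp (- (y^2 / 2))) y \<le> (\<lambda>y. cosh y * exp (- (y^2 / 2))) 0"
    proof (rule DERIV_nonpos_imp_nonincreasing[OF that])
      fix u :: real assume u: "0 \<le> u" "u \<le> y"
      have "(sinh u - u * cosh u) * exp (- (u^2 / 2)) \<le> 0"
        using sinh_le[OF u(1)] by (intro mult_nonpos_nonneg) auto
      thus "\<exists>d. ((\<lambda>y. cosh y * exp (- (y^2 / 2))) has_real_derivative d) (at u) \<and> d \<le> 0"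
        by (intro exI[of _ "(sinh u - u * cosh u) * exp (- (u^2 / 2))"])
          (auto intro!: derivative_eq_intros simp: algebra_simps)
    qed
    thus ?thesis by (simp add: exp_minus field_simps)
  qed
  show ?thesis using *[of x] *[of "- x"] by (cases "0 \<le> x") auto
qed

lemma sign_avg_exp_le:
  assumes "finite I"
  shows "sign_avg I (\<lambda>\<epsilon>. exp (s * (\<Sum>i\<in>I. \<epsilon> i * a i))) \<le> exp (s^2 * (\<Sum>i\<in>I. (a i)^2) / 2)"
proof -
  have "sign_avg I (\<lambda>\<epsilon>. exp (s * (\<Sum>i\<in>I. \<epsilon> i * a i))) = sign_avg I (\<lambda>\<epsilon>. \<Prod>i\<in>I. exp (s * \<epsilon> i * a i))"
    using assms by (simp add: sum_distrib_left exp_sum mult.assoc)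
  also have "\<dots> = (\<Prod>i\<in>I. (exp (s * (-1) * a i) + exp (s * 1 * a i)) / 2)"
    using sign_avg_prod[OF assms, of "\<lambda>i e. exp (s * e * a i)"] .
  also have "\<dots> = (\<Prod>i\<in>I. cosh (s * a i))" by (simp add: cosh_field_def add.commute)
  also have "\<dots> \<le> (\<Prod>i\<in>I. exp ((s * a i)^2 / 2))"
    by (intro prod_mono conjI cosh_le_exp_half_square cosh_real_nonneg)
  also have "\<dots> = exp (\<Sum>i\<in>I. (s * a i)^2 / 2)" using assms by (simp add: exp_sum)
  also have "(\<Sum>i\<in>I. (s * a i)^2 / 2) = s^2 * (\<Sum>i\<in>I. (a i)^2) / 2"
    by (simp add: power_mult_distrib sum_distrib_left sum_divide_distrib)
  finally show ?thesis .
qed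

lemma massart_maximal_inequality:
  assumes I: "finite I" and N: "finite N" "N \<noteq> {}" and \<sigma>: "0 < \<sigma>"
    and a: "\<And>b. b \<in> N \<Longrightarrow> (\<Sum>i\<in>I. (a b i)^2) \<le> \<sigma>^2"
  shows "sign_avg I (\<lambda>\<epsilon>. Max ((\<lambda>b. \<bar>\<Sum>i\<in>I. \<epsilon> i * a b i\<bar>) ` N)) \<le> \<sigma> * sqrt (2 * ln (2 * real (card N)))"
proof -
  define s where "s = sqrt (2 * ln (2 * real (card N)))"
  define l where "l = s / \<sigma>"
  define X where "X = (\<lambda>\<epsilon> b. \<Sum>i\<in>I. \<epsilon> i * a b i)"
  define M where "M = (\<lambda>\<epsilon>. Max ((\<lambda>b. \<bar>X \<epsilon> b\<bar>) ` N))"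
  have c1: "real (card N) \<ge> 1" using N by (simp add: Suc_leI card_gt_0_iff)
  hence ln0: "ln (2 * real (card N)) > 0" by simp
  have s0: "s > 0" using ln0 by (simp add: s_def)
  have s2: "s^2 = 2 * ln (2 * real (card N))" using ln0 by (simp add: s_def)
  have l0: "l > 0" using s0 \<sigma> by (simp add: l_def)
  have expM: "exp (l * M \<epsilon>) \<le> (\<Sum>b\<in>N. exp (l * X \<epsilon> b) + exp (- l * X \<epsilon> b))" for \<epsilon>
  proof -
    have "M \<epsilon> \<in> (\<lambda>b. \<bar>X \<epsilon> b\<bar>) ` N" unfolding M_def using N by (intro Max_in) auto
    then obtain b where b: "b \<in> N" "M \<epsilon> = \<bar>X \<epsilon> b\<bar>" by auto
    have "exp (l * M \<epsilon>) \<le> exp (l * X \<epsilon> b) + exp (- l * X \<epsilon> b)"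
      unfolding b(2) by (auto simp: abs_if add_increasing add_increasing2)
    also have "\<dots> \<le> (\<Sum>b\<in>N. exp (l * X \<epsilon> b) + exp (- l * X \<epsilon> b))"
      using b N by (intro member_le_sum[where f = "\<lambda>b. exp (l * X \<epsilon> b) + exp (- l * X \<epsilon> b)"]) (auto intro: add_nonneg_nonneg)
    finally show ?thesis .
  qed
  have each: "sign_avg I (\<lambda>\<epsilon>. exp (l' * X \<epsilon> b)) \<le> exp (s^2 / 2)" if "b \<in> N" "l'^2 = l^2" for b l'
  proof -
    have "sign_avg I (\<lambda>\<epsilon>. exp (l' * X \<epsilon> b)) \<le> exp (l'^2 * (\<Sum>i\<in>I. (a b i)^2) / 2)"
      unfolding X_def by (rule sign_avg_exp_le[OF I])
    also have "\<dots> \<le> exp (l^2 * \<sigma>^2 / 2)" using a[OF that(1)] that(2)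
      by (auto intro!: mult_left_mono)
    also have "l^2 * \<sigma>^2 = s^2" using \<sigma> by (simp add: l_def power_divide)
    finally show ?thesis .
  qed
  \<comment> \<open>Linearising by \<open>x \<le> exp (x - L) + L - 1\<close> replaces the concavity of the logarithm.\<close>
  have "sign_avg I (\<lambda>\<epsilon>. l * M \<epsilon>) \<le>
      sign_avg I (\<lambda>\<epsilon>. (s^2 - 1) + exp (- (s^2)) * (\<Sum>b\<in>N. exp (l * X \<epsilon> b) + exp (- l * X \<epsilon> b)))"
  proof (rule sign_avg_mono)
    fix \<epsilon>
    have "l * M \<epsilon> - s^2 + 1 \<le> exp (l * M \<epsilon> - s^2)" using exp_ge_add_one_self[of "l * M \<epsilon> - s^2"] by linarith
    also have "\<dots> = exp (- (s^2)) * exp (l * M \<epsilon>)" by (simp add: exp_add[symmetric])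
    also have "\<dots> \<le> exp (- (s^2)) * (\<Sum>b\<in>N. exp (l * X \<epsilon> b) + exp (- l * X \<epsilon> b))"
      using expM by (intro mult_left_mono) auto
    finally show "l * M \<epsilon> \<le> (s^2 - 1) + exp (- (s^2)) * (\<Sum>b\<in>N. exp (l * X \<epsilon> b) + exp (- l * X \<epsilon> b))"
      by simp
  qed
  also have "\<dots> = (s^2 - 1) + exp (- (s^2)) *
      (\<Sum>b\<in>N. sign_avg I (\<lambda>\<epsilon>. exp (l * X \<epsilon> b)) + sign_avg I (\<lambda>\<epsilon>. exp (- l * X \<epsilon> b)))"
    by (simp only: sign_avg_add sign_avg_const[OF I] sign_avg_cmult sign_avg_sum)
  also have "\<dots> \<le> (s^2 - 1) + exp (- (s^2)) * (\<Sum>b\<in>N. exp (s^2/2) + exp (s^2/2))"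
    by (intro add_mono mult_left_mono sum_mono each order_refl) auto
  also have "(\<Sum>b\<in>N. exp (s^2/2) + exp (s^2/2)) = 2 * real (card N) * exp (s^2 / 2)" by simp
  also have "2 * real (card N) = exp (s^2 / 2)" using c1 by (simp add: s2)
  also have "exp (- (s^2)) * (exp (s^2 / 2) * exp (s^2 / 2)) = 1" by (simp add: exp_add[symmetric])
  finally have "l * sign_avg I M \<le> s^2" by (simp add: sign_avg_cmult)
  hence "sign_avg I M \<le> s^2 / l" using l0 by (simp add: field_simps)
  also have "\<dots> = \<sigma> * s" using s0 \<sigma> by (simp add: l_def power2_eq_square)
  finally show ?thesis by (simp add: M_def X_def s_def)
qed

lemma shatters_mono: "shatters \<A> B \<Longrightarrow> \<A> \<subseteq> \<B> \<Longrightarrow> shatters \<B> B"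
  unfolding shatters_def by (meson subsetD)

lemma card_sym_diff_sum:
  assumes "finite I" "A \<subseteq> I" "B \<subseteq> I"
  shows "(\<Sum>i\<in>I. (of_bool (i \<in> A) - of_bool (i \<in> B) :: real)^2) = real (card (sym_diff A B))"
proof -
  define D where "D = sym_diff A B"
  have "(\<Sum>i\<in>I. (of_bool (i \<in> A) - of_bool (i \<in> B) :: real)^2) = (\<Sum>i\<in>I. of_bool (i \<in> D))"
    by (intro sum.cong) (auto simp: D_def)
  also have "\<dots> = real (card (I \<inter> D))" using assms by (simp add: sum_of_bool_eq)
  also have "I \<inter> D = D" using assms by (auto simp: D_def)
  finally show ?thesis by (simp only: D_def)
qed

lemma sum_restrict_of_bool:
  fixes \<epsilon> :: "'i \<Rightarrow> real"
  assumes "finite I" "A \<subseteq> I"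
  shows "(\<Sum>i\<in>A. \<epsilon> i) = (\<Sum>i\<in>I. \<epsilon> i * of_bool (i \<in> A))"
proof -
  have "(\<Sum>i\<in>I. \<epsilon> i * of_bool (i \<in> A)) = (\<Sum>i\<in>I. if i \<in> A then \<epsilon> i else 0)"
    by (intro sum.cong) auto
  also have "\<dots> = (\<Sum>i\<in>I \<inter> A. \<epsilon> i)" using assms by (simp add: sum.inter_restrict)
  also have "I \<inter> A = A" using assms by auto
  finally show ?thesis ..
qed

text \<open>A maximal separated subfamily is automatically a net of the same radius.\<close>

lemma maximal_separated_subset:
  assumes "finite \<S>" "\<S> \<noteq> {}" "0 \<le> r"
  obtains \<S>' where "\<S>' \<subseteq> \<S>" "\<S>' \<noteq> {}" "separated r \<S>'"
    "\<And>A. A \<in> \<S> \<Longrightarrow> \<exists>B\<in>\<S>'. real (card (sym_diff A B)) \<le> r"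
proof -
  define Q where "Q = {U. U \<subseteq> \<S> \<and> U \<noteq> {} \<and> separated r U}"
  obtain A0 where "A0 \<in> \<S>" using assms by auto
  hence "{A0} \<in> Q" by (auto simp: Q_def separated_def)
  moreover have "finite Q" using assms by (auto simp: Q_def)
  ultimately obtain U where U: "U \<in> Q" "\<And>U'. U' \<in> Q \<Longrightarrow> U \<subseteq> U' \<Longrightarrow> U = U'"
    using finite_has_maximal[of Q] by blast
  have "\<exists>B\<in>U. real (card (sym_diff A B)) \<le> r" if A: "A \<in> \<S>" for A
  proof (rule ccontr)
    assume *: "\<not> (\<exists>B\<in>U. real (card (sym_diff A B)) \<le> r)"
    have sym: "sym_diff B A = sym_diff A B" for B by auto
    have "separated r (insert A U)"
      unfolding separated_def
    proof (intro ballI impI)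
      fix B C assume BC: "B \<in> insert A U" "C \<in> insert A U" "B \<noteq> C"
      have far: "r < real (card (sym_diff A D))" if "D \<in> U" for D
        using * that by (meson not_le)
      show "r < real (card (sym_diff B C))"
      proof (cases "B \<in> U \<and> C \<in> U")
        case True
        thus ?thesis using U(1) BC(3) by (simp add: Q_def separated_def)
      next
        case False
        hence "(B = A \<and> C \<in> U) \<or> (C = A \<and> B \<in> U)" using BC by blast
        thus ?thesis using far sym by metis
      qed
    qed
    hence "insert A U \<in> Q" using U(1) A by (auto simp: Q_def)
    hence "A \<in> U" using U(2)[of "insert A U"] by auto
    moreover have "sym_diff A A = {}" by simp
    ultimately show False using * assms(3) by force
  qed
  thus thesis using U(1) that by (auto simp: Q_def)
qed

lemma ln_packing_le:
  assumes J: "finite J" "J \<noteq> {}" and S: "\<S> \<subseteq> Pow J" "\<S> \<noteq> {}" "separated (real (card J) / 4 ^ j) \<S>"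
    and vc: "\<And>B. B \<subseteq> J \<Longrightarrow> shatters \<S> B \<Longrightarrow> card B \<le> v"
  shows "ln (2 * real (card \<S>)) \<le> 3 * (real v + 1) * (real j + 1)"
proof -
  have finS: "finite \<S>" using J S by (meson finite_Pow_iff finite_subset)
  have c1: "real (card \<S>) \<ge> 1" using finS S by (simp add: Suc_leI card_gt_0_iff)
  have ln4: "ln (4::real) \<le> 3/2"
  proof -
    have "ln (4::real) = 2 * ln 2" using ln_realpow[of 2 2] by simp
    thus ?thesis using ln2_le_25_over_36 by simp
  qed
  have "ln (real (card \<S>)) \<le> 2 * real v * ln (4 / (1 / 4 ^ j)) + 1"
    using J S vc by (intro packing_bound) auto
  also have "ln (4 / (1 / 4 ^ j)) = (real j + 1) * ln (4::real)"
    using ln_realpow[of "4::real" "Suc j"] by (simp add: field_simps)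
  also have "2 * real v * ((real j + 1) * ln 4) \<le> 2 * real v * ((real j + 1) * (3/2))"
    using ln4 by (intro mult_left_mono) auto
  finally have "ln (real (card \<S>)) \<le> 3 * real v * (real j + 1) + 1" by (simp add: field_simps)
  moreover have "ln (2 * real (card \<S>)) = ln 2 + ln (real (card \<S>))" using c1 by (simp add: ln_mult)
  moreover have "real v * (real j + 1) \<ge> 0" by simp
  ultimately show ?thesis using ln2_le_25_over_36 by (simp add: algebra_simps)
qed

text \<open>Chaining, as an induction on the level: a family that is separated at level \<open>j + 1\<close> is linked to a maximal
  subfamily separated at level \<open>j\<close>. The links have squared length at most \<open>card J / 4 ^ j\<close> and there are as many
  as members, so the maximal inequality costs a term of order \<open>(j + 2) / 2 ^ j\<close>. The constant
  \<open>7 - (2 * j + 6) / 2 ^ j\<close> is the base term \<open>1\<close> plus the sum of \<open>(i + 2) / 2 ^ i\<close> over \<open>i < j\<close>.\<close>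

lemma sign_avg_Max_separated:
  fixes I :: "'i set"
  assumes I: "finite I" "J \<subseteq> I" "J \<noteq> {}" and S: "\<S> \<subseteq> Pow J" "\<S> \<noteq> {}" "separated (real (card J) / 4 ^ j) \<S>"
    and vc: "\<And>B. B \<subseteq> J \<Longrightarrow> shatters \<S> B \<Longrightarrow> card B \<le> v"
  shows "sign_avg I (\<lambda>\<epsilon>. Max ((\<lambda>A. \<bar>\<Sum>i\<in>A. \<epsilon> i\<bar>) ` \<S>)) \<le>
    sqrt (6 * (real v + 1) * real (card J)) * (7 - (2 * real j + 6) / 2 ^ j)"
  using S vc
proof (induction j arbitrary: \<S>)
  have J: "finite J" using I finite_subset by blast
  have cJ: "real (card J) > 0" using J I by (simp add: card_gt_0_iff)
  case 0
  have finS: "finite \<S>" using J 0 by (meson finite_Pow_iff finite_subset)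
  have "A = B" if AB: "A \<in> \<S>" "B \<in> \<S>" for A B
  proof (rule ccontr)
    assume "A \<noteq> B"
    hence "real (card (sym_diff A B)) > real (card J)" using 0 AB by (auto simp: separated_def)
    moreover have "card (sym_diff A B) \<le> card J"
      using AB 0 J by (intro card_mono) auto
    ultimately show False by simp
  qed
  then obtain A where A: "\<S> = {A}" "A \<subseteq> J" using 0(1,2) by blast
  define a where "a = (\<lambda>(b::'i set) i. of_bool (i \<in> A) :: real)"
  have "sign_avg I (\<lambda>\<epsilon>. Max ((\<lambda>b. \<bar>\<Sum>i\<in>I. \<epsilon> i * a b i\<bar>) ` {A})) \<le>
      sqrt (real (card J)) * sqrt (2 * ln (2 * real (card {A})))"
  proof (rule massart_maximal_inequality[OF I(1)])
    show "(\<Sum>i\<in>I. (a b i)\<^sup>2) \<le> (sqrt (real (card J)))\<^sup>2" for b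
      using card_sym_diff_sum[of I A "{}"] I A card_mono[OF J, of A]
      by (auto simp: a_def)
  qed (use cJ in auto)
  also have "(\<lambda>\<epsilon>. Max ((\<lambda>b. \<bar>\<Sum>i\<in>I. \<epsilon> i * a b i\<bar>) ` {A})) = (\<lambda>\<epsilon>. Max ((\<lambda>A. \<bar>\<Sum>i\<in>A. \<epsilon> i\<bar>) ` \<S>))"
    using A I sum_restrict_of_bool[of I A] by (auto simp: a_def)
  also have "sqrt (real (card J)) * sqrt (2 * ln (2 * real (card {A}))) = sqrt (real (card J) * (2 * ln 2))"
    by (simp add: real_sqrt_mult)
  also have "\<dots> \<le> sqrt (real (card J) * (6 * (real v + 1)))"
    using ln2_le_25_over_36 by (intro real_sqrt_le_mono mult_left_mono) auto
  finally show ?case by (simp add: mult.commute mult.left_commute)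
next
  have J: "finite J" using I finite_subset by blast
  have cJ: "real (card J) > 0" using J I by (simp add: card_gt_0_iff)
  case (Suc j)
  let ?c = "sqrt (6 * (real v + 1) * real (card J))"
  have finS: "finite \<S>" using J Suc.prems by (meson finite_Pow_iff finite_subset)
  obtain \<S>' where S': "\<S>' \<subseteq> \<S>" "\<S>' \<noteq> {}" "separated (real (card J) / 4 ^ j) \<S>'"
    "\<And>A. A \<in> \<S> \<Longrightarrow> \<exists>B\<in>\<S>'. real (card (sym_diff A B)) \<le> real (card J) / 4 ^ j"
    using maximal_separated_subset[OF finS Suc.prems(2), of "real (card J) / 4 ^ j"] by auto
  then obtain p where p: "\<And>A. A \<in> \<S> \<Longrightarrow> p A \<in> \<S>'"
    "\<And>A. A \<in> \<S> \<Longrightarrow> real (card (sym_diff A (p A))) \<le> real (card J) / 4 ^ j" by metis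
  define X :: "('i \<Rightarrow> real) \<Rightarrow> 'i set \<Rightarrow> real" where "X = (\<lambda>\<epsilon> A. \<Sum>i\<in>A. \<epsilon> i)"
  define a where "a = (\<lambda>A i. of_bool (i \<in> A) - of_bool (i \<in> p A) :: real)"
  have sub: "A \<subseteq> I" "p A \<subseteq> I" if "A \<in> \<S>" for A
    using that p(1)[OF that] S'(1) Suc.prems(1) I(2) by auto
  have finS': "finite \<S>'" by (rule finite_subset[OF S'(1) finS])
  have Xa: "(\<Sum>i\<in>I. \<epsilon> i * a A i) = X \<epsilon> A - X \<epsilon> (p A)" if "A \<in> \<S>" for A \<epsilon>
    unfolding X_def sum_restrict_of_bool[OF I(1) sub(1)[OF that]] sum_restrict_of_bool[OF I(1) sub(2)[OF that]]
    by (simp add: a_def right_diff_distrib sum_subtractf)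
  have "sign_avg I (\<lambda>\<epsilon>. Max ((\<lambda>A. \<bar>X \<epsilon> A\<bar>) ` \<S>)) \<le>
    sign_avg I (\<lambda>\<epsilon>. Max ((\<lambda>A. \<bar>X \<epsilon> A\<bar>) ` \<S>') + Max ((\<lambda>A. \<bar>\<Sum>i\<in>I. \<epsilon> i * a A i\<bar>) ` \<S>))"
  proof (rule sign_avg_mono)
    fix \<epsilon>
    show "Max ((\<lambda>A. \<bar>X \<epsilon> A\<bar>) ` \<S>) \<le> Max ((\<lambda>A. \<bar>X \<epsilon> A\<bar>) ` \<S>') + Max ((\<lambda>A. \<bar>\<Sum>i\<in>I. \<epsilon> i * a A i\<bar>) ` \<S>)"
    proof (rule Max.boundedI)
      fix y assume "y \<in> (\<lambda>A. \<bar>X \<epsilon> A\<bar>) ` \<S>"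
      then obtain A where A: "A \<in> \<S>" "y = \<bar>X \<epsilon> A\<bar>" by auto
      have "y \<le> \<bar>X \<epsilon> (p A)\<bar> + \<bar>\<Sum>i\<in>I. \<epsilon> i * a A i\<bar>" using Xa[OF A(1)] A(2) by simp
      also have "\<dots> \<le> Max ((\<lambda>A. \<bar>X \<epsilon> A\<bar>) ` \<S>') + Max ((\<lambda>A. \<bar>\<Sum>i\<in>I. \<epsilon> i * a A i\<bar>) ` \<S>)"
        using A p finS finS' by (intro add_mono Max_ge) auto
      finally show "y \<le> \<dots>" .
    qed (use finS Suc.prems(2) in auto)
  qed
  also have "\<dots> = sign_avg I (\<lambda>\<epsilon>. Max ((\<lambda>A. \<bar>X \<epsilon> A\<bar>) ` \<S>')) +
      sign_avg I (\<lambda>\<epsilon>. Max ((\<lambda>A. \<bar>\<Sum>i\<in>I. \<epsilon> i * a A i\<bar>) ` \<S>))" by (rule sign_avg_add)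
  also have "sign_avg I (\<lambda>\<epsilon>. Max ((\<lambda>A. \<bar>X \<epsilon> A\<bar>) ` \<S>')) \<le> ?c * (7 - (2 * real j + 6) / 2 ^ j)"
    unfolding X_def
  proof (rule Suc.IH)
    show "\<S>' \<subseteq> Pow J" using S'(1) Suc.prems(1) by (rule subset_trans)
    show "\<S>' \<noteq> {}" "separated (real (card J) / 4 ^ j) \<S>'" by (fact S'(2), fact S'(3))
    show "card B \<le> v" if B: "B \<subseteq> J" "shatters \<S>' B" for B
    proof (rule Suc.prems(4)[OF B(1)])
      show "shatters \<S> B" by (rule shatters_mono[OF B(2) S'(1)])
    qed
  qed
  also have "sign_avg I (\<lambda>\<epsilon>. Max ((\<lambda>A. \<bar>\<Sum>i\<in>I. \<epsilon> i * a A i\<bar>) ` \<S>)) \<le>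
      sqrt (real (card J) / 4 ^ j) * sqrt (2 * ln (2 * real (card \<S>)))"
  proof (rule massart_maximal_inequality[OF I(1) finS Suc.prems(2)])
    show "(\<Sum>i\<in>I. (a A i)\<^sup>2) \<le> (sqrt (real (card J) / 4 ^ j))\<^sup>2" if "A \<in> \<S>" for A
      using p(2)[OF that] card_sym_diff_sum[OF I(1) sub[OF that]] by (simp add: a_def)
  qed (use cJ in auto)
  also have "\<dots> \<le> sqrt (real (card J) / 4 ^ j) * sqrt (2 * (3 * (real v + 1) * (real (Suc j) + 1)))"
    using ln_packing_le[OF J I(3) Suc.prems(1-3)] Suc.prems(4)
    by (intro mult_left_mono real_sqrt_le_mono) auto
  also have "\<dots> = ?c * (sqrt (real j + 2) / 2 ^ j)"
  proof -
    have "(2 ^ j)\<^sup>2 = (2\<^sup>2 :: real) ^ j" by (simp only: power_mult[symmetric] mult.commute)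
    hence "sqrt (4 ^ j) = (2 ^ j :: real)" by (intro real_sqrt_unique) auto
    hence "sqrt (real (card J) / 4 ^ j) = sqrt (real (card J)) / 2 ^ j" by (simp only: real_sqrt_divide)
    moreover have "sqrt (real (card J)) * sqrt (2 * (3 * (real v + 1) * (real (Suc j) + 1))) = ?c * sqrt (real j + 2)"
      by (simp only: real_sqrt_mult[symmetric]) (simp add: algebra_simps)
    ultimately show ?thesis by simp
  qed
  also have "\<dots> \<le> ?c * ((real j + 2) / 2 ^ j)"
  proof (intro mult_left_mono divide_right_mono)
    show "sqrt (real j + 2) \<le> real j + 2" by (rule real_le_lsqrt) (auto simp: power2_eq_square algebra_simps)
  qed auto
  finally have "sign_avg I (\<lambda>\<epsilon>. Max ((\<lambda>A. \<bar>X \<epsilon> A\<bar>) ` \<S>)) \<le>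
      ?c * (7 - (2 * real j + 6) / 2 ^ j) + ?c * ((real j + 2) / 2 ^ j)" by simp
  also have "\<dots> = ?c * (7 - (2 * real (Suc j) + 6) / 2 ^ Suc j)"
    by (simp add: field_simps)
  finally show ?case by (simp add: X_def)
qed

text \<open>At a level \<open>j\<close> with \<open>card J < 4 ^ j\<close> every family is separated, since distinct sets differ in at least one
  point.\<close>

lemma sign_avg_Max_vc:
  assumes I: "finite I" "J \<subseteq> I" and S: "\<S> \<subseteq> Pow J" "\<S> \<noteq> {}"
    and vc: "\<And>B. B \<subseteq> J \<Longrightarrow> shatters \<S> B \<Longrightarrow> card B \<le> v"
  shows "sign_avg I (\<lambda>\<epsilon>. Max ((\<lambda>A. \<bar>\<Sum>i\<in>A. \<epsilon> i\<bar>) ` \<S>)) \<le> 18 * sqrt ((real v + 1) * real (card J))"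
proof (cases "J = {}")
  case True
  hence "\<S> = {{}}" using S by auto
  thus ?thesis using I True by (simp add: sign_avg_const)
next
  case False
  have J: "finite J" using I finite_subset by blast
  obtain j where j: "real (card J) < 4 ^ j" using real_arch_pow[of 4 "real (card J)"] by auto
  have "separated (real (card J) / 4 ^ j) \<S>" unfolding separated_def
  proof (intro ballI impI)
    fix A B assume AB: "A \<in> \<S>" "B \<in> \<S>" "A \<noteq> B"
    have "finite (sym_diff A B)" "sym_diff A B \<noteq> {}"
      using AB S J by (auto dest: finite_subset)
    hence "card (sym_diff A B) \<ge> 1" by (simp add: Suc_leI card_gt_0_iff)
    moreover have "real (card J) / 4 ^ j < 1" using j by simp
    ultimately show "real (card J) / 4 ^ j < real (card (sym_diff A B))" by linarith
  qed
  hence "sign_avg I (\<lambda>\<epsilon>. Max ((\<lambda>A. \<bar>\<Sum>i\<in>A. \<epsilon> i\<bar>) ` \<S>)) \<le>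
    sqrt (6 * (real v + 1) * real (card J)) * (7 - (2 * real j + 6) / 2 ^ j)"
    using assms False by (intro sign_avg_Max_separated) auto
  also have "\<dots> \<le> sqrt (6 * (real v + 1) * real (card J)) * 7"
    by (intro mult_left_mono) auto
  also have "\<dots> = sqrt (6 * (real v + 1) * real (card J)) * sqrt (7^2)" by simp
  also have "\<dots> = sqrt ((6 * 7^2) * ((real v + 1) * real (card J)))"
    by (subst real_sqrt_mult[symmetric]) (simp add: algebra_simps)
  also have "\<dots> \<le> sqrt (18^2 * ((real v + 1) * real (card J)))"
    by (intro real_sqrt_le_mono mult_right_mono) auto
  also have "\<dots> = 18 * sqrt ((real v + 1) * real (card J))" by (subst real_sqrt_mult) simp
  finally show ?thesis .
qed

lemma threshold_average:
  fixes x :: real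
  assumes "0 \<le> x" "x \<le> 1" "0 < Q"
  shows "\<bar>(\<Sum>q<Q. of_bool (real q / real Q < x)) / real Q - x\<bar> \<le> 1 / real Q"
proof -
  have "q < Q \<and> real q / real Q < x \<longleftrightarrow> q < nat \<lceil>real Q * x\<rceil>" for q
  proof -
    have "real q / real Q < x \<longleftrightarrow> real q < real Q * x" using assms by (simp add: field_simps)
    also have "\<dots> \<longleftrightarrow> q < nat \<lceil>real Q * x\<rceil>" by linarith
    finally have *: "real q / real Q < x \<longleftrightarrow> q < nat \<lceil>real Q * x\<rceil>" .
    have "real Q * x \<le> real Q" using assms by (simp add: mult_left_le)
    hence "nat \<lceil>real Q * x\<rceil> \<le> Q" by linarith
    thus ?thesis using * by (meson less_le_trans)
  qed
  hence "{..<Q} \<inter> {q. real q / real Q < x} = {..<nat \<lceil>real Q * x\<rceil>}" by auto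
  hence "(\<Sum>q<Q. of_bool (real q / real Q < x)) = real (nat \<lceil>real Q * x\<rceil>)"
    by (simp add: sum_of_bool_eq)
  also have "\<dots> = of_int \<lceil>real Q * x\<rceil>" using assms by simp
  finally have "\<bar>(\<Sum>q<Q. of_bool (real q / real Q < x)) - real Q * x\<bar> \<le> 1" by linarith
  hence "\<bar>(\<Sum>q<Q. of_bool (real q / real Q < x)) - real Q * x\<bar> / real Q \<le> 1 / real Q"
    using assms by (intro divide_right_mono) auto
  moreover have "(\<Sum>q<Q. of_bool (real q / real Q < x)) / real Q - x =
      ((\<Sum>q<Q. of_bool (real q / real Q < x)) - real Q * x) / real Q" using assms by (simp add: field_simps)
  ultimately show ?thesis using assms by (simp add: abs_divide)
qed

text \<open>A function with values in \<open>[0, 1]\<close> is, up to \<open>1 / Q\<close>, the average of the indicators of its level sets at the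
  heights \<open>q / Q\<close>. The supremum of an average is at most the average of the suprema, and for each fixed height
  the level sets form a VC class. With \<open>Q = card J\<close> the discretization costs \<open>1\<close> in total.\<close>

lemma sign_avg_SUP_functions:
  fixes f :: "'g \<Rightarrow> 'i \<Rightarrow> real"
  assumes I: "finite I" "J \<subseteq> I" and G: "G \<noteq> {}" and f: "\<And>g i. g \<in> G \<Longrightarrow> i \<in> J \<Longrightarrow> 0 \<le> f g i \<and> f g i \<le> 1"
    and vc: "\<And>s B. B \<subseteq> J \<Longrightarrow> shatters ((\<lambda>g. {i \<in> J. s < f g i}) ` G) B \<Longrightarrow> card B \<le> v"
  shows "sign_avg I (\<lambda>\<epsilon>. SUP g\<in>G. \<bar>\<Sum>i\<in>J. \<epsilon> i * f g i\<bar>) \<le> 19 * sqrt ((real v + 1) * real (card J))"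
proof (cases "J = {}")
  case True
  thus ?thesis using I G by (simp add: sign_avg_const)
next
  case False
  have J: "finite J" using I finite_subset by blast
  define Q where "Q = card J"
  have Q: "0 < Q" using False J by (simp add: Q_def card_gt_0_iff)
  define L where "L = (\<lambda>q::nat. (\<lambda>g. {i \<in> J. real q / real Q < f g i}) ` G)"
  define M where "M = (\<lambda>\<epsilon> q. Max ((\<lambda>A. \<bar>\<Sum>i\<in>A. \<epsilon> i\<bar>) ` L q) :: real)"
  have LJ: "L q \<subseteq> Pow J" for q by (auto simp: L_def)
  have finL: "finite (L q)" for q using LJ J by (meson finite_Pow_iff finite_subset)
  have "sign_avg I (\<lambda>\<epsilon>. SUP g\<in>G. \<bar>\<Sum>i\<in>J. \<epsilon> i * f g i\<bar>) \<le>
      sign_avg I (\<lambda>\<epsilon>. 1 / real Q * (\<Sum>q<Q. M \<epsilon> q) + 1)"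
  proof (intro sign_avg_mono cSUP_least[OF G])
    fix \<epsilon> g assume \<epsilon>: "\<epsilon> \<in> signs I" and g: "g \<in> G"
    define A where "A = (\<lambda>q. {i \<in> J. real q / real Q < f g i})"
    define h where "h = (\<lambda>i. (\<Sum>q<Q. of_bool (real q / real Q < f g i)) / real Q)"
    have abs\<epsilon>: "\<bar>\<epsilon> i\<bar> = 1" if "i \<in> J" for i
    proof -
      have "\<epsilon> i \<in> {-1, 1}" using \<epsilon> that I by (auto simp: signs_def PiE_def Pi_def)
      thus ?thesis by auto
    qed
    have "\<bar>\<Sum>i\<in>J. \<epsilon> i * (h i - f g i)\<bar> \<le> (\<Sum>i\<in>J. 1 / real Q)"
    proof (rule order_trans[OF sum_abs sum_mono])
      fix i assume i: "i \<in> J"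
      show "\<bar>\<epsilon> i * (h i - f g i)\<bar> \<le> 1 / real Q"
        using threshold_average[of "f g i" Q] f[OF g i] Q abs\<epsilon>[OF i] by (simp add: abs_mult h_def)
    qed
    also have "\<dots> = 1" using Q by (simp add: Q_def)
    finally have 1: "\<bar>\<Sum>i\<in>J. \<epsilon> i * f g i\<bar> \<le> \<bar>\<Sum>i\<in>J. \<epsilon> i * h i\<bar> + 1"
      by (simp add: right_diff_distrib sum_subtractf)
    have "(\<Sum>i\<in>J. \<epsilon> i * h i) = (\<Sum>i\<in>J. \<Sum>q<Q. \<epsilon> i * of_bool (real q / real Q < f g i)) / real Q"
      by (simp add: h_def sum_distrib_left sum_divide_distrib mult.commute)
    also have "(\<Sum>i\<in>J. \<Sum>q<Q. \<epsilon> i * of_bool (real q / real Q < f g i)) =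
       (\<Sum>q<Q. \<Sum>i\<in>J. \<epsilon> i * of_bool (i \<in> A q))"
      by (subst sum.swap) (auto intro!: sum.cong simp: A_def)
    also have "\<dots> = (\<Sum>q<Q. \<Sum>i\<in>A q. \<epsilon> i)"
      by (intro sum.cong sum_restrict_of_bool[OF J, symmetric]) (auto simp: A_def)
    finally have "\<bar>\<Sum>i\<in>J. \<epsilon> i * h i\<bar> = \<bar>\<Sum>q<Q. \<Sum>i\<in>A q. \<epsilon> i\<bar> / real Q" by (simp add: abs_divide)
    also have "\<dots> \<le> (\<Sum>q<Q. M \<epsilon> q) / real Q"
    proof (intro divide_right_mono order_trans[OF sum_abs sum_mono])
      fix q
      show "\<bar>\<Sum>i\<in>A q. \<epsilon> i\<bar> \<le> M \<epsilon> q" unfolding M_def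
        using finL g by (intro Max_ge) (auto simp: L_def A_def)
    qed simp
    finally show "\<bar>\<Sum>i\<in>J. \<epsilon> i * f g i\<bar> \<le> 1 / real Q * (\<Sum>q<Q. M \<epsilon> q) + 1" using 1 by simp
  qed
  also have "\<dots> = 1 / real Q * (\<Sum>q<Q. sign_avg I (\<lambda>\<epsilon>. M \<epsilon> q)) + 1"
    by (simp only: sign_avg_add sign_avg_const[OF I(1)] sign_avg_cmult sign_avg_sum)
  also have "\<dots> \<le> 1 / real Q * (\<Sum>q<Q. 18 * sqrt ((real v + 1) * real (card J))) + 1"
    unfolding M_def using G I vc LJ
    by (intro add_mono mult_left_mono sum_mono sign_avg_Max_vc) (auto simp: L_def)
  also have "\<dots> = 18 * sqrt ((real v + 1) * real (card J)) + 1" using Q by simp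
  finally have "sign_avg I (\<lambda>\<epsilon>. SUP g\<in>G. \<bar>\<Sum>i\<in>J. \<epsilon> i * f g i\<bar>) \<le> 18 * sqrt ((real v + 1) * real (card J)) + 1" .
  moreover have "1 * 1 \<le> (real v + 1) * real (card J)" using Q by (intro mult_mono) (auto simp: Q_def)
  hence "1 \<le> sqrt ((real v + 1) * real (card J))" by simp
  ultimately show ?thesis by linarith
qed

text \<open>Level sets at a fixed height \<open>s\<close> are sections of the subgraphs. A repeated point cannot be shattered, so \<open>z\<close>
  is injective on a shattered index set.\<close>

lemma level_sets_vc_dim:
  assumes vc: "vc_dim (subgraphs A F) \<le> enat v" and z: "\<And>i. i \<in> J \<Longrightarrow> z i \<in> A"
    and B: "finite B" "B \<subseteq> J" and sh: "shatters ((\<lambda>f. {i \<in> J. s < f (z i)}) ` F) B"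
  shows "card B \<le> v"
proof -
  have inj: "inj_on z B"
  proof (rule inj_onI, rule ccontr)
    fix i j assume ij: "i \<in> B" "j \<in> B" "z i = z j" "i \<noteq> j"
    have "{i} \<subseteq> B" using ij by auto
    then obtain f where "f \<in> F" and f: "{i \<in> J. s < f (z i)} \<inter> B = {i}" using sh unfolding shatters_def by blast
    have "i \<in> {i \<in> J. s < f (z i)} \<inter> B" using f by simp
    hence "j \<in> {i \<in> J. s < f (z i)} \<inter> B" using ij B(2) by auto
    thus False using ij(4) unfolding f by simp
  qed
  define B' where "B' = (\<lambda>i. (z i, s)) ` B"
  have "shatters (subgraphs A F) B'" unfolding shatters_def
  proof (intro allI impI)
    fix C assume C: "C \<subseteq> B'"
    define D where "D = {i \<in> B. (z i, s) \<in> C}"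
    have "D \<subseteq> B" by (auto simp: D_def)
    then obtain f where f: "f \<in> F" "{i \<in> J. s < f (z i)} \<inter> B = D" using sh unfolding shatters_def by blast
    have "{(x, s). x \<in> A \<and> s < f x} \<inter> B' = C"
    proof (intro equalityI subsetI)
      fix p assume "p \<in> {(x, s). x \<in> A \<and> s < f x} \<inter> B'"
      then obtain i where i: "i \<in> B" "p = (z i, s)" "s < f (z i)" by (auto simp: B'_def)
      hence "i \<in> D" using f(2) B by blast
      thus "p \<in> C" using i by (simp add: D_def)
    next
      fix p assume p: "p \<in> C"
      then obtain i where i: "i \<in> B" "p = (z i, s)" using C by (auto simp: B'_def)
      hence "i \<in> D" using p by (simp add: D_def)
      hence "s < f (z i)" using f(2) by blast
      thus "p \<in> {(x, s). x \<in> A \<and> s < f x} \<inter> B'" using i z B by (auto simp: B'_def)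
    qed
    thus "\<exists>A\<in>subgraphs A F. A \<inter> B' = C" using f(1) unfolding subgraphs_def by blast
  qed
  moreover have "finite B'" using B by (simp add: B'_def)
  ultimately have "enat (card B') \<le> vc_dim (subgraphs A F)"
    unfolding vc_dim_def by (intro SUP_upper) auto
  moreover have "card B' = card B"
    unfolding B'_def using inj by (intro card_image) (auto simp: inj_on_def)
  ultimately show ?thesis using vc by (metis enat_ord_simps(1) order_trans)
qed

section \<open>Independent samples\<close>

lemma (in prob_space) integrable_bounded_real:
  fixes f :: "'a \<Rightarrow> real"
  assumes "f \<in> borel_measurable M" "\<And>x. x \<in> space M \<Longrightarrow> \<bar>f x\<bar> \<le> B"
  shows "integrable M f"
  by (rule integrable_const_bound[of _ B]) (use assms in auto)

lemma (in prob_space) integrable_in_interval: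
  fixes f :: "'a \<Rightarrow> real"
  assumes "f \<in> borel_measurable M" "\<And>x. x \<in> space M \<Longrightarrow> 0 \<le> f x \<and> f x \<le> b"
  shows "integrable M f"
  using assms by (intro integrable_bounded_real[of f b]) (auto simp: abs_le_iff intro: order_trans[of _ 0])

lemma (in prob_space) prob_space_power: "prob_space (Pi\<^sub>M I (\<lambda>_. M))"
  by (intro prob_space_PiM prob_space_axioms)

lemma (in prob_space) distr_reindex_power:
  assumes "inj_on \<pi> K" "\<pi> \<in> K \<rightarrow> I"
  shows "distr (Pi\<^sub>M I (\<lambda>_. M)) (Pi\<^sub>M K (\<lambda>_. M)) (\<lambda>z. \<lambda>i\<in>K. z (\<pi> i)) = Pi\<^sub>M K (\<lambda>_. M)"
  using distr_PiM_reindex[of I "\<lambda>_. M" \<pi> K] assms prob_space_axioms by simp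

lemma measurable_reindex_power:
  assumes "\<pi> \<in> K \<rightarrow> I"
  shows "(\<lambda>z. \<lambda>i\<in>K. z (\<pi> i)) \<in> Pi\<^sub>M I (\<lambda>_. M) \<rightarrow>\<^sub>M Pi\<^sub>M K (\<lambda>_. M)"
  using assms by (intro measurable_restrict measurable_component_singleton) auto

lemma (in prob_space) integral_reindex_power:
  fixes f :: "_ \<Rightarrow> real"
  assumes "inj_on \<pi> K" "\<pi> \<in> K \<rightarrow> I" "f \<in> borel_measurable (Pi\<^sub>M K (\<lambda>_. M))"
  shows "(\<integral>z. f (\<lambda>i\<in>K. z (\<pi> i)) \<partial>Pi\<^sub>M I (\<lambda>_. M)) = (\<integral>z. f z \<partial>Pi\<^sub>M K (\<lambda>_. M))"
  using integral_distr[OF measurable_reindex_power[OF assms(2), of M] assms(3)]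
    distr_reindex_power[OF assms(1,2)] by simp

lemma (in prob_space) integral_component_power:
  fixes f :: "_ \<Rightarrow> real"
  assumes "i \<in> I" "f \<in> borel_measurable M"
  shows "(\<integral>z. f (z i) \<partial>Pi\<^sub>M I (\<lambda>_. M)) = (\<integral>x. f x \<partial>M)"
  using integral_distr[OF measurable_component_singleton[of i I "\<lambda>_. M"], of f]
    distr_PiM_component[of I "\<lambda>_. M" i] assms prob_space_axioms by simp

lemma measurable_at_component:
  "f \<in> M \<rightarrow>\<^sub>M N \<Longrightarrow> i \<in> I \<Longrightarrow> (\<lambda>z. f (z i)) \<in> Pi\<^sub>M I (\<lambda>_. M) \<rightarrow>\<^sub>M N"
  by (rule measurable_compose[OF measurable_component_singleton])

text \<open>Exchangeability of an i.i.d. sample. It converts a pathwise bound on a sum over the indices into a bound on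
  the mean of each summand.\<close>

lemma (in prob_space) integral_exchangeable:
  fixes f :: "'i \<Rightarrow> ('i \<Rightarrow> 'a) \<Rightarrow> real"
  assumes f: "\<And>i. i \<in> K \<Longrightarrow> f i \<in> borel_measurable (Pi\<^sub>M I (\<lambda>_. M))"
    and ex: "\<And>i j z. i \<in> K \<Longrightarrow> j \<in> K \<Longrightarrow> f i (\<lambda>l\<in>I. z (Transposition.transpose i j l)) = f j z"
    and i: "i \<in> K" and KI: "K \<subseteq> I"
  shows "real (card K) * (\<integral>z. f i z \<partial>Pi\<^sub>M I (\<lambda>_. M)) = (\<Sum>j\<in>K. (\<integral>z. f j z \<partial>Pi\<^sub>M I (\<lambda>_. M)))"
proof -
  have "(\<integral>z. f j z \<partial>Pi\<^sub>M I (\<lambda>_. M)) = (\<integral>z. f i z \<partial>Pi\<^sub>M I (\<lambda>_. M))" if j: "j \<in> K" for j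
  proof -
    have "(\<integral>z. f i (\<lambda>l\<in>I. z (Transposition.transpose i j l)) \<partial>Pi\<^sub>M I (\<lambda>_. M)) = (\<integral>z. f i z \<partial>Pi\<^sub>M I (\<lambda>_. M))"
      by (rule integral_reindex_power[OF _ _ f[OF i]])
        (use i j KI in \<open>auto simp: Transposition.transpose_def inj_on_def split: if_splits\<close>)
    thus ?thesis by (simp add: ex[OF i j])
  qed
  thus ?thesis by simp
qed

lemma measurable_swap_coordinate:
  assumes "i \<in> I"
  shows "(\<lambda>(z, w). (z(i := w), z i)) \<in> Pi\<^sub>M I (\<lambda>_. M) \<Otimes>\<^sub>M M \<rightarrow>\<^sub>M Pi\<^sub>M I (\<lambda>_. M) \<Otimes>\<^sub>M M"
proof -
  have [simp]: "insert i I = I" using assms by auto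
  have "(\<lambda>p. (fst p)(i := snd p)) \<in> Pi\<^sub>M I (\<lambda>_. M) \<Otimes>\<^sub>M M \<rightarrow>\<^sub>M Pi\<^sub>M (insert i I) (\<lambda>_. M)"
    by (intro measurable_fun_upd[where J = I]) auto
  hence "(\<lambda>p. ((fst p)(i := snd p), fst p i)) \<in> Pi\<^sub>M I (\<lambda>_. M) \<Otimes>\<^sub>M M \<rightarrow>\<^sub>M Pi\<^sub>M I (\<lambda>_. M) \<Otimes>\<^sub>M M"
    using assms by (intro measurable_Pair measurable_compose[OF measurable_fst measurable_component_singleton]) auto
  thus ?thesis by (simp add: case_prod_unfold)
qed

text \<open>A sample coordinate and a fresh observation are exchangeable: after isolating coordinate \<open>i\<close> with Fubini's
  theorem the claim is the symmetry of \<open>M \<Otimes>\<^sub>M M\<close>.\<close>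

lemma (in prob_space) distr_swap_coordinate:
  assumes I: "finite I" "i \<in> I"
  shows "distr (Pi\<^sub>M I (\<lambda>_. M) \<Otimes>\<^sub>M M) (Pi\<^sub>M I (\<lambda>_. M) \<Otimes>\<^sub>M M) (\<lambda>(z, w). (z(i := w), z i)) = Pi\<^sub>M I (\<lambda>_. M) \<Otimes>\<^sub>M M"
    (is "distr ?P ?P ?T = ?P")
proof (rule measure_eqI)
  interpret psf: product_sigma_finite "\<lambda>_. M" by unfold_locales
  define I' where "I' = I - {i}"
  have I': "finite I'" "i \<notin> I'" "I = insert i I'" using I by (auto simp: I'_def)
  interpret PI': prob_space "Pi\<^sub>M I' (\<lambda>_. M)" by (rule prob_space_power)
  interpret PI: prob_space "Pi\<^sub>M I (\<lambda>_. M)" by (rule prob_space_power)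
  interpret pair: pair_sigma_finite M M by unfold_locales
  fix B assume "B \<in> sets (distr ?P ?P ?T)"
  hence B: "B \<in> sets ?P" by simp
  define f where "f = (\<lambda>p. indicator B p :: ennreal)"
  have f: "f \<in> borel_measurable ?P" unfolding f_def using B by simp
  note T = measurable_swap_coordinate[OF I(2), of M]
  have fT: "(\<lambda>p. f (?T p)) \<in> borel_measurable ?P" using T f by (rule measurable_compose)
  have upd: "(\<lambda>p. (x(i := fst p), snd p)) \<in> M \<Otimes>\<^sub>M M \<rightarrow>\<^sub>M ?P" if x: "x \<in> space (Pi\<^sub>M I' (\<lambda>_. M))" for x
  proof (rule measurable_Pair)
    show "(\<lambda>p. x(i := fst p)) \<in> M \<Otimes>\<^sub>M M \<rightarrow>\<^sub>M Pi\<^sub>M I (\<lambda>_. M)"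
      using measurable_compose[OF measurable_fst measurable_component_update[OF x I'(2)], of M] by (simp add: I'(3))
  qed simp
  have "emeasure (distr ?P ?P ?T) B = (\<integral>\<^sup>+p. f (?T p) \<partial>?P)"
    using B T nn_integral_distr[OF T, of f] f by (simp add: f_def flip: nn_integral_indicator)
  also have "\<dots> = (\<integral>\<^sup>+z. (\<integral>\<^sup>+w. f (z(i := w), z i) \<partial>M) \<partial>Pi\<^sub>M I (\<lambda>_. M))"
    using nn_integral_fst[OF fT] by simp
  also have "\<dots> = (\<integral>\<^sup>+x. (\<integral>\<^sup>+y. (\<integral>\<^sup>+w. f (x(i := w), y) \<partial>M) \<partial>M) \<partial>Pi\<^sub>M I' (\<lambda>_. M))"
  proof -
    have "(\<lambda>z. \<integral>\<^sup>+w. f (z(i := w), z i) \<partial>M) \<in> borel_measurable (Pi\<^sub>M I (\<lambda>_. M))"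
      using borel_measurable_nn_integral_fst[OF fT] by simp
    thus ?thesis unfolding I'(3) by (subst psf.product_nn_integral_insert[OF I'(1,2)]) simp_all
  qed
  also have "\<dots> = (\<integral>\<^sup>+x. (\<integral>\<^sup>+w. (\<integral>\<^sup>+y. f (x(i := w), y) \<partial>M) \<partial>M) \<partial>Pi\<^sub>M I' (\<lambda>_. M))"
  proof (rule nn_integral_cong)
    fix x assume "x \<in> space (Pi\<^sub>M I' (\<lambda>_. M))"
    from measurable_compose[OF upd[OF this] f]
    have "(\<lambda>(w, y). f (x(i := w), y)) \<in> borel_measurable (M \<Otimes>\<^sub>M M)" by (simp add: case_prod_unfold)
    from pair.Fubini'[OF this]
    show "(\<integral>\<^sup>+y. (\<integral>\<^sup>+w. f (x(i := w), y) \<partial>M) \<partial>M) = (\<integral>\<^sup>+w. (\<integral>\<^sup>+y. f (x(i := w), y) \<partial>M) \<partial>M)" .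
  qed
  also have "\<dots> = (\<integral>\<^sup>+z. (\<integral>\<^sup>+y. f (z, y) \<partial>M) \<partial>Pi\<^sub>M I (\<lambda>_. M))"
  proof -
    have "(\<lambda>z. \<integral>\<^sup>+y. f (z, y) \<partial>M) \<in> borel_measurable (Pi\<^sub>M I (\<lambda>_. M))"
      using borel_measurable_nn_integral_fst[OF f] by simp
    thus ?thesis unfolding I'(3) by (subst psf.product_nn_integral_insert[OF I'(1,2)]) simp_all
  qed
  also have "\<dots> = (\<integral>\<^sup>+p. f p \<partial>?P)" by (rule nn_integral_fst[OF f])
  also have "\<dots> = emeasure ?P B" using B by (simp add: f_def)
  finally show "emeasure (distr ?P ?P ?T) B = emeasure ?P B" .
qed simp

lemma (in prob_space) integral_swap_coordinate:
  fixes f :: "_ \<Rightarrow> real"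
  assumes I: "finite I" "i \<in> I" and f: "f \<in> borel_measurable (Pi\<^sub>M I (\<lambda>_. M) \<Otimes>\<^sub>M M)"
  shows "(\<integral>p. f ((fst p)(i := snd p), fst p i) \<partial>(Pi\<^sub>M I (\<lambda>_. M) \<Otimes>\<^sub>M M)) = (\<integral>p. f p \<partial>(Pi\<^sub>M I (\<lambda>_. M) \<Otimes>\<^sub>M M))"
  using integral_distr[OF measurable_swap_coordinate[OF I(2), of M] f] distr_swap_coordinate[OF I]
  by (simp add: case_prod_unfold)

lemma (in prob_space) distr_resample_coordinate:
  assumes I: "finite I" "i \<in> I"
  shows "distr (Pi\<^sub>M I (\<lambda>_. M) \<Otimes>\<^sub>M M) (Pi\<^sub>M I (\<lambda>_. M)) (\<lambda>p. (fst p)(i := snd p)) = Pi\<^sub>M I (\<lambda>_. M)"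
proof -
  let ?P = "Pi\<^sub>M I (\<lambda>_. M) \<Otimes>\<^sub>M M"
  have "distr ?P (Pi\<^sub>M I (\<lambda>_. M)) (\<lambda>p. (fst p)(i := snd p)) =
      distr (distr ?P ?P (\<lambda>(z, w). (z(i := w), z i))) (Pi\<^sub>M I (\<lambda>_. M)) fst"
    by (subst distr_distr[OF measurable_fst measurable_swap_coordinate[OF I(2)]]) (simp add: comp_def case_prod_unfold)
  also have "\<dots> = distr ?P (Pi\<^sub>M I (\<lambda>_. M)) fst" by (simp only: distr_swap_coordinate[OF I])
  also have "\<dots> = Pi\<^sub>M I (\<lambda>_. M)" by (rule distr_pair_fst)
  finally show ?thesis .
qed

section \<open>Uniform deviations by symmetrization\<close>

text \<open>On the event that exactly the indices in \<open>J\<close> hit \<open>A\<close>, the restricted supremum is an unrestricted one in which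
  the other weights are zero. There are finitely many such events.\<close>

lemma restricted_class_measurable_sup:
  fixes F :: "('a \<Rightarrow> real) set" and m :: nat and e :: "nat \<Rightarrow> real"
  assumes F: "P_measurable_class M F" and A: "A \<in> sets M"
  shows "(\<lambda>z. SUP f\<in>F. \<bar>\<Sum>i<m. e i * (f (z i) * indicator A (z i))\<bar>)
    \<in> borel_measurable (completion (Pi\<^sub>M {..<m} (\<lambda>_. M)))"
proof -
  let ?Q = "Pi\<^sub>M {..<m} (\<lambda>_. M)"
  have meas: "(\<lambda>z. SUP f\<in>F. \<bar>\<Sum>i<m. e i * f (z i)\<bar>) \<in> borel_measurable (completion (Pi\<^sub>M {..<m} (\<lambda>_. M)))"
    for m :: nat and e using F unfolding P_measurable_class_def by blast
  define T where "T = (\<lambda>z. {i\<in>{..<m}. z i \<in> A})"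
  define S where "S = (\<lambda>J z. SUP f\<in>F. \<bar>\<Sum>i<m. (e i * of_bool (i \<in> J)) * f (z i)\<bar>)"
  have "(\<lambda>z. \<Sum>J\<in>Pow {..<m}. (\<Prod>i<m. if i \<in> J then indicator A (z i) else 1 - indicator A (z i)) * S J z)
     \<in> borel_measurable (completion ?Q)"
  proof (intro borel_measurable_sum borel_measurable_times)
    fix J
    show "S J \<in> borel_measurable (completion ?Q)"
      using meas[where m = m and e = "\<lambda>i. e i * of_bool (i \<in> J)"] unfolding S_def .
    have "(\<lambda>z. \<Prod>i<m. if i \<in> J then indicator A (z i) else 1 - indicator A (z i) :: real) \<in> borel_measurable ?Q"
      using A by (intro borel_measurable_prod) (auto intro!: measurable_compose[OF measurable_component_singleton])
    thus "(\<lambda>z. \<Prod>i<m. if i \<in> J then indicator A (z i) else 1 - indicator A (z i) :: real) \<in> borel_measurable (completion ?Q)"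
      by (rule measurable_completion)
  qed
  moreover have "(\<Sum>J\<in>Pow {..<m}. (\<Prod>i<m. if i \<in> J then indicator A (z i) else 1 - indicator A (z i)) * S J z)
    = (SUP f\<in>F. \<bar>\<Sum>i<m. e i * (f (z i) * indicator A (z i))\<bar>)" for z
  proof -
    have ind: "(\<Prod>i<m. if i \<in> J then indicator A (z i) else 1 - indicator A (z i)) = (of_bool (J = T z) :: real)"
      if J: "J \<subseteq> {..<m}" for J
    proof (cases "J = T z")
      case True
      thus ?thesis by (auto simp: T_def indicator_def intro!: prod.neutral)
    next
      case False
      then obtain i where i: "i < m" "i \<in> J \<longleftrightarrow> i \<notin> T z" using J by (auto simp: T_def)
      thus ?thesis using False by (auto simp: T_def indicator_def intro!: bexI[of _ i])
    qed
    have "(\<Sum>J\<in>Pow {..<m}. (\<Prod>i<m. if i \<in> J then indicator A (z i) else 1 - indicator A (z i)) * S J z)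
      = (\<Sum>J\<in>Pow {..<m}. if J = T z then S J z else 0)"
      using ind by (intro sum.cong) auto
    also have "\<dots> = S (T z) z" by (subst sum.delta) (auto simp: T_def)
    also have "\<dots> = (SUP f\<in>F. \<bar>\<Sum>i<m. e i * (f (z i) * indicator A (z i))\<bar>)"
      unfolding S_def by (intro SUP_cong refl arg_cong[where f=abs] sum.cong) (auto simp: T_def indicator_def)
    finally show ?thesis .
  qed
  ultimately show ?thesis by simp
qed

text \<open>The supremum over the class is measurable only for the completed measure. A Borel majorant that agrees with
  it almost everywhere has the same integral and can be used with Fubini's theorem.\<close>

lemma completion_measurable_majorant:
  fixes H :: "'a \<Rightarrow> real"
  assumes H: "H \<in> borel_measurable (completion Q)" and bound: "\<And>x. x \<in> space Q \<Longrightarrow> 0 \<le> H x \<and> H x \<le> b"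
  shows "\<exists>Hb\<in>borel_measurable Q. (\<forall>x\<in>space Q. H x \<le> Hb x \<and> Hb x \<le> b) \<and> (AE x in Q. Hb x = H x)"
proof -
  obtain H' where H': "H' \<in> borel_measurable Q" "AE x in Q. H x = H' x"
    using completion_ex_borel_measurable_real[OF H] by blast
  obtain N where N: "N \<in> null_sets Q" "{x\<in>space Q. \<not> H x = H' x} \<subseteq> N"
    using H'(2) unfolding eventually_ae_filter by auto
  have NQ: "N \<in> sets Q" using N by auto
  define Hb where "Hb = (\<lambda>x. if x \<in> N then b else H' x)"
  show ?thesis
  proof (intro bexI[of _ Hb] conjI ballI)
    have "Measurable.pred Q (\<lambda>x. x \<in> N)" using pred_sets2[OF NQ, of "\<lambda>x. x" Q] by simp
    thus "Hb \<in> borel_measurable Q" unfolding Hb_def using H'(1) by (intro measurable_If) auto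
    fix x assume x: "x \<in> space Q"
    show "H x \<le> Hb x" "Hb x \<le> b"
      using x N(2) bound[OF x] by (cases "x \<in> N"; auto simp: Hb_def)+
  next
    show "AE x in Q. Hb x = H x"
      using N by (intro AE_I'[of N]) (auto simp: Hb_def)
  qed
qed

lemma sum_double_lessThan:
  fixes g :: "nat \<Rightarrow> real"
  shows "(\<Sum>j<2 * m. g j) = (\<Sum>i<m. g i) + (\<Sum>i<m. g (i + m))"
proof -
  have "(\<Sum>j<2 * m. g j) = sum g {0..<m} + sum g {m..<2 * m}"
    unfolding lessThan_atLeast0 by (subst sum.atLeastLessThan_concat) auto
  also have "sum g {m..<2 * m} = (\<Sum>i<m. g (i + m))"
    using sum.shift_bounds_nat_ivl[of g 0 m m] by (simp add: lessThan_atLeast0 mult_2)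
  finally show ?thesis by (simp add: lessThan_atLeast0)
qed

lemma sign_avg_restricted_class:
  fixes F :: "('a \<Rightarrow> real) set" and z :: "nat \<Rightarrow> 'a"
  assumes F: "F \<noteq> {}" "\<And>f x. f \<in> F \<Longrightarrow> x \<in> X \<Longrightarrow> 0 \<le> f x \<and> f x \<le> 1"
    and vc: "vc_dim (subgraphs X F) \<le> enat v" and z: "\<And>i. i < m \<Longrightarrow> z i \<in> X"
  shows "sign_avg {..<m} (\<lambda>\<epsilon>. SUP f\<in>F. \<bar>\<Sum>i<m. \<epsilon> i * (f (z i) * indicator A (z i))\<bar>)
    \<le> 19 * sqrt ((real v + 1) * (\<Sum>i<m. indicator A (z i)))"
proof -
  define J where "J = {i\<in>{..<m}. z i \<in> A}"
  have sumJ: "(\<Sum>i<m. h i * indicator A (z i)) = (\<Sum>i\<in>J. h i)" for h :: "nat \<Rightarrow> real"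
  proof -
    have "(\<Sum>i\<in>J. h i) = (\<Sum>i\<in>{..<m}. if z i \<in> A then h i else 0)"
      unfolding J_def by (rule sum.inter_filter) simp
    also have "\<dots> = (\<Sum>i<m. h i * indicator A (z i))" by (intro sum.cong) (auto simp: indicator_def)
    finally show ?thesis ..
  qed
  have "sign_avg {..<m} (\<lambda>\<epsilon>. SUP f\<in>F. \<bar>\<Sum>i\<in>J. \<epsilon> i * f (z i)\<bar>) \<le> 19 * sqrt ((real v + 1) * real (card J))"
  proof (rule sign_avg_SUP_functions)
    show "card B \<le> v" if B: "B \<subseteq> J" "shatters ((\<lambda>f. {i \<in> J. s < f (z i)}) ` F) B" for s B
    proof (rule level_sets_vc_dim[OF vc _ _ B])
      show "finite B" using B(1) by (rule finite_subset) (simp add: J_def)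
    qed (use z in \<open>auto simp: J_def\<close>)
  qed (use F z in \<open>auto simp: J_def\<close>)
  moreover have "real (card J) = (\<Sum>i<m. indicator A (z i))" using sumJ[of "\<lambda>_. 1"] by simp
  ultimately show ?thesis using sumJ by (simp add: mult.assoc[symmetric])
qed

text \<open>The sample consists of the coordinates below \<open>m\<close> and a ghost sample of the coordinates above. Swapping \<open>i\<close> with
  \<open>i + m\<close> preserves the law and attaches a sign to the \<open>i\<close>-th difference. Averaging over all swaps turns the
  supremum into a Rademacher average at fixed points, where only points in \<open>A\<close> count. This gives the square root
  of the number of hits, whose mean is at most \<open>sqrt (m * prob A)\<close>.\<close>

lemma (in prob_space) symmetrized_deviation_majorant:
  fixes F :: "('a \<Rightarrow> real) set"
  assumes F: "P_measurable_class M F" "F \<noteq> {}" "\<forall>f\<in>F. \<forall>x\<in>space M. 0 \<le> f x \<and> f x \<le> 1"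
    and vc: "vc_dim (subgraphs (space M) F) \<le> enat v"
    and A: "A \<in> events" "0 < prob A" and m: "0 < m"
  obtains Hb where "Hb \<in> borel_measurable (Pi\<^sub>M {..<2 * m} (\<lambda>_. M))"
    "\<And>x f. x \<in> space (Pi\<^sub>M {..<2 * m} (\<lambda>_. M)) \<Longrightarrow> f \<in> F \<Longrightarrow>
      \<bar>(\<Sum>i<m. f (x i) * indicator A (x i)) - (\<Sum>i<m. f (x (i + m)) * indicator A (x (i + m)))\<bar> \<le> Hb x"
    "\<And>x. x \<in> space (Pi\<^sub>M {..<2 * m} (\<lambda>_. M)) \<Longrightarrow> 0 \<le> Hb x \<and> Hb x \<le> 2 * real m"
    "(\<integral>x. Hb x \<partial>Pi\<^sub>M {..<2 * m} (\<lambda>_. M)) \<le> 38 * sqrt ((real v + 1) * (real m * prob A))"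
proof -
  let ?Q = "Pi\<^sub>M {..<2 * m} (\<lambda>_. M)"
  interpret Q: prob_space ?Q by (rule prob_space_power)
  define \<phi> where "\<phi> = (\<lambda>f x. f x * indicator A x :: real)"
  have \<phi>: "0 \<le> \<phi> f x \<and> \<phi> f x \<le> 1" if "f \<in> F" "x \<in> space M" for f x
    using F(3)[rule_format, OF that] by (auto simp: \<phi>_def indicator_def)
  define e where "e = (\<lambda>i. if i < m then 1 else -1 :: real)"
  define H where "H = (\<lambda>x. SUP f\<in>F. \<bar>\<Sum>i<2 * m. e i * \<phi> f (x i)\<bar>)"
  have xM: "x i \<in> space M" if "x \<in> space ?Q" "i < 2 * m" for x i
    using that by (auto simp: space_PiM PiE_def Pi_def)
  have sum_bound: "\<bar>\<Sum>i<k. c i * \<phi> f (x (h i))\<bar> \<le> real k"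
    if "f \<in> F" "x \<in> space ?Q" "\<And>i. i < k \<Longrightarrow> h i < 2 * m" "\<And>i. i < k \<Longrightarrow> \<bar>c i\<bar> \<le> 1" for f x k h and c :: "nat \<Rightarrow> real"
  proof -
    have "\<bar>\<Sum>i<k. c i * \<phi> f (x (h i))\<bar> \<le> (\<Sum>i<k. 1)"
    proof (rule order_trans[OF sum_abs sum_mono])
      fix i assume "i \<in> {..<k}"
      hence i: "i < k" by simp
      have "\<bar>c i\<bar> * \<bar>\<phi> f (x (h i))\<bar> \<le> 1 * 1"
        using \<phi>[OF that(1) xM[OF that(2) that(3)[OF i]]] that(4)[OF i] by (intro mult_mono) auto
      thus "\<bar>c i * \<phi> f (x (h i))\<bar> \<le> 1" by (simp add: abs_mult)
    qed
    thus ?thesis by simp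
  qed
  have bdd: "bdd_above ((\<lambda>f. \<bar>\<Sum>i<k. c i * \<phi> f (x (h i))\<bar>) ` F)"
    if "x \<in> space ?Q" "\<And>i. i < k \<Longrightarrow> h i < 2 * m" "\<And>i. i < k \<Longrightarrow> \<bar>c i\<bar> \<le> 1" for x k h and c :: "nat \<Rightarrow> real"
    using sum_bound[OF _ that] by (intro bdd_aboveI2[of _ _ "real k"]) auto
  have e1: "\<bar>e i\<bar> \<le> 1" for i by (simp add: e_def)
  have H_upper: "\<bar>\<Sum>i<2 * m. e i * \<phi> f (x i)\<bar> \<le> H x" if "f \<in> F" "x \<in> space ?Q" for f x
    unfolding H_def using bdd[OF that(2), of "2 * m" "\<lambda>i. i" e] e1 that(1) by (intro cSUP_upper) auto
  obtain f0 where f0: "f0 \<in> F" using F(2) by auto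
  have H_bounds: "0 \<le> H x \<and> H x \<le> 2 * real m" if x: "x \<in> space ?Q" for x
  proof
    show "0 \<le> H x" using H_upper[OF f0 x] by (rule order_trans[OF abs_ge_zero])
    show "H x \<le> 2 * real m" unfolding H_def
      using sum_bound[OF _ x, of _ "2 * m" "\<lambda>i. i" e] e1 F(2) by (intro cSUP_least) auto
  qed
  have H_meas: "H \<in> borel_measurable (completion ?Q)"
    unfolding H_def \<phi>_def by (rule restricted_class_measurable_sup[OF F(1) A(1)])
  have "\<exists>Hb\<in>borel_measurable ?Q. (\<forall>x\<in>space ?Q. H x \<le> Hb x \<and> Hb x \<le> 2 * real m) \<and> (AE x in ?Q. Hb x = H x)"
    by (rule completion_measurable_majorant[OF H_meas]) (rule H_bounds)
  then obtain Hb where Hb: "Hb \<in> borel_measurable ?Q"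
    "\<forall>x\<in>space ?Q. H x \<le> Hb x \<and> Hb x \<le> 2 * real m" "AE x in ?Q. Hb x = H x"
    by (elim bexE conjE) simp
  have Hb_bounds: "0 \<le> Hb x \<and> Hb x \<le> 2 * real m" if "x \<in> space ?Q" for x
    using H_bounds[OF that] Hb(2) that by auto
  define B where "B = (\<lambda>h (x :: nat \<Rightarrow> 'a). \<Sum>i<m. indicator A (x (h i)) :: real)"
  define h1 h2 where "h1 = (\<lambda>i::nat. i)" and "h2 = (\<lambda>i::nat. i + m)"
  \<comment> \<open>\<open>\<pi> \<epsilon>\<close> swaps \<open>i\<close> and \<open>i + m\<close> exactly when \<open>\<epsilon> i = - 1\<close>.\<close>
  define \<pi> where "\<pi> = (\<lambda>\<epsilon> j. if j < m then (if \<epsilon> j = (1::real) then j else j + m)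
                             else (if \<epsilon> (j - m) = 1 then j else j - m))"
  define T where "T = (\<lambda>\<epsilon> (x :: nat \<Rightarrow> 'a). \<lambda>j\<in>{..<2 * m}. x (\<pi> \<epsilon> j))"
  have \<pi>_mem: "\<pi> \<epsilon> \<in> {..<2 * m} \<rightarrow> {..<2 * m}" for \<epsilon> by (auto simp: \<pi>_def)
  have \<pi>_inj: "inj_on (\<pi> \<epsilon>) {..<2 * m}" for \<epsilon>
    by (rule inj_on_inverseI[of _ "\<pi> \<epsilon>"]) (auto simp: \<pi>_def)
  have T_meas: "T \<epsilon> \<in> ?Q \<rightarrow>\<^sub>M ?Q" for \<epsilon> unfolding T_def by (rule measurable_reindex_power[OF \<pi>_mem])
  have T_distr: "distr ?Q ?Q (T \<epsilon>) = ?Q" for \<epsilon>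
    unfolding T_def by (rule distr_reindex_power[OF \<pi>_inj \<pi>_mem])
  have T_int: "(\<integral>x. Hb (T \<epsilon> x) \<partial>?Q) = (\<integral>x. Hb x \<partial>?Q)" for \<epsilon>
    unfolding T_def by (rule integral_reindex_power[OF \<pi>_inj \<pi>_mem Hb(1)])
  have HT: "H (T \<epsilon> x) = (SUP f\<in>F. \<bar>(\<Sum>i<m. \<epsilon> i * \<phi> f (x (h1 i))) - (\<Sum>i<m. \<epsilon> i * \<phi> f (x (h2 i)))\<bar>)"
    if \<epsilon>: "\<epsilon> \<in> signs {..<m}" for \<epsilon> x
  proof -
    have \<epsilon>i: "\<epsilon> i = 1 \<or> \<epsilon> i = -1" if "i < m" for i using \<epsilon> that by (auto simp: signs_def PiE_def Pi_def)
    have "(\<Sum>i<2 * m. e i * \<phi> f (T \<epsilon> x i)) = (\<Sum>i<m. \<epsilon> i * \<phi> f (x (h1 i))) - (\<Sum>i<m. \<epsilon> i * \<phi> f (x (h2 i)))" for f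
    proof -
      have "(\<Sum>i<2 * m. e i * \<phi> f (T \<epsilon> x i)) = (\<Sum>i<m. e i * \<phi> f (T \<epsilon> x i) + e (i + m) * \<phi> f (T \<epsilon> x (i + m)))"
        by (simp add: sum_double_lessThan sum.distrib)
      also have "\<dots> = (\<Sum>i<m. \<epsilon> i * \<phi> f (x (h1 i)) - \<epsilon> i * \<phi> f (x (h2 i)))"
      proof (rule sum.cong[OF refl])
        fix i assume "i \<in> {..<m}"
        thus "e i * \<phi> f (T \<epsilon> x i) + e (i + m) * \<phi> f (T \<epsilon> x (i + m)) = \<epsilon> i * \<phi> f (x (h1 i)) - \<epsilon> i * \<phi> f (x (h2 i))"
          using \<epsilon>i[of i] by (auto simp: e_def T_def \<pi>_def h1_def h2_def)
      qed
      finally show ?thesis by (simp add: sum_subtractf)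
    qed
    thus ?thesis by (simp add: H_def)
  qed
  have avg_bound: "sign_avg {..<m} (\<lambda>\<epsilon>. H (T \<epsilon> x)) \<le> 19 * sqrt (real v + 1) * (sqrt (B h1 x) + sqrt (B h2 x))"
    if x: "x \<in> space ?Q" for x
  proof -
    define R where "R = (\<lambda>h \<epsilon>. SUP f\<in>F. \<bar>\<Sum>i<m. \<epsilon> i * \<phi> f (x (h i))\<bar>)"
    have R_le: "sign_avg {..<m} (R h) \<le> 19 * sqrt ((real v + 1) * B h x)"
      if h: "\<And>i. i < m \<Longrightarrow> h i < 2 * m" for h
      unfolding R_def \<phi>_def B_def
    proof (rule sign_avg_restricted_class[OF F(2) _ vc])
      show "x (h i) \<in> space M" if "i < m" for i by (rule xM[OF x h[OF that]])
    qed (use F(3) in auto)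
    have "sign_avg {..<m} (\<lambda>\<epsilon>. H (T \<epsilon> x)) \<le> sign_avg {..<m} (\<lambda>\<epsilon>. R h1 \<epsilon> + R h2 \<epsilon>)"
    proof (rule sign_avg_mono)
      fix \<epsilon> assume \<epsilon>: "\<epsilon> \<in> signs {..<m}"
      have \<epsilon>1: "\<bar>\<epsilon> i\<bar> \<le> 1" if "i < m" for i
      proof -
        have "\<epsilon> i \<in> {-1, 1}" using \<epsilon> that by (auto simp: signs_def PiE_def Pi_def)
        thus ?thesis by auto
      qed
      show "H (T \<epsilon> x) \<le> R h1 \<epsilon> + R h2 \<epsilon>"
        unfolding HT[OF \<epsilon>]
      proof (rule cSUP_least[OF F(2)])
        fix f assume f: "f \<in> F"
        have "\<bar>\<Sum>i<m. \<epsilon> i * \<phi> f (x (h1 i))\<bar> \<le> R h1 \<epsilon>" "\<bar>\<Sum>i<m. \<epsilon> i * \<phi> f (x (h2 i))\<bar> \<le> R h2 \<epsilon>"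
          unfolding R_def using f \<epsilon>1 by (intro cSUP_upper bdd[OF x]; simp add: h1_def h2_def)+
        thus "\<bar>(\<Sum>i<m. \<epsilon> i * \<phi> f (x (h1 i))) - (\<Sum>i<m. \<epsilon> i * \<phi> f (x (h2 i)))\<bar> \<le> R h1 \<epsilon> + R h2 \<epsilon>"
          by linarith
      qed
    qed
    also have "\<dots> = sign_avg {..<m} (R h1) + sign_avg {..<m} (R h2)" by (rule sign_avg_add)
    also have "\<dots> \<le> 19 * sqrt ((real v + 1) * B h1 x) + 19 * sqrt ((real v + 1) * B h2 x)"
      by (intro add_mono R_le) (auto simp: h1_def h2_def)
    finally show ?thesis by (simp only: real_sqrt_mult distrib_left mult.assoc)
  qed
  define s where "s = sqrt (real m * prob A)"
  have s: "0 < s" "s^2 = real m * prob A" using A m by (simp_all add: s_def)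
  \<comment> \<open>The arithmetic-geometric mean inequality plays the role of Jensen's inequality for the square root.\<close>
  have sqrtB: "sqrt (B h x) \<le> (B h x / s + s) / 2" for h x
  proof -
    have B0: "0 \<le> B h x" by (auto simp: B_def intro!: sum_nonneg)
    have "0 \<le> (sqrt (B h x) - s)^2" by simp
    also have "\<dots> = B h x - 2 * s * sqrt (B h x) + s^2" using B0 by (simp add: power2_diff)
    finally show ?thesis using s(1) by (simp add: field_simps power2_eq_square)
  qed
  have B_int: "integrable ?Q (B h)" "(\<integral>x. B h x \<partial>?Q) = s^2" if h: "\<And>i. i < m \<Longrightarrow> h i < 2 * m" for h
  proof -
    have ind: "integrable ?Q (\<lambda>x. indicator A (x (h i)) :: real)" "(\<integral>x. (indicator A (x (h i)) :: real) \<partial>?Q) = prob A"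
      if "i < m" for i
    proof -
      show "integrable ?Q (\<lambda>x. indicator A (x (h i)) :: real)"
        using h[OF that] A(1)
        by (intro Q.integrable_bounded_real[of _ 1] measurable_at_component) auto
      have "(\<integral>x. (indicator A (x (h i)) :: real) \<partial>?Q) = (\<integral>x. indicator A x \<partial>M)"
        using h[OF that] A(1) by (intro integral_component_power) auto
      thus "(\<integral>x. (indicator A (x (h i)) :: real) \<partial>?Q) = prob A"
        using A(1) sets.sets_into_space[OF A(1)] by (simp add: Int_absorb2)
    qed
    show "integrable ?Q (B h)" unfolding B_def using ind by (intro Bochner_Integration.integrable_sum) auto
    have "(\<integral>x. B h x \<partial>?Q) = (\<Sum>i<m. (\<integral>x. indicator A (x (h i)) \<partial>?Q))"
      unfolding B_def using ind by (intro Bochner_Integration.integral_sum) auto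
    also have "\<dots> = s^2" using ind by (simp add: s)
    finally show "(\<integral>x. B h x \<partial>?Q) = s^2" .
  qed
  define U where "U = (\<lambda>x. 19 * sqrt (real v + 1) * ((B h1 x / s + s) / 2 + (B h2 x / s + s) / 2))"
  have h12: "\<And>i. i < m \<Longrightarrow> h1 i < 2 * m" "\<And>i. i < m \<Longrightarrow> h2 i < 2 * m" by (auto simp: h1_def h2_def)
  have HbT_int: "integrable ?Q (\<lambda>x. Hb (T \<epsilon> x))" for \<epsilon>
    using measurable_compose[OF T_meas Hb(1)] Hb_bounds[OF measurable_space[OF T_meas]]
    by (rule Q.integrable_in_interval)
  have AE_T: "AE x in ?Q. Hb (T \<epsilon> x) = H (T \<epsilon> x)" for \<epsilon>
    by (rule AE_distrD[OF T_meas]) (simp only: T_distr Hb(3))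
  have "(\<integral>x. Hb x \<partial>?Q) = sign_avg {..<m} (\<lambda>\<epsilon>. (\<integral>x. Hb (T \<epsilon> x) \<partial>?Q))"
    by (simp add: T_int sign_avg_const)
  also have "\<dots> = (\<integral>x. sign_avg {..<m} (\<lambda>\<epsilon>. Hb (T \<epsilon> x)) \<partial>?Q)"
    unfolding sign_avg_def using HbT_int by (simp add: Bochner_Integration.integral_sum)
  also have "\<dots> \<le> (\<integral>x. U x \<partial>?Q)"
  proof (rule integral_mono_AE)
    show "integrable ?Q (\<lambda>x. sign_avg {..<m} (\<lambda>\<epsilon>. Hb (T \<epsilon> x)))"
      unfolding sign_avg_def using HbT_int by (intro integrable_divide Bochner_Integration.integrable_sum) auto
    show "integrable ?Q U" unfolding U_def using B_int(1)[OF h12(1)] B_int(1)[OF h12(2)]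
      by (intro integrable_mult_right Bochner_Integration.integrable_add integrable_divide) auto
    have ae: "AE x in ?Q. \<forall>\<epsilon>\<in>signs {..<m}. Hb (T \<epsilon> x) = H (T \<epsilon> x)"
      using AE_T by (intro AE_finite_allI finite_signs) auto
    have U: "sign_avg {..<m} (\<lambda>\<epsilon>. Hb (T \<epsilon> x)) \<le> U x"
      if x: "x \<in> space ?Q" "\<forall>\<epsilon>\<in>signs {..<m}. Hb (T \<epsilon> x) = H (T \<epsilon> x)" for x
    proof -
      have "sign_avg {..<m} (\<lambda>\<epsilon>. Hb (T \<epsilon> x)) \<le> sign_avg {..<m} (\<lambda>\<epsilon>. H (T \<epsilon> x))"
        using x(2) by (intro sign_avg_mono) simp
      also have "\<dots> \<le> 19 * sqrt (real v + 1) * (sqrt (B h1 x) + sqrt (B h2 x))" by (rule avg_bound[OF x(1)])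
      also have "\<dots> \<le> U x" unfolding U_def by (intro mult_left_mono add_mono sqrtB) auto
      finally show ?thesis .
    qed
    show "AE x in ?Q. sign_avg {..<m} (\<lambda>\<epsilon>. Hb (T \<epsilon> x)) \<le> U x"
      using AE_space ae by eventually_elim (rule U)
  qed
  also have "\<dots> = 19 * sqrt (real v + 1) * ((s^2 / s + s) / 2 + (s^2 / s + s) / 2)"
    unfolding U_def using B_int[OF h12(1)] B_int[OF h12(2)] by (simp add: Q.prob_space)
  also have "\<dots> = 38 * sqrt ((real v + 1) * (real m * prob A))"
    using s(1) by (simp add: s_def power2_eq_square real_sqrt_mult)
  finally have int: "(\<integral>x. Hb x \<partial>?Q) \<le> 38 * sqrt ((real v + 1) * (real m * prob A))" .
  show thesis
  proof (rule that[OF Hb(1) _ _ int])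
    fix x f assume x: "x \<in> space ?Q" and f: "f \<in> F"
    have "(\<Sum>i<2 * m. e i * \<phi> f (x i)) = (\<Sum>i<m. f (x i) * indicator A (x i)) - (\<Sum>i<m. f (x (i + m)) * indicator A (x (i + m)))"
      by (simp add: sum_double_lessThan e_def \<phi>_def sum_negf)
    thus "\<bar>(\<Sum>i<m. f (x i) * indicator A (x i)) - (\<Sum>i<m. f (x (i + m)) * indicator A (x (i + m)))\<bar> \<le> Hb x"
      using H_upper[OF f x] Hb(2)[rule_format, OF x] by simp
  next
    show "0 \<le> Hb x \<and> Hb x \<le> 2 * real m" if "x \<in> space ?Q" for x by (rule Hb_bounds[OF that])
  qed
qed

text \<open>The supremum of the deviations over the class need not be measurable, so it is replaced by a measurable
  function that dominates all of them at once. The crude upper bound makes it integrable.\<close>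

definition (in prob_space) deviation_majorant ::
  "('a \<Rightarrow> real) set \<Rightarrow> 'a set \<Rightarrow> nat set \<Rightarrow> nat set \<Rightarrow> ((nat \<Rightarrow> 'a) \<Rightarrow> real) \<Rightarrow> bool" where
  "deviation_majorant F A I T D \<longleftrightarrow> D \<in> borel_measurable (Pi\<^sub>M I (\<lambda>_. M)) \<and>
     (\<forall>z\<in>space (Pi\<^sub>M I (\<lambda>_. M)). 0 \<le> D z \<and> D z \<le> 2 * real (card T) \<and>
       (\<forall>f\<in>F. \<bar>(\<Sum>i\<in>T. f (z i) * indicator A (z i)) - real (card T) * (\<integral>x. f x * indicator A x \<partial>M)\<bar> \<le> D z))"

text \<open>Integrating the symmetrized majorant over the ghost sample dominates the deviation from the mean, by Jensen's
  inequality, uniformly in the class.\<close>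

lemma (in prob_space) uniform_deviation_majorant:
  fixes F :: "('a \<Rightarrow> real) set"
  assumes F: "P_measurable_class M F" "F \<noteq> {}" "\<forall>f\<in>F. \<forall>x\<in>space M. 0 \<le> f x \<and> f x \<le> 1"
    and vc: "vc_dim (subgraphs (space M) F) \<le> enat v"
    and A: "A \<in> events" "0 < prob A" and m: "0 < m"
  shows "\<exists>D. deviation_majorant F A {..<m} {..<m} D \<and>
    (\<integral>z. D z \<partial>Pi\<^sub>M {..<m} (\<lambda>_. M)) \<le> 38 * sqrt ((real v + 1) * (real m * prob A))"
proof -
  let ?Q = "Pi\<^sub>M {..<2 * m} (\<lambda>_. M)" and ?I = "Pi\<^sub>M {..<m} (\<lambda>_. M)" and ?J = "Pi\<^sub>M {m..<2 * m} (\<lambda>_. M)"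
  interpret Q: prob_space ?Q by (rule prob_space_power)
  interpret I: prob_space ?I by (rule prob_space_power)
  interpret J: prob_space ?J by (rule prob_space_power)
  interpret psf: product_sigma_finite "\<lambda>_::nat. M" by unfold_locales
  have union: "{..<m} \<union> {m..<2 * m} = {..<2 * m}" by auto
  have F_meas: "f \<in> borel_measurable M" if "f \<in> F" for f
    using F(1) that unfolding P_measurable_class_def by blast
  from symmetrized_deviation_majorant[OF F vc A m]
  obtain Hb where Hb: "Hb \<in> borel_measurable ?Q"
    and dev: "\<And>x f. x \<in> space ?Q \<Longrightarrow> f \<in> F \<Longrightarrow>
      \<bar>(\<Sum>i<m. f (x i) * indicator A (x i)) - (\<Sum>i<m. f (x (i + m)) * indicator A (x (i + m)))\<bar> \<le> Hb x"
    and bounds: "\<And>x. x \<in> space ?Q \<Longrightarrow> 0 \<le> Hb x \<and> Hb x \<le> 2 * real m"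
    and int: "(\<integral>x. Hb x \<partial>?Q) \<le> 38 * sqrt ((real v + 1) * (real m * prob A))" by blast
  define mg where "mg = (\<lambda>z w :: nat \<Rightarrow> 'a. merge {..<m} {m..<2 * m} (z, w))"
  define D where "D = (\<lambda>z. \<integral>w. Hb (mg z w) \<partial>?J)"
  have mg_meas: "(\<lambda>(z, w). mg z w) \<in> ?I \<Otimes>\<^sub>M ?J \<rightarrow>\<^sub>M ?Q"
    using measurable_merge[of "{..<m}" "{m..<2 * m}" "\<lambda>_. M"] by (simp add: mg_def union case_prod_unfold)
  have mg_meas': "mg z \<in> ?J \<rightarrow>\<^sub>M ?Q" if "z \<in> space ?I" for z
    using measurable_compose[OF measurable_Pair1'[OF that] mg_meas] by simp
  have mg_space: "mg z w \<in> space ?Q" if "z \<in> space ?I" "w \<in> space ?J" for z w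
    using measurable_space[OF mg_meas'[OF that(1)] that(2)] .
  have Hb_int: "integrable ?J (\<lambda>w. Hb (mg z w))" if "z \<in> space ?I" for z
    using measurable_compose[OF mg_meas'[OF that] Hb] bounds[OF mg_space[OF that]] by (rule J.integrable_in_interval)
  have D_meas: "D \<in> borel_measurable ?I"
    unfolding D_def using measurable_compose[OF mg_meas Hb]
    by (intro J.borel_measurable_lebesgue_integral) (simp add: case_prod_unfold)
  have D_bounds: "0 \<le> D z \<and> D z \<le> 2 * real m" if z: "z \<in> space ?I" for z
  proof
    show "0 \<le> D z" unfolding D_def using bounds mg_space[OF z] by (intro Bochner_Integration.integral_nonneg_AE AE_I2) blast
    show "D z \<le> 2 * real m" unfolding D_def using bounds mg_space[OF z]
      by (intro J.integral_le_const Hb_int[OF z] AE_I2) blast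
  qed
  have D_dev: "\<bar>(\<Sum>i<m. f (z i) * indicator A (z i)) - real m * (\<integral>x. f x * indicator A x \<partial>M)\<bar> \<le> D z"
    if z: "z \<in> space ?I" and f: "f \<in> F" for z f
  proof -
    let ?\<phi> = "\<lambda>x. f x * indicator A x :: real"
    have \<phi>_meas: "?\<phi> \<in> borel_measurable M" using F_meas[OF f] A(1) by auto
    have comp_int: "integrable ?J (\<lambda>w. ?\<phi> (w (i + m)))" if "i < m" for i
      using that F(3) f
      by (intro J.integrable_in_interval[of _ 1] measurable_at_component[OF \<phi>_meas])
        (auto simp: indicator_def space_PiM PiE_def Pi_def)
    have comp_val: "(\<integral>w. ?\<phi> (w (i + m)) \<partial>?J) = (\<integral>x. ?\<phi> x \<partial>M)" if "i < m" for i
      using that by (intro integral_component_power \<phi>_meas) auto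
    have sum_int: "integrable ?J (\<lambda>w. \<Sum>i<m. ?\<phi> (w (i + m)))"
      using comp_int by (intro Bochner_Integration.integrable_sum) auto
    have "(\<integral>w. (\<Sum>i<m. ?\<phi> (z i)) - (\<Sum>i<m. ?\<phi> (w (i + m))) \<partial>?J)
        = (\<Sum>i<m. ?\<phi> (z i)) - (\<integral>w. (\<Sum>i<m. ?\<phi> (w (i + m))) \<partial>?J)"
      by (subst Bochner_Integration.integral_diff[OF J.integrable_const sum_int])
        (simp only: lebesgue_integral_const J.prob_space scaleR_one)
    also have "(\<integral>w. (\<Sum>i<m. ?\<phi> (w (i + m))) \<partial>?J) = (\<Sum>i<m. (\<integral>w. ?\<phi> (w (i + m)) \<partial>?J))"
      using comp_int by (intro Bochner_Integration.integral_sum) auto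
    also have "\<dots> = real m * (\<integral>x. ?\<phi> x \<partial>M)" using comp_val by simp
    finally have "\<bar>(\<Sum>i<m. ?\<phi> (z i)) - real m * (\<integral>x. ?\<phi> x \<partial>M)\<bar> =
        \<bar>\<integral>w. (\<Sum>i<m. ?\<phi> (z i)) - (\<Sum>i<m. ?\<phi> (w (i + m))) \<partial>?J\<bar>" by simp
    also have "\<dots> \<le> (\<integral>w. \<bar>(\<Sum>i<m. ?\<phi> (z i)) - (\<Sum>i<m. ?\<phi> (w (i + m)))\<bar> \<partial>?J)"
      by (rule integral_abs_bound)
    also have "\<dots> \<le> D z" unfolding D_def
    proof (rule integral_mono)
      show "integrable ?J (\<lambda>w. \<bar>(\<Sum>i<m. ?\<phi> (z i)) - (\<Sum>i<m. ?\<phi> (w (i + m)))\<bar>)"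
        by (intro integrable_abs Bochner_Integration.integrable_diff J.integrable_const sum_int)
      show "integrable ?J (\<lambda>w. Hb (mg z w))" by (rule Hb_int[OF z])
      fix w assume w: "w \<in> space ?J"
      have "(\<Sum>i<m. ?\<phi> (z i)) = (\<Sum>i<m. ?\<phi> (mg z w i))"
        "(\<Sum>i<m. ?\<phi> (w (i + m))) = (\<Sum>i<m. ?\<phi> (mg z w (i + m)))"
        by (auto simp: mg_def merge_def)
      thus "\<bar>(\<Sum>i<m. ?\<phi> (z i)) - (\<Sum>i<m. ?\<phi> (w (i + m)))\<bar> \<le> Hb (mg z w)"
        using dev[OF mg_space[OF z w] f] by simp
    qed
    finally show ?thesis .
  qed
  have "(\<integral>z. D z \<partial>?I) = (\<integral>x. Hb x \<partial>?Q)"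
  proof -
    have "integrable ?Q Hb" using Hb bounds by (rule Q.integrable_in_interval)
    thus ?thesis unfolding D_def mg_def
      using psf.product_integral_fold[of "{..<m}" "{m..<2 * m}" Hb] by (simp add: union ivl_disj_int)
  qed
  thus ?thesis using D_meas D_bounds D_dev int by (intro exI[of _ D]) (auto simp: deviation_majorant_def)
qed

text \<open>The majorant for a subsample depends only on the coordinates in \<open>T\<close>; this is what makes it independent of a
  held-out point.\<close>

lemma (in prob_space) uniform_deviation_on_subsample:
  fixes F :: "('a \<Rightarrow> real) set" and T I :: "nat set"
  assumes F: "P_measurable_class M F" "F \<noteq> {}" "\<forall>f\<in>F. \<forall>x\<in>space M. 0 \<le> f x \<and> f x \<le> 1"
    and vc: "vc_dim (subgraphs (space M) F) \<le> enat v"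
    and A: "A \<in> events" "0 < prob A" and T: "finite T" "T \<noteq> {}" "T \<subseteq> I"
  shows "\<exists>D. deviation_majorant F A I T D \<and> (\<forall>z z'. (\<forall>i\<in>T. z i = z' i) \<longrightarrow> D z = D z') \<and>
    (\<integral>z. D z \<partial>Pi\<^sub>M I (\<lambda>_. M)) \<le> 38 * sqrt ((real v + 1) * (real (card T) * prob A))"
proof -
  define m where "m = card T"
  have m: "0 < m" using T by (simp add: m_def card_gt_0_iff)
  obtain b where b: "bij_betw b {..<m} T"
    using ex_bij_betw_nat_finite[OF T(1)] by (auto simp: m_def lessThan_atLeast0)
  have inj: "inj_on b {..<m}" and bT: "b ` {..<m} = T" using b by (auto simp: bij_betw_def)
  have bI: "b \<in> {..<m} \<rightarrow> I" using bT T(3) by auto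
  define r where "r = (\<lambda>z :: nat \<Rightarrow> 'a. \<lambda>i\<in>{..<m}. z (b i))"
  have r: "r \<in> Pi\<^sub>M I (\<lambda>_. M) \<rightarrow>\<^sub>M Pi\<^sub>M {..<m} (\<lambda>_. M)" unfolding r_def by (rule measurable_reindex_power[OF bI])
  obtain D where maj: "deviation_majorant F A {..<m} {..<m} D"
    and int: "(\<integral>z. D z \<partial>Pi\<^sub>M {..<m} (\<lambda>_. M)) \<le> 38 * sqrt ((real v + 1) * (real m * prob A))"
    using uniform_deviation_majorant[OF F vc A m] by (elim exE conjE)
  have D: "D \<in> borel_measurable (Pi\<^sub>M {..<m} (\<lambda>_. M))" using maj by (simp add: deviation_majorant_def)
  show ?thesis
  proof (intro exI[of _ "\<lambda>z. D (r z)"] conjI allI impI)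
    show "deviation_majorant F A I T (\<lambda>z. D (r z))"
      unfolding deviation_majorant_def
    proof (intro conjI ballI)
      show "(\<lambda>z. D (r z)) \<in> borel_measurable (Pi\<^sub>M I (\<lambda>_. M))" using r D by (rule measurable_compose)
      fix z assume "z \<in> space (Pi\<^sub>M I (\<lambda>_. M))"
      hence rz: "r z \<in> space (Pi\<^sub>M {..<m} (\<lambda>_. M))" by (rule measurable_space[OF r])
      show "0 \<le> D (r z)" "D (r z) \<le> 2 * real (card T)" using maj rz by (auto simp: deviation_majorant_def m_def)
      fix f assume f: "f \<in> F"
      have "(\<Sum>i\<in>T. f (z i) * indicator A (z i)) = (\<Sum>i<m. f (z (b i)) * indicator A (z (b i)))"
        using sum.reindex_bij_betw[OF b, of "\<lambda>i. f (z i) * indicator A (z i)"] by simp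
      also have "\<dots> = (\<Sum>i<m. f (r z i) * indicator A (r z i))" by (simp add: r_def)
      finally show "\<bar>(\<Sum>i\<in>T. f (z i) * indicator A (z i)) - real (card T) * (\<integral>x. f x * indicator A x \<partial>M)\<bar> \<le> D (r z)"
        using maj rz f by (simp add: deviation_majorant_def m_def)
    qed
    show "(\<integral>z. D (r z) \<partial>Pi\<^sub>M I (\<lambda>_. M)) \<le> 38 * sqrt ((real v + 1) * (real (card T) * prob A))"
      unfolding r_def integral_reindex_power[OF inj bI D] using int by (simp add: m_def)
  next
    fix z z' :: "nat \<Rightarrow> 'a" assume "\<forall>i\<in>T. z i = z' i"
    hence "r z = r z'" using bT by (auto simp: r_def fun_eq_iff restrict_def)
    thus "D (r z) = D (r z')" by simp
  qed
qed

lemma P_measurable_class_const: "P_measurable_class M {\<lambda>_. 1}"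
  unfolding P_measurable_class_def by simp

lemma vc_dim_singleton: "vc_dim (subgraphs X {f}) \<le> enat 0"
  unfolding vc_dim_def
proof (rule SUP_least)
  fix B assume "B \<in> {B. finite B \<and> shatters (subgraphs X {f}) B}"
  hence sh: "shatters (subgraphs X {f}) B" by simp
  have "B = {}"
  proof (rule ccontr)
    assume "B \<noteq> {}"
    then obtain b where b: "b \<in> B" by auto
    from sh have "\<exists>A\<in>subgraphs X {f}. A \<inter> B = {}" "\<exists>A\<in>subgraphs X {f}. A \<inter> B = B"
      unfolding shatters_def by simp_all
    hence "B = {}" unfolding subgraphs_def by simp
    thus False using b by simp
  qed
  thus "enat (card B) \<le> enat 0" by simp
qed

section \<open>Order statistics\<close>

lemma card_eq_length_filter_sort:
  "card {l \<in> {1..n}. Q (u l)} = card {i. i < n \<and> Q (sort (map u [1..<Suc n]) ! i)}" for u :: "nat \<Rightarrow> real"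
proof -
  let ?xs = "sort (map u [1..<Suc n])"
  have "card {i. i < n \<and> Q (?xs ! i)} = length (filter Q ?xs)"
    by (simp add: length_filter_conv_card)
  also have "\<dots> = size (filter_mset Q (mset (map u [1..<Suc n])))"
    by (metis mset_filter mset_sort size_mset)
  also have "\<dots> = length (filter (\<lambda>l. Q (u l)) [1..<Suc n])"
    by (simp only: mset_filter[symmetric] size_mset filter_map length_map o_def)
  also have "\<dots> = card (set (filter (\<lambda>l. Q (u l)) [1..<Suc n]))"
    by (rule distinct_card[symmetric]) simp
  also have "set (filter (\<lambda>l. Q (u l)) [1..<Suc n]) = {l \<in> {1..n}. Q (u l)}" by auto
  finally show ?thesis ..
qed

text \<open>These two counting inequalities determine the \<open>k\<close>-th largest value, also in the presence of ties; all later
  arguments use only them.\<close>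

lemma rev_order_stat_bounds:
  assumes "1 \<le> k" "k \<le> n"
  shows "k \<le> card {l \<in> {1..n}. rev_order_stat n u k \<le> u l}"
    and "card {l \<in> {1..n}. rev_order_stat n u k < u l} < k"
proof -
  define xs where "xs = sort (map u [1..<Suc n])"
  have len: "length xs = n" and sorted: "sorted xs" by (simp_all add: xs_def)
  have s: "rev_order_stat n u k = xs ! (n - k)"
  proof -
    have "rev_order_stat n u k = rev xs ! (k - 1)" by (simp only: rev_order_stat_def xs_def)
    thus ?thesis using assms len by (simp add: rev_nth)
  qed
  have "k = card {n - k..<n}" using assms by simp
  also have "\<dots> \<le> card {i. i < n \<and> xs ! (n - k) \<le> xs ! i}"
    using sorted len by (intro card_mono) (auto simp: sorted_iff_nth_mono)
  also have "\<dots> = card {l \<in> {1..n}. rev_order_stat n u k \<le> u l}"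
    unfolding s xs_def by (rule card_eq_length_filter_sort[symmetric])
  finally show "k \<le> card {l \<in> {1..n}. rev_order_stat n u k \<le> u l}" .
  have "card {l \<in> {1..n}. rev_order_stat n u k < u l} = card {i. i < n \<and> xs ! (n - k) < xs ! i}"
    unfolding s xs_def by (rule card_eq_length_filter_sort)
  also have "\<dots> \<le> card {n - k<..<n}"
  proof (intro card_mono subsetI)
    fix i assume i: "i \<in> {i. i < n \<and> xs ! (n - k) < xs ! i}"
    have "\<not> i \<le> n - k"
    proof
      assume "i \<le> n - k"
      hence "xs ! i \<le> xs ! (n - k)" using sorted len assms by (intro sorted_nth_mono) auto
      thus False using i by simp
    qed
    thus "i \<in> {n - k<..<n}" using i by simp
  qed simp
  also have "\<dots> < k" using assms by simp
  finally show "card {l \<in> {1..n}. rev_order_stat n u k < u l} < k" .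
qed

lemma less_rev_order_stat_iff:
  assumes "1 \<le> k" "k \<le> n"
  shows "a < rev_order_stat n u k \<longleftrightarrow> k \<le> card {l \<in> {1..n}. a < u l}"
proof
  assume "a < rev_order_stat n u k"
  hence "card {l \<in> {1..n}. rev_order_stat n u k \<le> u l} \<le> card {l \<in> {1..n}. a < u l}"
    by (intro card_mono) auto
  thus "k \<le> card {l \<in> {1..n}. a < u l}" using rev_order_stat_bounds(1)[OF assms] by (rule order_trans[rotated])
next
  assume *: "k \<le> card {l \<in> {1..n}. a < u l}"
  show "a < rev_order_stat n u k"
  proof (rule ccontr)
    assume "\<not> a < rev_order_stat n u k"
    hence "card {l \<in> {1..n}. a < u l} \<le> card {l \<in> {1..n}. rev_order_stat n u k < u l}"
      by (intro card_mono) auto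
    thus False using * rev_order_stat_bounds(2)[OF assms, of u] by linarith
  qed
qed

lemma rev_order_stat_less_iff:
  assumes "1 \<le> k" "k \<le> n"
  shows "rev_order_stat n u k < a \<longleftrightarrow> card {l \<in> {1..n}. a \<le> u l} < k"
proof
  assume "rev_order_stat n u k < a"
  hence "card {l \<in> {1..n}. a \<le> u l} \<le> card {l \<in> {1..n}. rev_order_stat n u k < u l}"
    by (intro card_mono) auto
  thus "card {l \<in> {1..n}. a \<le> u l} < k" using rev_order_stat_bounds(2)[OF assms, of u] by linarith
next
  assume *: "card {l \<in> {1..n}. a \<le> u l} < k"
  show "rev_order_stat n u k < a"
  proof (rule ccontr)
    assume "\<not> rev_order_stat n u k < a"
    hence "card {l \<in> {1..n}. rev_order_stat n u k \<le> u l} \<le> card {l \<in> {1..n}. a \<le> u l}"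
      by (intro card_mono) auto
    thus False using * rev_order_stat_bounds(1)[OF assms, of u] by linarith
  qed
qed

text \<open>Counts of values above any level up to the order statistic do not see which larger value stands at \<open>i\<close>.\<close>

lemma rev_order_stat_update_above:
  assumes k: "1 \<le> k" "k \<le> n"
    and above: "rev_order_stat n u k < u i" "rev_order_stat n u k < u' i" and eq: "\<And>l. l \<noteq> i \<Longrightarrow> u' l = u l"
  shows "rev_order_stat n u' k = rev_order_stat n u k"
proof (rule antisym)
  let ?s = "rev_order_stat n u k"
  have same: "{l \<in> {1..n}. a < u' l} = {l \<in> {1..n}. a < u l}" if "a \<le> ?s" for a
    using above eq that by (auto; metis le_less_trans)
  show "rev_order_stat n u' k \<le> ?s"
    using less_rev_order_stat_iff[OF k, of ?s u'] same[of ?s] rev_order_stat_bounds(2)[OF k, of u]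
    by (simp add: not_less[symmetric])
  show "?s \<le> rev_order_stat n u' k"
  proof (rule dense_le)
    fix a assume "a < ?s"
    thus "a \<le> rev_order_stat n u' k"
      using less_rev_order_stat_iff[OF k, of a u'] less_rev_order_stat_iff[OF k, of a u] same[of a] by simp
  qed
qed

lemma rev_order_stat_cong:
  "(\<And>l. l \<in> {1..n} \<Longrightarrow> u l = u' l) \<Longrightarrow> rev_order_stat n u k = rev_order_stat n u' k"
  unfolding rev_order_stat_def by (intro arg_cong2[where f = nth] arg_cong[where f = rev] arg_cong[where f = sort] map_cong) auto

lemma card_permuted_indices:
  assumes \<pi>: "bij_betw \<pi> {1..n} {1..n}"
  shows "card {l \<in> {1..n}. Q (\<pi> l)} = card {l \<in> {1..n}. Q l}"
proof (rule bij_betw_same_card[of \<pi>])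
  have inj: "inj_on \<pi> {1..n}" and im: "\<pi> ` {1..n} = {1..n}" using \<pi> by (auto simp: bij_betw_def)
  have "\<pi> ` {l \<in> {1..n}. Q (\<pi> l)} = {l \<in> \<pi> ` {1..n}. Q l}" by blast
  moreover have "inj_on \<pi> {l \<in> {1..n}. Q (\<pi> l)}" using inj by (rule inj_on_subset) blast
  ultimately show "bij_betw \<pi> {l \<in> {1..n}. Q (\<pi> l)} {l \<in> {1..n}. Q l}" by (simp only: bij_betw_def im)
qed

lemma rev_order_stat_permute:
  assumes k: "1 \<le> k" "k \<le> n" and \<pi>: "bij_betw \<pi> {1..n} {1..n}"
  shows "rev_order_stat n (\<lambda>l. u (\<pi> l)) k = rev_order_stat n u k"
proof -
  have "card {l \<in> {1..n}. a < u (\<pi> l)} = card {l \<in> {1..n}. a < u l}" for a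
    by (rule card_permuted_indices[OF \<pi>])
  hence "a < rev_order_stat n (\<lambda>l. u (\<pi> l)) k \<longleftrightarrow> a < rev_order_stat n u k" for a
    by (simp add: less_rev_order_stat_iff[OF k])
  thus ?thesis by (meson less_irrefl linorder_neqE)
qed

lemma measurable_rev_order_stat:
  assumes h: "h \<in> borel_measurable M" and k: "1 \<le> k" "k \<le> n"
  shows "(\<lambda>z. rev_order_stat n (\<lambda>i. h (z i)) k) \<in> borel_measurable (Pi\<^sub>M {1..n} (\<lambda>_. M))"
  unfolding borel_measurable_iff_greater
proof
  fix a
  let ?Q = "Pi\<^sub>M {1..n} (\<lambda>_. M)"
  define c where "c = (\<lambda>z. \<Sum>l\<in>{1..n}. indicator {x \<in> space M. a < h x} (z l) :: real)"
  have c: "c \<in> borel_measurable ?Q"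
    unfolding c_def using h by (intro borel_measurable_sum measurable_at_component) auto
  have "a < rev_order_stat n (\<lambda>i. h (z i)) k \<longleftrightarrow> real k \<le> c z" if z: "z \<in> space ?Q" for z
  proof -
    have "c z = (\<Sum>l\<in>{1..n}. of_bool (a < h (z l)))"
      unfolding c_def using z by (intro sum.cong) (auto simp: space_PiM PiE_def Pi_def indicator_def)
    also have "\<dots> = real (card ({1..n} \<inter> {l. a < h (z l)}))" by (simp add: sum_of_bool_eq)
    also have "{1..n} \<inter> {l. a < h (z l)} = {l \<in> {1..n}. a < h (z l)}" by auto
    finally show ?thesis by (simp add: less_rev_order_stat_iff[OF k])
  qed
  hence "{z \<in> space ?Q. a < rev_order_stat n (\<lambda>i. h (z i)) k} = {z \<in> space ?Q. real k \<le> c z}" by auto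
  also have "\<dots> \<in> sets ?Q" using c by measurable
  finally show "{z \<in> space ?Q. a < rev_order_stat n (\<lambda>i. h (z i)) k} \<in> sets ?Q" .
qed

section \<open>The random threshold against the population tail\<close>

text \<open>Sample indices run over \<open>{1..n}\<close>; this keeps the simplifier from rewriting the index set.\<close>

declare One_nat_def [simp del]

locale tail_sample = prob_space M for M :: "'a measure" +
  fixes h :: "'a \<Rightarrow> real" and t :: real and n k :: nat
  assumes h_meas [measurable]: "h \<in> borel_measurable M"
    and k: "1 \<le> k" "k \<le> n"
    and tail_prob: "prob {x \<in> space M. t \<le> h x} = real k / real n"
    and tail_atomless: "\<And>r. t \<le> r \<Longrightarrow> prob {x \<in> space M. h x = r} = 0"
begin

abbreviation "Mn \<equiv> Pi\<^sub>M {1..n} (\<lambda>_. M)"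

definition thr :: "(nat \<Rightarrow> 'a) \<Rightarrow> real" where "thr z = rev_order_stat n (\<lambda>i. h (z i)) k"

definition above :: "(nat \<Rightarrow> 'a) \<Rightarrow> 'a \<Rightarrow> real" where "above z x = of_bool (thr z < h x)"

definition in_tail :: "'a \<Rightarrow> real" where "in_tail x = of_bool (t \<le> h x)"

definition disc :: "(nat \<Rightarrow> 'a) \<Rightarrow> 'a \<Rightarrow> real" where "disc z x = \<bar>above z x - in_tail x\<bar>"

definition total_disc :: "(nat \<Rightarrow> 'a) \<Rightarrow> real" where "total_disc z = (\<Sum>i=1..n. disc z (z i))"

definition mean_disc :: "(nat \<Rightarrow> 'a) \<Rightarrow> real" where "mean_disc z = (\<integral>x. disc z x \<partial>M)"

text \<open>The points of rank exactly \<open>k\<close>: those whose status can change when another coordinate is resampled.\<close>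

definition on_threshold :: "(nat \<Rightarrow> 'a) \<Rightarrow> 'a \<Rightarrow> real" where
  "on_threshold z x = of_bool (card {l \<in> {1..n}. h x \<le> h (z l)} = k)"

text \<open>Ties below the level \<open>t\<close> may have positive probability and are not excluded.\<close>

definition untied :: "(nat \<Rightarrow> 'a) \<Rightarrow> bool" where
  "untied z \<longleftrightarrow> (\<forall>i\<in>{1..n}. \<forall>j\<in>{1..n}. i \<noteq> j \<longrightarrow> \<not> (h (z i) = h (z j) \<and> t \<le> h (z i)))"

sublocale Mn: prob_space Mn by (rule prob_space_power)
sublocale MnM: prob_space "Mn \<Otimes>\<^sub>M M"
  by (intro prob_space_pair Mn.prob_space_axioms prob_space_axioms)
sublocale MnM: pair_sigma_finite Mn M by unfold_locales

lemma n_pos: "0 < n" using k by simp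

lemma thr_measurable [measurable]: "thr \<in> borel_measurable Mn"
  unfolding thr_def[abs_def] by (rule measurable_rev_order_stat[OF h_meas k])

lemma in_tail_measurable [measurable]: "in_tail \<in> borel_measurable M"
  unfolding in_tail_def[abs_def] of_bool_def by measurable

lemma above_pair_measurable [measurable]: "(\<lambda>p. above (fst p) (snd p)) \<in> borel_measurable (Mn \<Otimes>\<^sub>M M)"
  unfolding above_def of_bool_def by measurable

lemma disc_pair_measurable [measurable]: "(\<lambda>p. disc (fst p) (snd p)) \<in> borel_measurable (Mn \<Otimes>\<^sub>M M)"
  unfolding disc_def by measurable

lemma coordinate_pair_measurable: "i \<in> {1..n} \<Longrightarrow> (\<lambda>z. (z, z i)) \<in> Mn \<rightarrow>\<^sub>M Mn \<Otimes>\<^sub>M M"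
  by (intro measurable_Pair measurable_component_singleton) auto

lemma above_coordinate_measurable: "i \<in> {1..n} \<Longrightarrow> (\<lambda>z. above z (z i)) \<in> borel_measurable Mn"
  using measurable_compose[OF coordinate_pair_measurable above_pair_measurable] by simp

lemma disc_coordinate_measurable: "i \<in> {1..n} \<Longrightarrow> (\<lambda>z. disc z (z i)) \<in> borel_measurable Mn"
  using measurable_compose[OF coordinate_pair_measurable disc_pair_measurable] by simp

lemma in_tail_coordinate_measurable: "i \<in> {1..n} \<Longrightarrow> (\<lambda>z. in_tail (z i)) \<in> borel_measurable Mn"
  by (rule measurable_at_component[OF in_tail_measurable])

lemma total_disc_measurable [measurable]: "total_disc \<in> borel_measurable Mn"
  unfolding total_disc_def[abs_def] by (intro borel_measurable_sum disc_coordinate_measurable)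

lemma mean_disc_measurable [measurable]: "mean_disc \<in> borel_measurable Mn"
  unfolding mean_disc_def[abs_def]
  using borel_measurable_lebesgue_integral[of "\<lambda>z x. disc z x" Mn] disc_pair_measurable by (simp add: case_prod_unfold)

lemma on_threshold_coordinate_measurable:
  assumes i: "i \<in> {1..n}"
  shows "(\<lambda>z. on_threshold z (z i)) \<in> borel_measurable Mn"
proof -
  define c where "c = (\<lambda>z. \<Sum>l\<in>{1..n}. (if h (z i) \<le> h (z l) then 1 else 0) :: real)"
  have c: "c \<in> borel_measurable Mn" unfolding c_def
  proof (intro borel_measurable_sum)
    fix l assume l: "l \<in> {1..n}"
    have [measurable]: "(\<lambda>z. h (z i)) \<in> borel_measurable Mn" "(\<lambda>z. h (z l)) \<in> borel_measurable Mn"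
      using i l by (auto intro: measurable_at_component[OF h_meas])
    show "(\<lambda>z. if h (z i) \<le> h (z l) then 1 else 0 :: real) \<in> borel_measurable Mn" by measurable
  qed
  have "c z = real (card {l \<in> {1..n}. h (z i) \<le> h (z l)})" for z
  proof -
    have "c z = real (card ({1..n} \<inter> {l. h (z i) \<le> h (z l)}))" unfolding c_def by (simp add: sum.If_cases)
    also have "{1..n} \<inter> {l. h (z i) \<le> h (z l)} = {l \<in> {1..n}. h (z i) \<le> h (z l)}" by auto
    finally show ?thesis .
  qed
  hence "(\<lambda>z. on_threshold z (z i)) = (\<lambda>z. if c z = real k then 1 else 0)"
    by (auto simp: on_threshold_def fun_eq_iff)
  thus ?thesis using c by simp
qed

lemma above_bounds: "0 \<le> above z x" "above z x \<le> 1" by (auto simp: above_def)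
lemma in_tail_bounds: "0 \<le> in_tail x" "in_tail x \<le> 1" by (auto simp: in_tail_def)
lemma disc_bounds: "0 \<le> disc z x" "disc z x \<le> 1" by (auto simp: disc_def above_def in_tail_def)
lemma on_threshold_bounds: "0 \<le> on_threshold z x" "on_threshold z x \<le> 1" by (auto simp: on_threshold_def)

lemma total_disc_bounds: "0 \<le> total_disc z" "total_disc z \<le> real n"
  using sum_bounded_above[of "{1..n}" "\<lambda>i. disc z (z i)" 1] by (auto simp: total_disc_def disc_bounds intro!: sum_nonneg)

lemma disc_measurable: "z \<in> space Mn \<Longrightarrow> disc z \<in> borel_measurable M"
  using measurable_compose[OF measurable_Pair1'[of z Mn M] disc_pair_measurable] by simp

lemma above_measurable: "z \<in> space Mn \<Longrightarrow> above z \<in> borel_measurable M"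
  using measurable_compose[OF measurable_Pair1'[of z Mn M] above_pair_measurable] by simp

lemma disc_integrable: "z \<in> space Mn \<Longrightarrow> integrable M (disc z)"
  using disc_measurable disc_bounds by (intro integrable_in_interval) auto

lemma above_integrable: "z \<in> space Mn \<Longrightarrow> integrable M (above z)"
  using above_measurable above_bounds by (intro integrable_in_interval) auto

lemma mean_disc_bounds: assumes "z \<in> space Mn" shows "0 \<le> mean_disc z" "mean_disc z \<le> 1"
  unfolding mean_disc_def using disc_bounds disc_integrable[OF assms]
  by (auto intro!: integral_nonneg_AE integral_le_const)

lemma integral_in_tail: "(\<integral>x. in_tail x \<partial>M) = real k / real n"
proof -
  have "(\<integral>x. in_tail x \<partial>M) = (\<integral>x. indicator {x \<in> space M. t \<le> h x} x \<partial>M)"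
    by (intro Bochner_Integration.integral_cong) (auto simp: in_tail_def indicator_def)
  also have "\<dots> = prob ({x \<in> space M. t \<le> h x} \<inter> space M)" by (rule Bochner_Integration.integral_indicator)
  also have "{x \<in> space M. t \<le> h x} \<inter> space M = {x \<in> space M. t \<le> h x}" by auto
  finally show ?thesis by (simp only: tail_prob)
qed

lemma sum_above_card: "(\<Sum>i=1..n. above z (z i)) = real (card {i \<in> {1..n}. thr z < h (z i)})"
proof -
  have "(\<Sum>i=1..n. above z (z i)) = real (card ({1..n} \<inter> {i. thr z < h (z i)}))"
    unfolding above_def by (simp add: sum_of_bool_eq)
  also have "{1..n} \<inter> {i. thr z < h (z i)} = {i \<in> {1..n}. thr z < h (z i)}" by auto
  finally show ?thesis .
qed

lemma sum_above_le: "(\<Sum>i=1..n. above z (z i)) \<le> real k - 1"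
  using rev_order_stat_bounds(2)[OF k, of "\<lambda>i. h (z i)"] by (simp add: sum_above_card thr_def)

lemma AE_resample:
  assumes i: "i \<in> {1..n}" and P: "Measurable.pred Mn P" and ae: "\<And>z. z \<in> space Mn \<Longrightarrow> AE w in M. P (z(i := w))"
  shows "AE z in Mn. P z"
proof -
  have meas: "(\<lambda>p. (fst p)(i := snd p)) \<in> Mn \<Otimes>\<^sub>M M \<rightarrow>\<^sub>M Mn"
    using measurable_compose[OF measurable_swap_coordinate[OF i, of M] measurable_fst] by (simp add: case_prod_unfold)
  have "AE p in Mn \<Otimes>\<^sub>M M. P ((fst p)(i := snd p))"
  proof (rule MnM.AE_pair_measure)
    show "{x \<in> space (Mn \<Otimes>\<^sub>M M). P ((fst x)(i := snd x))} \<in> sets (Mn \<Otimes>\<^sub>M M)"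
      using measurable_compose[OF meas P] by (simp add: pred_def)
    show "AE x in Mn. AE y in M. P ((fst (x, y))(i := snd (x, y)))" by (rule AE_I2) (simp add: ae)
  qed
  moreover have "{z \<in> space Mn. P z} \<in> sets Mn" using P by (simp add: pred_def)
  ultimately have "AE z in distr (Mn \<Otimes>\<^sub>M M) Mn (\<lambda>p. (fst p)(i := snd p)). P z"
    using AE_distr_iff[OF meas] by simp
  thus ?thesis by (simp only: distr_resample_coordinate[OF finite_atLeastAtMost i])
qed

lemma AE_untied: "AE z in Mn. untied z"
proof -
  have "AE z in Mn. \<not> (h (z i) = h (z j) \<and> t \<le> h (z i))" if ij: "i \<in> {1..n}" "j \<in> {1..n}" "i \<noteq> j" for i j
  proof (rule AE_resample[OF ij(1)])
    define f g where "f = (\<lambda>z. h (z i))" and "g = (\<lambda>z. h (z j))"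
    have [measurable]: "f \<in> borel_measurable Mn" "g \<in> borel_measurable Mn"
      using ij by (auto simp: f_def g_def intro: measurable_at_component[OF h_meas])
    have "Measurable.pred Mn (\<lambda>z. f z = g z)" "Measurable.pred Mn (\<lambda>z. t \<le> f z)"
      unfolding pred_def by (intro borel_measurable_eq borel_measurable_le borel_measurable_const; measurable)+
    hence "Measurable.pred Mn (\<lambda>z. \<not> (f z = g z \<and> t \<le> f z))" by (intro pred_intros_logic)
    thus "Measurable.pred Mn (\<lambda>z. \<not> (h (z i) = h (z j) \<and> t \<le> h (z i)))" by (simp add: f_def g_def)
    fix z
    show "AE w in M. \<not> (h ((z(i := w)) i) = h ((z(i := w)) j) \<and> t \<le> h ((z(i := w)) i))"
    proof (cases "t \<le> h (z j)")
      case True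
      have "AE w in M. \<not> h w = h (z j)"
        using tail_atomless[OF True] by (subst (asm) prob_eq_0) auto
      thus ?thesis by eventually_elim (use ij in auto)
    qed (use ij in auto)
  qed
  hence "AE z in Mn. \<forall>i\<in>{1..n}. \<forall>j\<in>{1..n}. i \<noteq> j \<longrightarrow> \<not> (h (z i) = h (z j) \<and> t \<le> h (z i))"
    by (intro AE_finite_allI) (auto intro!: AE_finite_allI AE_impI)
  thus ?thesis by (simp add: untied_def)
qed

definition tail_count :: "(nat \<Rightarrow> 'a) \<Rightarrow> real" where "tail_count z = (\<Sum>i=1..n. in_tail (z i))"

lemma tail_count_card: "tail_count z = real (card {i \<in> {1..n}. t \<le> h (z i)})"
proof -
  have "tail_count z = real (card ({1..n} \<inter> {i. t \<le> h (z i)}))"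
    unfolding tail_count_def in_tail_def by (simp add: sum_of_bool_eq)
  also have "{1..n} \<inter> {i. t \<le> h (z i)} = {i \<in> {1..n}. t \<le> h (z i)}" by auto
  finally show ?thesis .
qed

text \<open>The events of exceeding the threshold and of lying in the tail are nested, in one order or the other, so the
  total discrepancy is a difference of counts. At most \<open>k - 1\<close> points exceed the threshold. If the threshold
  lies in the tail then, without ties, at least \<open>k - 1\<close> do.\<close>

lemma total_disc_le_count_deviation:
  assumes z: "untied z"
  shows "total_disc z \<le> \<bar>tail_count z - real k\<bar> + 1"
proof (cases "thr z < t")
  case True
  have "total_disc z = (\<Sum>i=1..n. above z (z i)) - tail_count z"
    unfolding total_disc_def tail_count_def sum_subtractf[symmetric]
    using True by (intro sum.cong) (auto simp: disc_def above_def in_tail_def)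
  thus ?thesis using sum_above_le[of z] by linarith
next
  case False
  have "total_disc z = tail_count z - (\<Sum>i=1..n. above z (z i))"
    unfolding total_disc_def tail_count_def sum_subtractf[symmetric]
    using False by (intro sum.cong) (auto simp: disc_def above_def in_tail_def)
  moreover have "real k \<le> (\<Sum>i=1..n. above z (z i)) + 1"
  proof -
    let ?G = "{i \<in> {1..n}. thr z < h (z i)}" and ?E = "{i \<in> {1..n}. h (z i) = thr z}"
    have "card ?E \<le> 1"
    proof (rule card_le_Suc0_iff_eq[THEN iffD2, folded One_nat_def])
      show "\<forall>i\<in>?E. \<forall>j\<in>?E. i = j"
      proof (intro ballI)
        fix i j assume ij: "i \<in> ?E" "j \<in> ?E"
        show "i = j"
        proof (rule ccontr)
          assume "i \<noteq> j"
          moreover have "i \<in> {1..n}" "j \<in> {1..n}" "h (z i) = h (z j)" "t \<le> h (z i)" using ij False by auto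
          ultimately show False using z unfolding untied_def by blast
        qed
      qed
    qed simp
    have "k \<le> card {i \<in> {1..n}. thr z \<le> h (z i)}"
      using rev_order_stat_bounds(1)[OF k, of "\<lambda>i. h (z i)"] by (simp add: thr_def)
    also have "{i \<in> {1..n}. thr z \<le> h (z i)} = ?G \<union> ?E" by auto
    also have "card \<dots> \<le> card ?G + card ?E" by (rule card_Un_le)
    also have "\<dots> \<le> card ?G + 1" using \<open>card ?E \<le> 1\<close> by simp
    finally show ?thesis by (simp add: sum_above_card)
  qed
  ultimately show ?thesis by linarith
qed

text \<open>All points of rank exactly \<open>k\<close> share one value \<open>u\<close>. In the tail there are no ties, so there is at most one such
  point. Below the tail, these points and all tail points together are among the \<open>k\<close> points with value at
  least \<open>u\<close>.\<close>

lemma sum_on_threshold_le_count_deviation: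
  assumes z: "untied z"
  shows "(\<Sum>i=1..n. on_threshold z (z i)) \<le> \<bar>tail_count z - real k\<bar> + 1"
proof -
  define C where "C = (\<lambda>u. {l \<in> {1..n}. u \<le> h (z l)})"
  define E where "E = {i \<in> {1..n}. card (C (h (z i))) = k}"
  have fin: "finite E" "finite (C u)" for u by (auto simp: E_def C_def)
  have "(\<Sum>i=1..n. on_threshold z (z i)) = real (card ({1..n} \<inter> {i. card (C (h (z i))) = k}))"
    unfolding on_threshold_def C_def by (simp add: sum_of_bool_eq)
  also have "{1..n} \<inter> {i. card (C (h (z i))) = k} = E" by (auto simp: E_def)
  finally have sum: "(\<Sum>i=1..n. on_threshold z (z i)) = real (card E)" .
  show ?thesis
  proof (cases "E = {}")
    case False
    then obtain i where i: "i \<in> E" by auto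
    define u where "u = h (z i)"
    have same: "h (z j) = u" if j: "j \<in> E" for j
    proof (rule ccontr)
      have strict: "card (C (h (z b))) < card (C (h (z a)))" if "a \<in> E" "b \<in> E" "h (z a) < h (z b)" for a b
      proof (rule psubset_card_mono[OF fin(2)])
        have "a \<in> C (h (z a))" "a \<notin> C (h (z b))" using that by (auto simp: C_def E_def)
        moreover have "C (h (z b)) \<subseteq> C (h (z a))" using that by (auto simp: C_def)
        ultimately show "C (h (z b)) \<subset> C (h (z a))" by blast
      qed
      assume "h (z j) \<noteq> u"
      hence "h (z j) < h (z i) \<or> h (z i) < h (z j)" by (auto simp: u_def)
      thus False using strict[OF i j] strict[OF j i] i j by (auto simp: E_def)
    qed
    show ?thesis
    proof (cases "t \<le> u")
      case True
      have "E \<subseteq> {i}"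
      proof
        fix j assume j: "j \<in> E"
        have "i \<in> {1..n}" "j \<in> {1..n}" "h (z i) = h (z j)" "t \<le> h (z i)"
          using i j same[OF j] True by (auto simp: E_def u_def)
        hence "i = j" using z unfolding untied_def by blast
        thus "j \<in> {i}" by simp
      qed
      hence "card E \<le> 1" using card_mono[of "{i}" E] by simp
      thus ?thesis using sum by simp
    next
      case False
      have "card E + card (C t) = card (E \<union> C t)"
        using same False fin by (subst card_Un_disjoint) (auto simp: C_def)
      also have "\<dots> \<le> card (C u)"
        using same False fin by (intro card_mono) (auto simp: C_def E_def)
      also have "\<dots> = k" using i by (simp add: E_def u_def)
      finally have "real (card E) + tail_count z \<le> real k"
        by (simp add: tail_count_card C_def flip: of_nat_add)
      thus ?thesis using sum by linarith
    qed
  qed (use sum in simp)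
qed

lemma tail_count_measurable [measurable]: "tail_count \<in> borel_measurable Mn"
  unfolding tail_count_def[abs_def] by (intro borel_measurable_sum in_tail_coordinate_measurable)

lemma count_deviation_integrable: "integrable Mn (\<lambda>z. \<bar>tail_count z - real k\<bar>)"
proof (rule Mn.integrable_bounded_real[of _ "real n"])
  fix z
  have "card {i \<in> {1..n}. t \<le> h (z i)} \<le> card {1..n}" by (intro card_mono) auto
  thus "\<bar>\<bar>tail_count z - real k\<bar>\<bar> \<le> real n" using k by (simp add: tail_count_card)
qed measurable

text \<open>The uniform deviation bound for the class that consists of the constant \<open>1\<close>.\<close>

lemma expectation_count_deviation: "(\<integral>z. \<bar>tail_count z - real k\<bar> \<partial>Mn) \<le> 38 * sqrt (real k)"
proof -
  define A where "A = {x \<in> space M. t \<le> h x}"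
  have A: "A \<in> events" "0 < prob A" "prob A = real k / real n"
    using k by (simp_all add: A_def tail_prob)
  have ne: "{1..n} \<noteq> {}" using n_pos by simp
  obtain D where D: "deviation_majorant {\<lambda>_. 1} A {1..n} {1..n} D"
    "(\<integral>z. D z \<partial>Mn) \<le> 38 * sqrt ((real 0 + 1) * (real (card {1..n}) * prob A))"
    using uniform_deviation_on_subsample[OF P_measurable_class_const _ _ vc_dim_singleton A(1,2) _ ne order_refl] by auto
  have "A \<inter> space M = A" by (auto simp: A_def)
  hence mean: "real n * (\<integral>x. indicator A x \<partial>M) = real k" using n_pos by (simp add: A(3))
  have "(\<integral>z. \<bar>tail_count z - real k\<bar> \<partial>Mn) \<le> (\<integral>z. D z \<partial>Mn)"
  proof (rule integral_mono[OF count_deviation_integrable])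
    show "integrable Mn D"
      using D(1) by (intro Mn.integrable_in_interval[of _ "2 * real n"]) (auto simp: deviation_majorant_def)
    fix z assume z: "z \<in> space Mn"
    have "tail_count z = (\<Sum>i=1..n. indicator A (z i))" unfolding tail_count_def
      using z by (intro sum.cong) (auto simp: A_def in_tail_def indicator_def space_PiM PiE_def Pi_def)
    thus "\<bar>tail_count z - real k\<bar> \<le> D z" using D(1) z mean by (simp add: deviation_majorant_def)
  qed
  also have "\<dots> \<le> 38 * sqrt (real k)" using D(2) n_pos by (simp add: A(3))
  finally show ?thesis .
qed

lemma expectation_le_count_deviation:
  assumes f: "f \<in> borel_measurable Mn" "\<And>z. \<bar>f z\<bar> \<le> b" and le: "\<And>z. untied z \<Longrightarrow> f z \<le> \<bar>tail_count z - real k\<bar> + 1"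
  shows "(\<integral>z. f z \<partial>Mn) \<le> 39 * sqrt (real k)"
proof -
  have "(\<integral>z. f z \<partial>Mn) \<le> (\<integral>z. \<bar>tail_count z - real k\<bar> + 1 \<partial>Mn)"
  proof (rule integral_mono_AE)
    show "integrable Mn f" using f by (intro Mn.integrable_bounded_real)
    show "integrable Mn (\<lambda>z. \<bar>tail_count z - real k\<bar> + 1)"
      using count_deviation_integrable by (intro Bochner_Integration.integrable_add Mn.integrable_const)
    show "AE z in Mn. f z \<le> \<bar>tail_count z - real k\<bar> + 1" using AE_untied by eventually_elim (rule le)
  qed
  also have "\<dots> = (\<integral>z. \<bar>tail_count z - real k\<bar> \<partial>Mn) + 1"
    using count_deviation_integrable by (subst Bochner_Integration.integral_add) (auto simp: Mn.prob_space)
  also have "\<dots> \<le> 38 * sqrt (real k) + 1" using expectation_count_deviation by simp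
  also have "1 \<le> sqrt (real k)" using k by simp
  finally show ?thesis by simp
qed

lemma expectation_total_disc: "(\<integral>z. total_disc z \<partial>Mn) \<le> 39 * sqrt (real k)"
  using total_disc_bounds by (intro expectation_le_count_deviation[of _ "real n"] total_disc_le_count_deviation) (auto simp: abs_le_iff)

lemma expectation_sum_on_threshold: "(\<integral>z. (\<Sum>i=1..n. on_threshold z (z i)) \<partial>Mn) \<le> 39 * sqrt (real k)"
proof (rule expectation_le_count_deviation[of _ "real n"])
  show "(\<lambda>z. \<Sum>i=1..n. on_threshold z (z i)) \<in> borel_measurable Mn"
    by (intro borel_measurable_sum on_threshold_coordinate_measurable)
  show "\<bar>\<Sum>i=1..n. on_threshold z (z i)\<bar> \<le> real n" for z
    using sum_bounded_above[of "{1..n}" "\<lambda>i. on_threshold z (z i)" 1]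
    by (auto simp: abs_le_iff on_threshold_bounds sum_nonneg intro: order_trans[of _ 0])
qed (rule sum_on_threshold_le_count_deviation)

lemma transpose_permutes_indices:
  "i \<in> {1..n} \<Longrightarrow> j \<in> {1..n} \<Longrightarrow> bij_betw (Transposition.transpose i j) {1..n} {1..n}"
  by (rule bij_betwI[of _ _ _ "Transposition.transpose i j"]) (auto simp: Transposition.transpose_def)

abbreviation exchange :: "nat \<Rightarrow> nat \<Rightarrow> (nat \<Rightarrow> 'a) \<Rightarrow> nat \<Rightarrow> 'a" where
  "exchange i j z \<equiv> (\<lambda>l\<in>{1..n}. z (Transposition.transpose i j l))"

lemma thr_exchange:
  assumes "i \<in> {1..n}" "j \<in> {1..n}"
  shows "thr (exchange i j z) = thr z"
proof -
  have "thr (exchange i j z) =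
      rev_order_stat n (\<lambda>l. h (z (Transposition.transpose i j l))) k"
    unfolding thr_def by (rule rev_order_stat_cong) auto
  also have "\<dots> = thr z"
    unfolding thr_def by (rule rev_order_stat_permute[OF k transpose_permutes_indices[OF assms], of "\<lambda>l. h (z l)"])
  finally show ?thesis .
qed

lemma
  assumes ij: "i \<in> {1..n}" "j \<in> {1..n}"
  shows above_exchange: "above (exchange i j z) = above z"
    and disc_exchange: "disc (exchange i j z) = disc z"
    and mean_disc_exchange: "mean_disc (exchange i j z) = mean_disc z"
    and total_disc_exchange: "total_disc (exchange i j z) = total_disc z"
    and on_threshold_exchange: "on_threshold (exchange i j z) = on_threshold z"
proof -
  let ?z = "exchange i j z"
  note bij = transpose_permutes_indices[OF ij]
  show a: "above ?z = above z" by (simp only: above_def[abs_def] thr_exchange[OF ij])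
  show d: "disc ?z = disc z" by (simp only: disc_def[abs_def] a)
  show "mean_disc ?z = mean_disc z" by (simp only: mean_disc_def d)
  have "total_disc ?z = (\<Sum>l\<in>{1..n}. disc z (z (Transposition.transpose i j l)))"
    unfolding total_disc_def d by (intro sum.cong) auto
  also have "\<dots> = total_disc z"
    unfolding total_disc_def by (rule sum.reindex_bij_betw[OF bij])
  finally show "total_disc ?z = total_disc z" .
  show "on_threshold ?z = on_threshold z"
  proof
    fix x
    have "{l \<in> {1..n}. h x \<le> h (?z l)} = {l \<in> {1..n}. h x \<le> h (z (Transposition.transpose i j l))}" by auto
    also have "card \<dots> = card {l \<in> {1..n}. h x \<le> h (z l)}" by (rule card_permuted_indices[OF bij])
    finally show "on_threshold ?z x = on_threshold z x" by (simp add: on_threshold_def)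
  qed
qed

lemma above_coordinate_integrable: "i \<in> {1..n} \<Longrightarrow> integrable Mn (\<lambda>z. above z (z i))"
  using above_coordinate_measurable above_bounds by (intro Mn.integrable_in_interval) auto

lemma disc_coordinate_integrable: "i \<in> {1..n} \<Longrightarrow> integrable Mn (\<lambda>z. disc z (z i))"
  using disc_coordinate_measurable disc_bounds by (intro Mn.integrable_in_interval) auto

lemma on_threshold_coordinate_integrable: "i \<in> {1..n} \<Longrightarrow> integrable Mn (\<lambda>z. on_threshold z (z i))"
  using on_threshold_coordinate_measurable on_threshold_bounds by (intro Mn.integrable_in_interval) auto

lemma total_disc_integrable: "integrable Mn total_disc"
  using total_disc_bounds by (intro Mn.integrable_in_interval) auto

lemma expectation_above: assumes i: "i \<in> {1..n}" shows "(\<integral>z. above z (z i) \<partial>Mn) \<le> real k / real n"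
proof -
  have "real (card {1..n}) * (\<integral>z. above z (z i) \<partial>Mn) = (\<Sum>j=1..n. (\<integral>z. above z (z j) \<partial>Mn))"
    using i by (intro integral_exchangeable[where f = "\<lambda>i z. above z (z i)"] above_coordinate_measurable)
      (auto simp: above_exchange)
  also have "\<dots> = (\<integral>z. (\<Sum>j=1..n. above z (z j)) \<partial>Mn)"
    using above_coordinate_integrable by (intro Bochner_Integration.integral_sum[symmetric])
  also have "\<dots> \<le> real k"
  proof (intro Mn.integral_le_const Bochner_Integration.integrable_sum AE_I2 above_coordinate_integrable)
    fix z show "(\<Sum>j=1..n. above z (z j)) \<le> real k" using sum_above_le[of z] by linarith
  qed
  finally show ?thesis using n_pos by (simp add: field_simps)
qed

lemma expectation_disc: assumes i: "i \<in> {1..n}" shows "(\<integral>z. disc z (z i) \<partial>Mn) \<le> 39 * sqrt (real k) / real n"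
proof -
  have "real (card {1..n}) * (\<integral>z. disc z (z i) \<partial>Mn) = (\<Sum>j=1..n. (\<integral>z. disc z (z j) \<partial>Mn))"
    using i by (intro integral_exchangeable[where f = "\<lambda>i z. disc z (z i)"] disc_coordinate_measurable)
      (auto simp: disc_exchange)
  also have "\<dots> = (\<integral>z. total_disc z \<partial>Mn)"
    unfolding total_disc_def using disc_coordinate_integrable by (intro Bochner_Integration.integral_sum[symmetric])
  also have "\<dots> \<le> 39 * sqrt (real k)" by (rule expectation_total_disc)
  finally show ?thesis using n_pos by (simp add: field_simps)
qed

lemma expectation_on_threshold:
  assumes i: "i \<in> {1..n}" shows "(\<integral>z. on_threshold z (z i) \<partial>Mn) \<le> 39 * sqrt (real k) / real n"
proof -
  have "real (card {1..n}) * (\<integral>z. on_threshold z (z i) \<partial>Mn) = (\<Sum>j=1..n. (\<integral>z. on_threshold z (z j) \<partial>Mn))"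
    using i by (intro integral_exchangeable[where f = "\<lambda>i z. on_threshold z (z i)"] on_threshold_coordinate_measurable)
      (auto simp: on_threshold_exchange)
  also have "\<dots> = (\<integral>z. (\<Sum>j=1..n. on_threshold z (z j)) \<partial>Mn)"
    using on_threshold_coordinate_integrable by (intro Bochner_Integration.integral_sum[symmetric])
  also have "\<dots> \<le> 39 * sqrt (real k)" by (rule expectation_sum_on_threshold)
  finally show ?thesis using n_pos by (simp add: field_simps)
qed

text \<open>Multiplying a symmetric statistic by the indicator that a given point exceeds the threshold costs the factor
  \<open>k / n\<close>, because fewer than \<open>k\<close> of the exchangeable points exceed it.\<close>

lemma expectation_above_times:
  assumes i: "i \<in> {1..n}"
    and f: "f \<in> borel_measurable Mn" "\<And>z. z \<in> space Mn \<Longrightarrow> 0 \<le> f z \<and> f z \<le> b"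
    and sym: "\<And>i j z. i \<in> {1..n} \<Longrightarrow> j \<in> {1..n} \<Longrightarrow> f (exchange i j z) = f z"
  shows "(\<integral>z. above z (z i) * f z \<partial>Mn) \<le> real k / real n * (\<integral>z. f z \<partial>Mn)"
proof -
  have int: "integrable Mn (\<lambda>z. above z (z j) * f z)" if "j \<in> {1..n}" for j
  proof (rule Mn.integrable_bounded_real[of _ "1 * b"])
    show "(\<lambda>z. above z (z j) * f z) \<in> borel_measurable Mn"
      by (intro borel_measurable_times above_coordinate_measurable that f(1))
    fix z assume "z \<in> space Mn"
    thus "\<bar>above z (z j) * f z\<bar> \<le> 1 * b"
      unfolding abs_mult using f(2)[of z] above_bounds[of z "z j"] by (intro mult_mono) auto
  qed
  have f_int: "integrable Mn f" using f by (rule Mn.integrable_in_interval)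
  have "real (card {1..n}) * (\<integral>z. above z (z i) * f z \<partial>Mn) = (\<Sum>j=1..n. (\<integral>z. above z (z j) * f z \<partial>Mn))"
    using i by (intro integral_exchangeable[where f = "\<lambda>i z. above z (z i) * f z"] borel_measurable_times above_coordinate_measurable f(1))
      (auto simp: above_exchange sym)
  also have "\<dots> = (\<integral>z. (\<Sum>j=1..n. above z (z j) * f z) \<partial>Mn)"
    using int by (intro Bochner_Integration.integral_sum[symmetric])
  also have "\<dots> \<le> (\<integral>z. real k * f z \<partial>Mn)"
  proof (rule integral_mono)
    show "integrable Mn (\<lambda>z. \<Sum>j=1..n. above z (z j) * f z)" using int by (intro Bochner_Integration.integrable_sum)
    show "integrable Mn (\<lambda>z. real k * f z)" using f_int by simp
    fix z assume "z \<in> space Mn"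
    thus "(\<Sum>j=1..n. above z (z j) * f z) \<le> real k * f z"
      unfolding sum_distrib_right[symmetric] using f(2)[of z] sum_above_le[of z] by (intro mult_right_mono) auto
  qed
  also have "\<dots> = real k * (\<integral>z. f z \<partial>Mn)" by simp
  finally show ?thesis using n_pos by (simp add: field_simps)
qed

text \<open>The pair \<open>(i, l)\<close> is typical among pairs of distinct indices: first \<open>l\<close> is averaged with \<open>i\<close> fixed, then \<open>i\<close>.\<close>

lemma expectation_above_disc:
  assumes i: "i \<in> {1..n}" and l: "l \<in> {1..n}" "l \<noteq> i"
  shows "(\<integral>z. above z (z i) * disc z (z l) \<partial>Mn) \<le> real k / real n * (39 * sqrt (real k) / (real n - 1))"
proof -
  have n2: "2 \<le> n" using i l by auto
  have meas: "(\<lambda>z. above z (z i) * disc z (z j)) \<in> borel_measurable Mn" if "j \<in> {1..n}" for j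
    using i that by (intro borel_measurable_times above_coordinate_measurable disc_coordinate_measurable)
  have int: "integrable Mn (\<lambda>z. above z (z i) * disc z (z j))" if "j \<in> {1..n}" for j
    using meas[OF that] above_bounds disc_bounds
    by (intro Mn.integrable_bounded_real[of _ "1 * 1"]) (auto simp: abs_mult intro!: mult_le_one)
  have "real (card ({1..n} - {i})) * (\<integral>z. above z (z i) * disc z (z l) \<partial>Mn) =
      (\<Sum>j\<in>{1..n} - {i}. (\<integral>z. above z (z i) * disc z (z j) \<partial>Mn))"
    using i l by (intro integral_exchangeable[where f = "\<lambda>j z. above z (z i) * disc z (z j)"] meas)
      (auto simp: above_exchange disc_exchange transpose_apply_other)
  also have "\<dots> = (\<integral>z. (\<Sum>j\<in>{1..n} - {i}. above z (z i) * disc z (z j)) \<partial>Mn)"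
    using int by (intro Bochner_Integration.integral_sum[symmetric]) auto
  also have "\<dots> \<le> (\<integral>z. above z (z i) * total_disc z \<partial>Mn)"
  proof (rule integral_mono)
    show "integrable Mn (\<lambda>z. \<Sum>j\<in>{1..n} - {i}. above z (z i) * disc z (z j))"
      using int by (intro Bochner_Integration.integrable_sum) auto
    show "integrable Mn (\<lambda>z. above z (z i) * total_disc z)"
      unfolding total_disc_def sum_distrib_left using int by (intro Bochner_Integration.integrable_sum)
    fix z
    show "(\<Sum>j\<in>{1..n} - {i}. above z (z i) * disc z (z j)) \<le> above z (z i) * total_disc z"
      unfolding total_disc_def sum_distrib_left using above_bounds disc_bounds
      by (intro sum_mono2) (auto intro!: mult_nonneg_nonneg)
  qed
  also have "\<dots> \<le> real k / real n * (\<integral>z. total_disc z \<partial>Mn)"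
    using total_disc_bounds by (intro expectation_above_times[OF i, of _ "real n"]) (auto simp: total_disc_exchange)
  also have "\<dots> \<le> real k / real n * (39 * sqrt (real k))"
    by (intro mult_left_mono expectation_total_disc) auto
  finally have "(real n - 1) * (\<integral>z. above z (z i) * disc z (z l) \<partial>Mn) \<le> real k / real n * (39 * sqrt (real k))"
    using i n2 by (simp add: of_nat_diff)
  thus ?thesis using n2 by (simp add: pos_le_divide_eq mult.commute)
qed

text \<open>Resampling coordinate \<open>i\<close> changes by at most one the number of points at or above the old \<open>z i\<close>. This can flip
  its status relative to the threshold only if that number was \<open>k\<close>.\<close>

lemma disc_update_le:
  assumes i: "i \<in> {1..n}"
  shows "disc (z(i := w)) (z i) \<le> disc z (z i) + on_threshold z (z i)"
proof -
  define C where "C = {l \<in> {1..n} - {i}. h (z i) \<le> h (z l)}"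
  have C: "finite C" "i \<notin> C" by (auto simp: C_def)
  have 1: "{l \<in> {1..n}. h (z i) \<le> h (z l)} = insert i C" using i by (auto simp: C_def)
  have 2: "{l \<in> {1..n}. h (z i) \<le> h ((z(i := w)) l)} = (if h (z i) \<le> h w then insert i C else C)"
    using i by (auto simp: C_def)
  have "above z (z i) = of_bool (card C + 1 < k)"
    unfolding above_def thr_def rev_order_stat_less_iff[OF k] 1 using C by simp
  moreover have "above (z(i := w)) (z i) = of_bool (card C + of_bool (h (z i) \<le> h w) < k)"
    unfolding above_def thr_def rev_order_stat_less_iff[OF k] 2 using C by simp
  moreover have "on_threshold z (z i) = of_bool (card C + 1 = k)"
    unfolding on_threshold_def 1 using C by simp
  ultimately show ?thesis unfolding disc_def in_tail_def by (auto simp: of_bool_def)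
qed

lemma integral_fst_pair:
  fixes f :: "_ \<Rightarrow> real"
  assumes "f \<in> borel_measurable Mn"
  shows "(\<integral>p. f (fst p) \<partial>(Mn \<Otimes>\<^sub>M M)) = (\<integral>z. f z \<partial>Mn)"
  using integral_distr[OF measurable_fst[of Mn M] assms] by (simp add: distr_pair_fst)

text \<open>A fresh point is exchanged with the first sample point; after the exchange the threshold is the one of the
  resampled data, and \<open>disc_update_le\<close> compares it with the original one.\<close>

lemma expectation_mean_disc: "(\<integral>z. mean_disc z \<partial>Mn) \<le> 78 * sqrt (real k) / real n"
proof -
  have i: "1 \<in> {1..n}" using n_pos by simp
  have int: "integrable (Mn \<Otimes>\<^sub>M M) (\<lambda>p. disc (fst p) (snd p))"
    using disc_bounds by (intro MnM.integrable_in_interval) auto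
  note m = measurable_compose[OF measurable_fst[of Mn M] disc_coordinate_measurable[OF i]]
    measurable_compose[OF measurable_fst[of Mn M] on_threshold_coordinate_measurable[OF i]]
  have "(\<integral>z. mean_disc z \<partial>Mn) = (\<integral>p. disc (fst p) (snd p) \<partial>(Mn \<Otimes>\<^sub>M M))"
    unfolding mean_disc_def using MnM.integral_fst'[OF int] by simp
  also have "\<dots> = (\<integral>p. disc ((fst p)(1 := snd p)) (fst p 1) \<partial>(Mn \<Otimes>\<^sub>M M))"
    using integral_swap_coordinate[OF _ i disc_pair_measurable] by simp
  also have "\<dots> \<le> (\<integral>p. disc (fst p) (fst p 1) + on_threshold (fst p) (fst p 1) \<partial>(Mn \<Otimes>\<^sub>M M))"
  proof (rule integral_mono)
    have "(\<lambda>p. disc ((fst p)(1 := snd p)) (fst p 1)) \<in> borel_measurable (Mn \<Otimes>\<^sub>M M)"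
      using measurable_compose[OF measurable_swap_coordinate[OF i, of M] disc_pair_measurable] by (simp add: case_prod_unfold)
    thus "integrable (Mn \<Otimes>\<^sub>M M) (\<lambda>p. disc ((fst p)(1 := snd p)) (fst p 1))"
      using disc_bounds by (intro MnM.integrable_in_interval) auto
    show "integrable (Mn \<Otimes>\<^sub>M M) (\<lambda>p. disc (fst p) (fst p 1) + on_threshold (fst p) (fst p 1))"
      using m disc_bounds on_threshold_bounds
      by (intro Bochner_Integration.integrable_add MnM.integrable_in_interval) auto
  qed (rule disc_update_le[OF i])
  also have "\<dots> = (\<integral>z. disc z (z 1) + on_threshold z (z 1) \<partial>Mn)"
    using disc_coordinate_measurable[OF i] on_threshold_coordinate_measurable[OF i]
    by (intro integral_fst_pair[where f = "\<lambda>z. disc z (z 1) + on_threshold z (z 1)"]) simp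
  also have "\<dots> = (\<integral>z. disc z (z 1) \<partial>Mn) + (\<integral>z. on_threshold z (z 1) \<partial>Mn)"
    by (intro Bochner_Integration.integral_add disc_coordinate_integrable on_threshold_coordinate_integrable i)
  also have "\<dots> \<le> 39 * sqrt (real k) / real n + 39 * sqrt (real k) / real n"
    by (intro add_mono expectation_disc expectation_on_threshold i)
  finally show ?thesis by simp
qed

lemma expectation_above_mean_disc:
  assumes i: "i \<in> {1..n}"
  shows "(\<integral>z. above z (z i) * mean_disc z \<partial>Mn) \<le> real k / real n * (78 * sqrt (real k) / real n)"
proof -
  have "(\<integral>z. above z (z i) * mean_disc z \<partial>Mn) \<le> real k / real n * (\<integral>z. mean_disc z \<partial>Mn)"
    using mean_disc_bounds by (intro expectation_above_times[OF i, of _ 1]) (auto simp: mean_disc_exchange)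
  also have "\<dots> \<le> real k / real n * (78 * sqrt (real k) / real n)"
    by (intro mult_left_mono expectation_mean_disc) auto
  finally show ?thesis .
qed

end

section \<open>Cross-validated empirical risk minimizers\<close>

text \<open>Minimality of \<open>\<Psi>\<close> is stated for unnormalized sums, so that the empty training set needs no separate
  treatment; locality allows \<open>\<Psi>\<close> to depend on the threshold of the full sample.\<close>

locale tail_erm = tail_sample M h t n k for M :: "'a measure" and h t n k +
  fixes G :: "'g set" and c :: "'g \<Rightarrow> 'a \<Rightarrow> real" and v :: nat
    and \<Psi> :: "nat set \<Rightarrow> (nat \<Rightarrow> 'a) \<Rightarrow> 'g"
  assumes class_measurable: "P_measurable_class M (c ` G)"
    and c_bounds: "\<And>g x. g \<in> G \<Longrightarrow> x \<in> space M \<Longrightarrow> 0 \<le> c g x \<and> c g x \<le> 1"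
    and class_vc: "vc_dim (subgraphs (space M) (c ` G)) \<le> enat v"
    and \<Psi>_in: "\<And>T z. T \<subseteq> {1..n} \<Longrightarrow> z \<in> space (Pi\<^sub>M {1..n} (\<lambda>_. M)) \<Longrightarrow> \<Psi> T z \<in> G"
    and \<Psi>_minimal: "\<And>T z g. T \<subseteq> {1..n} \<Longrightarrow> z \<in> space (Pi\<^sub>M {1..n} (\<lambda>_. M)) \<Longrightarrow> g \<in> G \<Longrightarrow>
      (\<Sum>i\<in>T. above z (z i) * c (\<Psi> T z) (z i)) \<le> (\<Sum>i\<in>T. above z (z i) * c g (z i))"
    and \<Psi>_local: "\<And>T z z'. T \<subseteq> {1..n} \<Longrightarrow> z \<in> space (Pi\<^sub>M {1..n} (\<lambda>_. M)) \<Longrightarrow> z' \<in> space (Pi\<^sub>M {1..n} (\<lambda>_. M)) \<Longrightarrow>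
      (\<forall>i\<in>T. z i = z' i) \<Longrightarrow> thr z = thr z' \<Longrightarrow> \<Psi> T z = \<Psi> T z'"
    and \<Psi>_measurable: "\<And>T. T \<subseteq> {1..n} \<Longrightarrow>
      (\<lambda>p. c (\<Psi> T (fst p)) (snd p)) \<in> borel_measurable (Pi\<^sub>M {1..n} (\<lambda>_. M) \<Otimes>\<^sub>M M)"
begin

definition \<alpha> :: real where "\<alpha> = real k / real n"

definition risk :: "'g \<Rightarrow> real" where "risk g = (\<integral>x. c g x * in_tail x \<partial>M) / \<alpha>"

lemma \<alpha>_pos: "0 < \<alpha>" and n_\<alpha>: "real n * \<alpha> = real k"
  using k by (simp_all add: \<alpha>_def)

lemma c_measurable: "g \<in> G \<Longrightarrow> c g \<in> borel_measurable M"
  using class_measurable unfolding P_measurable_class_def by blast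

lemma coordinate_in_space: "z \<in> space Mn \<Longrightarrow> i \<in> {1..n} \<Longrightarrow> z i \<in> space M"
  by (auto simp: space_PiM PiE_def Pi_def)

lemma in_tail_integrable: "integrable M in_tail"
  using in_tail_bounds by (intro integrable_in_interval) auto

lemma c_in_tail_integrable: "g \<in> G \<Longrightarrow> integrable M (\<lambda>x. c g x * in_tail x)"
  using c_measurable c_bounds in_tail_bounds by (intro integrable_in_interval) (auto intro: mult_le_one)

lemma risk_bounds: assumes g: "g \<in> G" shows "0 \<le> risk g" "risk g \<le> 1"
proof -
  show "0 \<le> risk g" unfolding risk_def using c_bounds[OF g] in_tail_bounds \<alpha>_pos
    by (intro divide_nonneg_nonneg integral_nonneg_AE AE_I2 mult_nonneg_nonneg) auto
  have "(\<integral>x. c g x * in_tail x \<partial>M) \<le> (\<integral>x. in_tail x \<partial>M)"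
  proof (rule integral_mono[OF c_in_tail_integrable[OF g]])
    show "integrable M in_tail" by (rule in_tail_integrable)
    show "c g x * in_tail x \<le> in_tail x" if "x \<in> space M" for x
      using c_bounds[OF g that] in_tail_bounds[of x] by (simp add: mult_left_le_one_le)
  qed
  also have "\<dots> = \<alpha>" by (simp add: integral_in_tail \<alpha>_def)
  finally show "risk g \<le> 1" unfolding risk_def using \<alpha>_pos by (simp add: field_simps)
qed

lemma \<alpha>_risk: "\<alpha> * risk g = (\<integral>x. c g x * in_tail x \<partial>M)"
  using \<alpha>_pos by (simp add: risk_def)

lemma risk_measurable:
  assumes T: "T \<subseteq> {1..n}" shows "(\<lambda>z. risk (\<Psi> T z)) \<in> borel_measurable Mn"
proof -
  have "(\<lambda>p. c (\<Psi> T (fst p)) (snd p) * in_tail (snd p)) \<in> borel_measurable (Mn \<Otimes>\<^sub>M M)"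
    using \<Psi>_measurable[OF T] by simp
  hence "(\<lambda>z. \<integral>x. c (\<Psi> T z) x * in_tail x \<partial>M) \<in> borel_measurable Mn"
    using borel_measurable_lebesgue_integral[of "\<lambda>z x. c (\<Psi> T z) x * in_tail x" Mn] by (simp add: case_prod_unfold)
  thus ?thesis by (simp add: risk_def)
qed

lemma loss_measurable:
  assumes T: "T \<subseteq> {1..n}" and i: "i \<in> {1..n}"
  shows "(\<lambda>z. above z (z i) * c (\<Psi> T z) (z i)) \<in> borel_measurable Mn"
  using measurable_compose[OF coordinate_pair_measurable[OF i] \<Psi>_measurable[OF T]] above_coordinate_measurable[OF i] by simp

lemma loss_bounds:
  assumes T: "T \<subseteq> {1..n}" and i: "i \<in> {1..n}" and z: "z \<in> space Mn"
  shows "0 \<le> above z (z i) * c (\<Psi> T z) (z i)" "above z (z i) * c (\<Psi> T z) (z i) \<le> 1"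
  using c_bounds[OF \<Psi>_in[OF T z] coordinate_in_space[OF z i]] above_bounds[of z "z i"]
  by (auto intro: mult_le_one)

lemma loss_integrable:
  assumes "T \<subseteq> {1..n}" "i \<in> {1..n}"
  shows "integrable Mn (\<lambda>z. above z (z i) * c (\<Psi> T z) (z i))"
  using loss_bounds[OF assms] loss_measurable[OF assms] by (intro Mn.integrable_in_interval) auto

lemma risk_above_integrable:
  assumes T: "T \<subseteq> {1..n}" and i: "i \<in> {1..n}"
  shows "integrable Mn (\<lambda>z. above z (z i) * risk (\<Psi> T z))"
  using above_bounds risk_bounds[OF \<Psi>_in[OF T]] above_coordinate_measurable[OF i] risk_measurable[OF T]
  by (intro Mn.integrable_in_interval) (auto intro: mult_le_one)

lemma tail_deviation_majorant:
  assumes T: "T \<subseteq> {1..n}" "T \<noteq> {}"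
  shows "\<exists>D\<in>borel_measurable Mn. (\<forall>z\<in>space Mn. 0 \<le> D z \<and> D z \<le> 2 * real (card T) \<and>
      (\<forall>g\<in>G. \<bar>(\<Sum>i\<in>T. c g (z i) * in_tail (z i)) - real (card T) * (\<alpha> * risk g)\<bar> \<le> D z)) \<and>
    (\<forall>z z'. (\<forall>i\<in>T. z i = z' i) \<longrightarrow> D z = D z') \<and>
    (\<integral>z. D z \<partial>Mn) \<le> 38 * sqrt ((real v + 1) * (real (card T) * \<alpha>))"
proof -
  define A where "A = {x \<in> space M. t \<le> h x}"
  have A: "A \<in> events" "prob A = \<alpha>" by (simp_all add: A_def tail_prob \<alpha>_def)
  have G: "c ` G \<noteq> {}"
  proof -
    obtain z where "z \<in> space Mn" using Mn.not_empty by blast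
    thus ?thesis using \<Psi>_in[of "{}" z] by auto
  qed
  have fT: "finite T" using T(1) by (rule finite_subset) simp
  have bounds: "\<forall>f\<in>c ` G. \<forall>x\<in>space M. 0 \<le> f x \<and> f x \<le> 1" using c_bounds by auto
  have pA: "0 < prob A" using A \<alpha>_pos by simp
  obtain D where D: "deviation_majorant (c ` G) A {1..n} T D" "\<forall>z z'. (\<forall>i\<in>T. z i = z' i) \<longrightarrow> D z = D z'"
    "(\<integral>z. D z \<partial>Mn) \<le> 38 * sqrt ((real v + 1) * (real (card T) * prob A))"
    using uniform_deviation_on_subsample[OF class_measurable G bounds class_vc A(1) pA fT T(2,1)]
    by (elim exE conjE)
  have "\<bar>(\<Sum>i\<in>T. c g (z i) * in_tail (z i)) - real (card T) * (\<alpha> * risk g)\<bar> \<le> D z"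
    if z: "z \<in> space Mn" and g: "g \<in> G" for z g
  proof -
    have "(\<Sum>i\<in>T. c g (z i) * in_tail (z i)) = (\<Sum>i\<in>T. c g (z i) * indicator A (z i))"
      using T(1) coordinate_in_space[OF z] by (intro sum.cong) (auto simp: A_def in_tail_def indicator_def)
    moreover have "\<alpha> * risk g = (\<integral>x. c g x * indicator A x \<partial>M)"
      unfolding \<alpha>_risk by (intro Bochner_Integration.integral_cong) (auto simp: A_def in_tail_def indicator_def)
    ultimately show ?thesis using D(1) z g by (simp add: deviation_majorant_def)
  qed
  thus ?thesis using D A(2) by (intro bexI[of _ D]) (auto simp: deviation_majorant_def)
qed

lemma expectation_in_tail_times_independent:
  assumes i: "i \<in> {1..n}" and D: "D \<in> borel_measurable Mn" "\<And>z. z \<in> space Mn \<Longrightarrow> \<bar>D z\<bar> \<le> b"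
    and indep: "\<And>z w. D (z(i := w)) = D z"
  shows "(\<integral>z. in_tail (z i) * D z \<partial>Mn) = \<alpha> * (\<integral>z. D z \<partial>Mn)"
proof -
  have upd: "(\<lambda>p. (fst p)(i := snd p)) \<in> Mn \<Otimes>\<^sub>M M \<rightarrow>\<^sub>M Mn"
    using measurable_compose[OF measurable_swap_coordinate[OF i, of M] measurable_fst] by (simp add: case_prod_unfold)
  have f: "(\<lambda>z. in_tail (z i) * D z) \<in> borel_measurable Mn"
    using in_tail_coordinate_measurable[OF i] D(1) by simp
  have int: "integrable (Mn \<Otimes>\<^sub>M M) (\<lambda>p. in_tail (snd p) * D (fst p))"
  proof (rule MnM.integrable_bounded_real[of _ "1 * b"])
    show "(\<lambda>p. in_tail (snd p) * D (fst p)) \<in> borel_measurable (Mn \<Otimes>\<^sub>M M)" using D(1) by simp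
    fix p assume "p \<in> space (Mn \<Otimes>\<^sub>M M)"
    hence "fst p \<in> space Mn" by (auto simp: space_pair_measure)
    thus "\<bar>in_tail (snd p) * D (fst p)\<bar> \<le> 1 * b"
      unfolding abs_mult using in_tail_bounds[of "snd p"] D(2) by (intro mult_mono) auto
  qed
  have "(\<integral>z. in_tail (z i) * D z \<partial>Mn) = (\<integral>z. in_tail (z i) * D z \<partial>distr (Mn \<Otimes>\<^sub>M M) Mn (\<lambda>p. (fst p)(i := snd p)))"
    by (simp only: distr_resample_coordinate[OF finite_atLeastAtMost i])
  also have "\<dots> = (\<integral>p. in_tail (((fst p)(i := snd p)) i) * D ((fst p)(i := snd p)) \<partial>(Mn \<Otimes>\<^sub>M M))"
    by (rule integral_distr[OF upd f])
  also have "\<dots> = (\<integral>p. in_tail (snd p) * D (fst p) \<partial>(Mn \<Otimes>\<^sub>M M))" by (simp add: indep)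
  also have "\<dots> = (\<integral>z. (\<integral>x. in_tail x * D z \<partial>M) \<partial>Mn)" using MnM.integral_fst'[OF int] by simp
  also have "\<dots> = \<alpha> * (\<integral>z. D z \<partial>Mn)" by (simp add: integral_in_tail \<alpha>_def)
  finally show ?thesis .
qed

text \<open>The usual comparison of an empirical minimizer with a competitor \<open>g\<close>, with an additional term because the
  minimized empirical risk uses the random threshold. Costs lie in \<open>[0, 1]\<close>, so replacing one indicator
  changes the difference of the two unnormalized sums by at most one.\<close>

lemma excess_risk_le:
  assumes T: "T \<subseteq> {1..n}" and z: "z \<in> space Mn" and g: "g \<in> G"
    and dev: "\<And>g. g \<in> G \<Longrightarrow> \<bar>(\<Sum>i\<in>T. c g (z i) * in_tail (z i)) - real (card T) * (\<alpha> * risk g)\<bar> \<le> d"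
  shows "real (card T) * \<alpha> * (risk (\<Psi> T z) - risk g) \<le> 2 * d + (\<Sum>l\<in>T. disc z (z l))"
proof -
  let ?g = "\<Psi> T z"
  have gG: "?g \<in> G" by (rule \<Psi>_in[OF T z])
  have "(\<Sum>i\<in>T. c ?g (z i) * in_tail (z i)) - (\<Sum>i\<in>T. c g (z i) * in_tail (z i)) =
      (\<Sum>i\<in>T. (c ?g (z i) - c g (z i)) * (in_tail (z i) - above z (z i))) +
      ((\<Sum>i\<in>T. above z (z i) * c ?g (z i)) - (\<Sum>i\<in>T. above z (z i) * c g (z i)))"
    unfolding sum_subtractf[symmetric] sum.distrib[symmetric] by (intro sum.cong) (auto simp: algebra_simps)
  also have "\<dots> \<le> (\<Sum>l\<in>T. disc z (z l)) + 0"
  proof (intro add_mono sum_mono)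
    fix i assume "i \<in> T"
    hence zi: "z i \<in> space M" using T coordinate_in_space[OF z] by auto
    have "(c ?g (z i) - c g (z i)) * (in_tail (z i) - above z (z i)) \<le> \<bar>c ?g (z i) - c g (z i)\<bar> * \<bar>in_tail (z i) - above z (z i)\<bar>"
      by (metis abs_ge_self abs_mult)
    also have "\<dots> \<le> 1 * \<bar>in_tail (z i) - above z (z i)\<bar>"
      using c_bounds[OF gG zi] c_bounds[OF g zi] by (intro mult_right_mono) auto
    finally show "(c ?g (z i) - c g (z i)) * (in_tail (z i) - above z (z i)) \<le> disc z (z i)"
      by (simp add: disc_def abs_minus_commute)
  qed (use \<Psi>_minimal[OF T z g] in simp)
  finally have "(\<Sum>i\<in>T. c ?g (z i) * in_tail (z i)) - (\<Sum>i\<in>T. c g (z i) * in_tail (z i)) \<le> (\<Sum>l\<in>T. disc z (z l))" by simp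
  moreover have "real (card T) * \<alpha> * (risk ?g - risk g) = real (card T) * (\<alpha> * risk ?g) - real (card T) * (\<alpha> * risk g)"
    by (simp add: algebra_simps)
  ultimately show ?thesis using dev[OF gG] dev[OF g] by linarith
qed

text \<open>When both the held-out point and the fresh point exceed the threshold, exchanging them changes neither the
  threshold nor the rule trained on \<open>T\<close>. This replaces the independence that the common threshold destroys.\<close>

lemma swap_held_out:
  assumes T: "T \<subseteq> {1..n}" and i: "i \<in> {1..n}" "i \<notin> T"
  shows "(\<integral>p. above (fst p) (fst p i) * above (fst p) (snd p) * c (\<Psi> T (fst p)) (fst p i) \<partial>(Mn \<Otimes>\<^sub>M M)) =
    (\<integral>p. above (fst p) (fst p i) * above (fst p) (snd p) * c (\<Psi> T (fst p)) (snd p) \<partial>(Mn \<Otimes>\<^sub>M M))"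
proof -
  define f where "f = (\<lambda>p. above (fst p) (fst p i) * above (fst p) (snd p) * c (\<Psi> T (fst p)) (snd p))"
  have "(\<lambda>p. above (fst p) (fst p i)) \<in> borel_measurable (Mn \<Otimes>\<^sub>M M)"
    using measurable_compose[OF measurable_fst[of Mn M] above_coordinate_measurable[OF i(1)]] .
  hence f: "f \<in> borel_measurable (Mn \<Otimes>\<^sub>M M)" unfolding f_def using \<Psi>_measurable[OF T] by simp
  have "(\<integral>p. above (fst p) (fst p i) * above (fst p) (snd p) * c (\<Psi> T (fst p)) (fst p i) \<partial>(Mn \<Otimes>\<^sub>M M)) =
      (\<integral>p. f ((fst p)(i := snd p), fst p i) \<partial>(Mn \<Otimes>\<^sub>M M))"
  proof (rule Bochner_Integration.integral_cong[OF refl])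
    fix p assume p: "p \<in> space (Mn \<Otimes>\<^sub>M M)"
    obtain z w where zw: "p = (z, w)" by (cases p)
    define z' where "z' = z(i := w)"
    have z: "z \<in> space Mn" and w: "w \<in> space M" using p by (auto simp: zw space_pair_measure)
    have z': "z' \<in> space Mn" using z w i(1) by (auto simp: z'_def space_PiM PiE_def Pi_def extensional_def)
    have 1: "thr z' = thr z" if "thr z < h (z i)" "thr z < h w"
      unfolding thr_def using that
      by (intro rev_order_stat_update_above[OF k, of "\<lambda>l. h (z l)" i]) (auto simp: thr_def z'_def)
    have 2: "thr z = thr z'" if "thr z' < h w" "thr z' < h (z i)"
      unfolding thr_def using that
      by (intro rev_order_stat_update_above[OF k, of "\<lambda>l. h (z' l)" i]) (auto simp: thr_def z'_def)
    have "above z' w * above z' (z i) * c (\<Psi> T z') (z i) = above z (z i) * above z w * c (\<Psi> T z) (z i)"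
    proof (cases "thr z < h (z i) \<and> thr z < h w")
      case True
      hence eq: "thr z' = thr z" using 1 by simp
      have "\<Psi> T z' = \<Psi> T z"
        using i(2) by (intro \<Psi>_local[OF T z' z _ eq]) (auto simp: z'_def)
      thus ?thesis using True eq by (simp add: above_def)
    next
      case False
      hence "\<not> (thr z' < h w \<and> thr z' < h (z i))" using 2 by auto
      thus ?thesis using False by (auto simp: above_def)
    qed
    thus "above (fst p) (fst p i) * above (fst p) (snd p) * c (\<Psi> T (fst p)) (fst p i) = f ((fst p)(i := snd p), fst p i)"
      by (simp add: f_def zw z'_def)
  qed
  also have "\<dots> = (\<integral>p. f p \<partial>(Mn \<Otimes>\<^sub>M M))" by (rule integral_swap_coordinate[OF _ i(1) f]) simp
  finally show ?thesis by (simp add: f_def)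
qed

text \<open>In \<open>swap_held_out\<close> the mass above the random threshold is replaced by the tail probability \<open>\<alpha>\<close>, once on
  either side, each time at the price \<open>mean_disc\<close>.\<close>

lemma expected_loss_le_expected_risk:
  assumes T: "T \<subseteq> {1..n}" and i: "i \<in> {1..n}" "i \<notin> T"
  shows "\<alpha> * (\<integral>z. above z (z i) * c (\<Psi> T z) (z i) \<partial>Mn) \<le>
    \<alpha> * (\<integral>z. above z (z i) * risk (\<Psi> T z) \<partial>Mn) + 2 * (\<integral>z. above z (z i) * mean_disc z \<partial>Mn)"
proof -
  let ?I = "\<lambda>z. above z (z i)"
  have I_meas: "?I \<in> borel_measurable Mn" by (rule above_coordinate_measurable[OF i(1)])
  have Ip_meas: "(\<lambda>p. ?I (fst p)) \<in> borel_measurable (Mn \<Otimes>\<^sub>M M)"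
    using measurable_compose[OF measurable_fst[of Mn M] I_meas] .
  have md_int: "integrable Mn (\<lambda>z. ?I z * mean_disc z)"
    using I_meas above_bounds mean_disc_bounds by (intro Mn.integrable_in_interval) (auto intro: mult_le_one)
  note risk_int = risk_above_integrable[OF T i(1)]
  define f1 f2 where "f1 = (\<lambda>p. ?I (fst p) * above (fst p) (snd p) * c (\<Psi> T (fst p)) (fst p i))"
    and "f2 = (\<lambda>p. ?I (fst p) * above (fst p) (snd p) * c (\<Psi> T (fst p)) (snd p))"
  have ci_meas: "(\<lambda>p. c (\<Psi> T (fst p)) (fst p i)) \<in> borel_measurable (Mn \<Otimes>\<^sub>M M)"
    using measurable_compose[OF measurable_fst[of Mn M] measurable_compose[OF coordinate_pair_measurable[OF i(1)] \<Psi>_measurable[OF T]]]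
    by simp
  have f1_int: "integrable (Mn \<Otimes>\<^sub>M M) f1"
    unfolding f1_def using Ip_meas ci_meas c_bounds[OF \<Psi>_in[OF T] coordinate_in_space[OF _ i(1)]] above_bounds
    by (intro MnM.integrable_in_interval) (auto simp: space_pair_measure intro!: mult_le_one)
  have f2_int: "integrable (Mn \<Otimes>\<^sub>M M) f2"
    unfolding f2_def using Ip_meas \<Psi>_measurable[OF T] c_bounds[OF \<Psi>_in[OF T]] above_bounds
    by (intro MnM.integrable_in_interval) (auto simp: space_pair_measure intro!: mult_le_one)
  have lower: "\<alpha> * (?I z * c (\<Psi> T z) (z i)) - ?I z * mean_disc z \<le> (\<integral>x. f1 (z, x) \<partial>M)" if z: "z \<in> space Mn" for z
  proof -
    note tail_int = in_tail_integrable
    have "\<alpha> - mean_disc z = (\<integral>x. in_tail x - disc z x \<partial>M)"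
      using tail_int disc_integrable[OF z] by (simp add: integral_in_tail \<alpha>_def mean_disc_def)
    also have "\<dots> \<le> (\<integral>x. above z x \<partial>M)"
      using tail_int disc_integrable[OF z] above_integrable[OF z] by (intro integral_mono) (auto simp: disc_def)
    finally have *: "\<alpha> - mean_disc z \<le> (\<integral>x. above z x \<partial>M)" .
    have cb: "0 \<le> c (\<Psi> T z) (z i)" "c (\<Psi> T z) (z i) \<le> 1"
      using c_bounds[OF \<Psi>_in[OF T z] coordinate_in_space[OF z i(1)]] by auto
    have "\<alpha> * (?I z * c (\<Psi> T z) (z i)) - ?I z * mean_disc z \<le> (?I z * c (\<Psi> T z) (z i)) * (\<alpha> - mean_disc z)"
    proof -
      have "(?I z * c (\<Psi> T z) (z i)) * mean_disc z \<le> ?I z * mean_disc z"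
        using cb above_bounds[of z "z i"] mean_disc_bounds[OF z] by (intro mult_right_mono mult_left_le) auto
      thus ?thesis by (simp add: algebra_simps)
    qed
    also have "\<dots> \<le> (?I z * c (\<Psi> T z) (z i)) * (\<integral>x. above z x \<partial>M)"
      using * cb above_bounds[of z "z i"] by (intro mult_left_mono) auto
    also have "\<dots> = (\<integral>x. f1 (z, x) \<partial>M)"
    proof -
      have "(\<integral>x. f1 (z, x) \<partial>M) = (\<integral>x. (?I z * c (\<Psi> T z) (z i)) * above z x \<partial>M)"
        by (intro Bochner_Integration.integral_cong) (auto simp: f1_def)
      thus ?thesis by simp
    qed
    finally show ?thesis .
  qed
  have upper: "(\<integral>x. f2 (z, x) \<partial>M) \<le> \<alpha> * (?I z * risk (\<Psi> T z)) + ?I z * mean_disc z" if z: "z \<in> space Mn" for z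
  proof -
    have g: "\<Psi> T z \<in> G" by (rule \<Psi>_in[OF T z])
    have int: "integrable M (\<lambda>x. above z x * c (\<Psi> T z) x)"
      using above_measurable[OF z] c_measurable[OF g] c_bounds[OF g] above_bounds
      by (intro integrable_in_interval) (auto intro: mult_le_one)
    have "(\<integral>x. f2 (z, x) \<partial>M) = (\<integral>x. ?I z * (above z x * c (\<Psi> T z) x) \<partial>M)"
      by (intro Bochner_Integration.integral_cong) (auto simp: f2_def)
    also have "\<dots> = ?I z * (\<integral>x. above z x * c (\<Psi> T z) x \<partial>M)" by simp
    finally have f2_eq: "(\<integral>x. f2 (z, x) \<partial>M) = ?I z * (\<integral>x. above z x * c (\<Psi> T z) x \<partial>M)" .
    have "(\<integral>x. above z x * c (\<Psi> T z) x \<partial>M) \<le> (\<integral>x. c (\<Psi> T z) x * in_tail x + disc z x \<partial>M)"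
    proof (rule integral_mono[OF int])
      show "integrable M (\<lambda>x. c (\<Psi> T z) x * in_tail x + disc z x)"
        using c_in_tail_integrable[OF g] disc_integrable[OF z] by simp
      fix x assume x: "x \<in> space M"
      show "above z x * c (\<Psi> T z) x \<le> c (\<Psi> T z) x * in_tail x + disc z x"
        using c_bounds[OF g x] by (auto simp: disc_def above_def in_tail_def)
    qed
    also have "\<dots> = \<alpha> * risk (\<Psi> T z) + mean_disc z"
      using c_in_tail_integrable[OF g] disc_integrable[OF z] by (simp add: \<alpha>_risk mean_disc_def)
    finally have "?I z * (\<integral>x. above z x * c (\<Psi> T z) x \<partial>M) \<le> ?I z * (\<alpha> * risk (\<Psi> T z) + mean_disc z)"
      using above_bounds[of z "z i"] by (intro mult_left_mono) auto
    thus ?thesis unfolding f2_eq by (simp add: algebra_simps)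
  qed
  have "\<alpha> * (\<integral>z. ?I z * c (\<Psi> T z) (z i) \<partial>Mn) - (\<integral>z. ?I z * mean_disc z \<partial>Mn) =
      (\<integral>z. \<alpha> * (?I z * c (\<Psi> T z) (z i)) - ?I z * mean_disc z \<partial>Mn)"
    using loss_integrable[OF T i(1)] md_int by simp
  also have "\<dots> \<le> (\<integral>z. (\<integral>x. f1 (z, x) \<partial>M) \<partial>Mn)"
    using loss_integrable[OF T i(1)] md_int MnM.integrable_fst'[OF f1_int] lower
    by (intro integral_mono Bochner_Integration.integrable_diff) auto
  also have "\<dots> = (\<integral>p. f1 p \<partial>(Mn \<Otimes>\<^sub>M M))" by (rule MnM.integral_fst'[OF f1_int])
  also have "\<dots> = (\<integral>p. f2 p \<partial>(Mn \<Otimes>\<^sub>M M))" unfolding f1_def f2_def by (rule swap_held_out[OF T i])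
  also have "\<dots> = (\<integral>z. (\<integral>x. f2 (z, x) \<partial>M) \<partial>Mn)" by (rule MnM.integral_fst'[OF f2_int, symmetric])
  also have "\<dots> \<le> (\<integral>z. \<alpha> * (?I z * risk (\<Psi> T z)) + ?I z * mean_disc z \<partial>Mn)"
    using risk_int md_int MnM.integrable_fst'[OF f2_int] upper
    by (intro integral_mono Bochner_Integration.integrable_add) auto
  also have "\<dots> = \<alpha> * (\<integral>z. ?I z * risk (\<Psi> T z) \<partial>Mn) + (\<integral>z. ?I z * mean_disc z \<partial>Mn)"
    using risk_int md_int by simp
  finally show ?thesis by simp
qed

definition rate :: "nat \<Rightarrow> real" where "rate m = sqrt (real v + 1) / sqrt (\<alpha> * real m)"

lemma rate_pos: "0 < m \<Longrightarrow> 0 < rate m"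
  using \<alpha>_pos by (simp add: rate_def)

text \<open>The threshold errors are of order \<open>1 / sqrt k\<close> after division by \<open>\<alpha>\<close>, and \<open>\<alpha> * m \<le> k\<close>, so they are absorbed
  by the rate of the smaller training sample.\<close>

lemma sqrt_k_div_n_le_rate:
  assumes m: "0 < m" "m \<le> n"
  shows "sqrt (real k) / real n \<le> \<alpha> * rate m"
proof -
  have k0: "0 < real k" using k by simp
  have "sqrt (real k) / real n = \<alpha> * (1 / sqrt (real k))"
    using k0 n_pos by (simp add: \<alpha>_def field_simps)
  also have "\<dots> \<le> \<alpha> * rate m" unfolding rate_def
  proof (intro mult_left_mono frac_le)
    show "sqrt (\<alpha> * real m) \<le> sqrt (real k)"
      unfolding n_\<alpha>[symmetric] using m \<alpha>_pos by (simp add: mult.commute)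
  qed (use \<alpha>_pos m in auto)
  finally show ?thesis .
qed

lemma sqrt_majorant_eq_rate:
  assumes "0 < m"
  shows "sqrt ((real v + 1) * (real m * \<alpha>)) / (real m * \<alpha>) = rate m"
proof -
  define y where "y = sqrt (real m * \<alpha>)"
  have y: "0 < y" "real m * \<alpha> = y * y" using assms \<alpha>_pos by (simp_all add: y_def)
  have "sqrt ((real v + 1) * (real m * \<alpha>)) = sqrt (real v + 1) * y" by (simp add: y_def real_sqrt_mult)
  hence "sqrt ((real v + 1) * (real m * \<alpha>)) / (real m * \<alpha>) = sqrt (real v + 1) * y / (y * y)" by (simp only: y(2))
  also have "\<dots> = sqrt (real v + 1) / y" using y(1) by simp
  finally show ?thesis by (simp only: rate_def y_def mult.commute)
qed

text \<open>The held-out point enters the excess risk only through the threshold. Its indicator is therefore exchanged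
  for the tail indicator, which is independent of the deviation majorant of \<open>T\<close>; where the two indicators
  differ, the excess risk is bounded by \<open>1\<close>. The constant is \<open>76 + 39 + 78 + 156\<close>, for the deviation on \<open>T\<close>, the
  indicator at \<open>i\<close>, the indicators on \<open>T\<close> and the two terms of \<open>expected_loss_le_expected_risk\<close>.\<close>

lemma expected_loss_held_out:
  assumes T: "T \<subseteq> {1..n}" "T \<noteq> {}" and i: "i \<in> {1..n}" "i \<notin> T" and g: "g \<in> G"
  shows "(\<integral>z. above z (z i) * c (\<Psi> T z) (z i) \<partial>Mn) \<le> \<alpha> * (risk g + 349 * rate (card T))"
proof -
  define m where "m = card T"
  have fT: "finite T" using T(1) by (rule finite_subset) simp
  have m: "0 < m" "m \<le> n" using T fT card_mono[of "{1..n}" T] by (auto simp: m_def card_gt_0_iff)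
  have m\<alpha>: "0 < real m * \<alpha>" using m \<alpha>_pos by simp
  have n2: "2 \<le> n"
  proof -
    obtain l where "l \<in> T" using T(2) by auto
    hence "l \<in> {1..n}" "l \<noteq> i" using T(1) i by auto
    thus ?thesis using i(1) by auto
  qed
  let ?I = "\<lambda>z. above z (z i)"
  obtain D where D: "D \<in> borel_measurable Mn"
    "\<forall>z\<in>space Mn. 0 \<le> D z \<and> D z \<le> 2 * real (card T) \<and>
      (\<forall>g\<in>G. \<bar>(\<Sum>i\<in>T. c g (z i) * in_tail (z i)) - real (card T) * (\<alpha> * risk g)\<bar> \<le> D z)"
    "\<forall>z z'. (\<forall>i\<in>T. z i = z' i) \<longrightarrow> D z = D z'"
    "(\<integral>z. D z \<partial>Mn) \<le> 38 * sqrt ((real v + 1) * (real (card T) * \<alpha>))"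
    using tail_deviation_majorant[OF T] by (elim bexE conjE) simp
  have D_int: "integrable Mn D" using D(1,2) by (intro Mn.integrable_in_interval) auto
  define X where "X = (\<lambda>z. in_tail (z i) * D z)"
  define Y where "Y = (\<lambda>z. \<Sum>l\<in>T. ?I z * disc z (z l))"
  have X_int: "integrable Mn X"
  proof (rule Mn.integrable_in_interval[of _ "1 * (2 * real (card T))"])
    show "X \<in> borel_measurable Mn" unfolding X_def using in_tail_coordinate_measurable[OF i(1)] D(1) by simp
    show "0 \<le> X z \<and> X z \<le> 1 * (2 * real (card T))" if "z \<in> space Mn" for z
      unfolding X_def using in_tail_bounds[of "z i"] bspec[OF D(2) that]
      by (intro conjI mult_mono mult_nonneg_nonneg) auto
  qed
  have X_exp: "(\<integral>z. X z \<partial>Mn) \<le> \<alpha> * (38 * sqrt ((real v + 1) * (real m * \<alpha>)))"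
  proof -
    have "(\<integral>z. X z \<partial>Mn) = \<alpha> * (\<integral>z. D z \<partial>Mn)" unfolding X_def
    proof (rule expectation_in_tail_times_independent[OF i(1) D(1)])
      show "\<bar>D z\<bar> \<le> 2 * real (card T)" if "z \<in> space Mn" for z using D(2) that by (auto simp: abs_le_iff)
      show "D (z(i := w)) = D z" for z w
      proof -
        have "\<forall>l\<in>T. (z(i := w)) l = z l" using i(2) by auto
        thus ?thesis using D(3) by blast
      qed
    qed
    thus ?thesis using D(4) \<alpha>_pos by (simp add: m_def)
  qed
  have Yl_int: "integrable Mn (\<lambda>z. ?I z * disc z (z l))" if "l \<in> T" for l
    using that T(1) i(1) above_bounds disc_bounds
    by (intro Mn.integrable_in_interval[of _ 1] borel_measurable_times above_coordinate_measurable disc_coordinate_measurable)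
      (auto intro: mult_le_one)
  have Y_int: "integrable Mn Y" unfolding Y_def using Yl_int by (intro Bochner_Integration.integrable_sum)
  have Y_exp: "(\<integral>z. Y z \<partial>Mn) \<le> real m * (\<alpha> * (78 * sqrt (real k) / real n))"
  proof -
    have "(\<integral>z. Y z \<partial>Mn) = (\<Sum>l\<in>T. (\<integral>z. ?I z * disc z (z l) \<partial>Mn))"
      unfolding Y_def using Yl_int by (intro Bochner_Integration.integral_sum)
    also have "\<dots> \<le> (\<Sum>l\<in>T. \<alpha> * (78 * sqrt (real k) / real n))"
    proof (rule sum_mono)
      fix l assume l: "l \<in> T"
      have "(\<integral>z. ?I z * disc z (z l) \<partial>Mn) \<le> \<alpha> * (39 * sqrt (real k) / (real n - 1))"
        unfolding \<alpha>_def using l T(1) i by (intro expectation_above_disc) auto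
      also have "39 * sqrt (real k) / (real n - 1) \<le> 39 * sqrt (real k) / (real n / 2)"
        using n2 by (intro divide_left_mono) auto
      finally show "(\<integral>z. ?I z * disc z (z l) \<partial>Mn) \<le> \<alpha> * (78 * sqrt (real k) / real n)"
        using \<alpha>_pos by simp
    qed
    finally show ?thesis by (simp add: m_def)
  qed
  \<comment> \<open>The four terms are the competitor, the deviation on \<open>T\<close>, the disagreement of the two indicators at \<open>i\<close>, and
    the disagreement on \<open>T\<close>.\<close>
  define U where "U = (\<lambda>z. risk g * ?I z + 2 / (real m * \<alpha>) * X z + disc z (z i) + 1 / (real m * \<alpha>) * Y z)"
  have risk_le: "?I z * risk (\<Psi> T z) \<le> U z" if z: "z \<in> space Mn" for z
  proof -
    have D0: "0 \<le> D z" using D(2) z by auto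
    have Y0: "0 \<le> Y z" unfolding Y_def using above_bounds disc_bounds by (intro sum_nonneg mult_nonneg_nonneg) auto
    have X0: "0 \<le> X z" unfolding X_def using D0 in_tail_bounds by simp
    have q0: "0 \<le> 2 / (real m * \<alpha>) * X z" "0 \<le> 1 / (real m * \<alpha>) * Y z"
      using m\<alpha> X0 Y0 by (auto intro!: mult_nonneg_nonneg)
    show ?thesis
    proof (cases "thr z < h (z i)")
      case False
      hence "?I z = 0" by (simp add: above_def)
      thus ?thesis using q0 disc_bounds(1)[of z "z i"] by (simp add: U_def)
    next
      case True
      hence I1: "?I z = 1" by (simp add: above_def)
      show ?thesis
      proof (cases "t \<le> h (z i)")
        case True
        have "real m * \<alpha> * (risk (\<Psi> T z) - risk g) \<le> 2 * D z + (\<Sum>l\<in>T. disc z (z l))"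
          unfolding m_def using D(2) z by (intro excess_risk_le[OF T(1) z g]) auto
        also have "\<dots> = 2 * X z + Y z" using True I1 by (simp add: X_def Y_def in_tail_def)
        finally have "risk (\<Psi> T z) - risk g \<le> (2 * X z + Y z) / (real m * \<alpha>)"
          using m\<alpha> by (simp add: pos_le_divide_eq mult.commute)
        hence "risk (\<Psi> T z) \<le> risk g + (2 / (real m * \<alpha>) * X z + 1 / (real m * \<alpha>) * Y z)"
          by (simp add: add_divide_distrib)
        thus ?thesis using I1 disc_bounds(1)[of z "z i"] by (simp add: U_def)
      next
        case False
        hence "disc z (z i) = 1" using True by (simp add: disc_def above_def in_tail_def)
        thus ?thesis using I1 q0 risk_bounds(2)[OF \<Psi>_in[OF T(1) z]] risk_bounds(1)[OF g] by (simp add: U_def)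
      qed
    qed
  qed
  note risk_int = risk_above_integrable[OF T(1) i(1)]
  have I_int: "integrable Mn ?I" by (rule above_coordinate_integrable[OF i(1)])
  have dd_int: "integrable Mn (\<lambda>z. disc z (z i))" by (rule disc_coordinate_integrable[OF i(1)])
  have "(\<integral>z. ?I z * risk (\<Psi> T z) \<partial>Mn) \<le> (\<integral>z. U z \<partial>Mn)"
    using risk_int risk_le I_int X_int dd_int Y_int unfolding U_def
    by (intro integral_mono Bochner_Integration.integrable_add integrable_mult_right) auto
  also have "\<dots> = risk g * (\<integral>z. ?I z \<partial>Mn) + 2 / (real m * \<alpha>) * (\<integral>z. X z \<partial>Mn) + (\<integral>z. disc z (z i) \<partial>Mn)
      + 1 / (real m * \<alpha>) * (\<integral>z. Y z \<partial>Mn)"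
    unfolding U_def using I_int X_int dd_int Y_int by simp
  also have "\<dots> \<le> risk g * \<alpha> + 2 / (real m * \<alpha>) * (\<alpha> * (38 * sqrt ((real v + 1) * (real m * \<alpha>)))) + 39 * sqrt (real k) / real n
      + 1 / (real m * \<alpha>) * (real m * (\<alpha> * (78 * sqrt (real k) / real n)))"
    using expectation_above[OF i(1)] expectation_disc[OF i(1)] X_exp Y_exp risk_bounds(1)[OF g] m\<alpha>
    by (intro add_mono mult_left_mono) (auto simp: \<alpha>_def)
  also have "2 / (real m * \<alpha>) * (\<alpha> * (38 * sqrt ((real v + 1) * (real m * \<alpha>)))) = 76 * (\<alpha> * rate m)"
    unfolding sqrt_majorant_eq_rate[OF m(1), symmetric] by simp
  also have "1 / (real m * \<alpha>) * (real m * (\<alpha> * (78 * sqrt (real k) / real n))) = 78 * (sqrt (real k) / real n)"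
    using m(1) \<alpha>_pos by simp
  finally have step: "(\<integral>z. ?I z * risk (\<Psi> T z) \<partial>Mn) \<le> risk g * \<alpha> + 76 * (\<alpha> * rate m) + 117 * (sqrt (real k) / real n)"
    by simp
  have "\<alpha> * (\<integral>z. ?I z * c (\<Psi> T z) (z i) \<partial>Mn) \<le>
      \<alpha> * (\<integral>z. ?I z * risk (\<Psi> T z) \<partial>Mn) + 2 * (\<integral>z. ?I z * mean_disc z \<partial>Mn)"
    by (rule expected_loss_le_expected_risk[OF T(1) i])
  also have "\<dots> \<le> \<alpha> * (risk g * \<alpha> + 76 * (\<alpha> * rate m) + 117 * (sqrt (real k) / real n)) + 2 * (\<alpha> * (78 * sqrt (real k) / real n))"
    using step expectation_above_mean_disc[OF i(1)] \<alpha>_pos by (intro add_mono mult_left_mono) (auto simp: \<alpha>_def)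
  also have "\<dots> = \<alpha> * (risk g * \<alpha> + 76 * (\<alpha> * rate m) + 273 * (sqrt (real k) / real n))"
    by (simp add: algebra_simps)
  finally have "(\<integral>z. ?I z * c (\<Psi> T z) (z i) \<partial>Mn) \<le> risk g * \<alpha> + 76 * (\<alpha> * rate m) + 273 * (sqrt (real k) / real n)"
    using \<alpha>_pos by (simp only: mult_le_cancel_left_pos)
  also have "\<dots> \<le> risk g * \<alpha> + 76 * (\<alpha> * rate m) + 273 * (\<alpha> * rate m)"
    using sqrt_k_div_n_le_rate[OF m] by linarith
  also have "\<dots> = \<alpha> * (risk g + 349 * rate m)" by (simp add: algebra_simps)
  finally show ?thesis by (simp add: m_def)
qed

definition cv :: "nat \<Rightarrow> (nat \<Rightarrow> nat set) \<Rightarrow> (nat \<Rightarrow> 'a) \<Rightarrow> real" where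
  "cv K V z = 1 / real K * (\<Sum>j=1..K. 1 / (\<alpha> * real (card (V j))) *
     (\<Sum>i\<in>V j. above z (z i) * c (\<Psi> ({1..n} - V j) z) (z i)))"

context
  fixes K V nV
  assumes K: "1 \<le> K" and nV: "1 \<le> nV" "nV < n"
    and V: "\<And>j. j \<in> {1..K} \<Longrightarrow> V j \<subseteq> {1..n}" "\<And>j. j \<in> {1..K} \<Longrightarrow> card (V j) = nV"
    and balanced: "\<And>l. l \<in> {1..n} \<Longrightarrow> 1 / real K * (\<Sum>j=1..K. of_bool (l \<in> V j)) = real nV / real n"
begin

lemma fold_complement:
  assumes j: "j \<in> {1..K}"
  shows "{1..n} - V j \<subseteq> {1..n}" "{1..n} - V j \<noteq> {}" "card ({1..n} - V j) = n - nV"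
proof -
  have "finite (V j)" using V(1)[OF j] by (rule finite_subset) simp
  thus "card ({1..n} - V j) = n - nV" using V[OF j] by (simp add: card_Diff_subset)
  hence "card ({1..n} - V j) \<noteq> 0" using nV by simp
  thus "{1..n} - V j \<noteq> {}" by force
qed auto

lemma fold_loss_integrable:
  assumes "j \<in> {1..K}" "i \<in> V j"
  shows "integrable Mn (\<lambda>z. above z (z i) * c (\<Psi> ({1..n} - V j) z) (z i))"
  using loss_integrable[OF fold_complement(1)[OF assms(1)]] V(1)[OF assms(1)] assms(2) by auto

lemma cv_integrable: "integrable Mn (cv K V)"
  unfolding cv_def[abs_def] using fold_loss_integrable
  by (intro integrable_mult_right Bochner_Integration.integrable_sum) auto

lemma expectation_cv:
  assumes g: "g \<in> G"
  shows "(\<integral>z. cv K V z \<partial>Mn) \<le> risk g + 349 * rate (n - nV)"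
proof -
  let ?R = "risk g + 349 * rate (n - nV)"
  have "(\<integral>z. cv K V z \<partial>Mn) = 1 / real K * (\<Sum>j=1..K. 1 / (\<alpha> * real (card (V j))) *
     (\<Sum>i\<in>V j. (\<integral>z. above z (z i) * c (\<Psi> ({1..n} - V j) z) (z i) \<partial>Mn)))"
    unfolding cv_def using fold_loss_integrable by (simp add: Bochner_Integration.integral_sum)
  also have "\<dots> \<le> 1 / real K * (\<Sum>j=1..K. 1 / (\<alpha> * real (card (V j))) * (\<Sum>i\<in>V j. \<alpha> * ?R))"
  proof (intro mult_left_mono sum_mono)
    fix j i assume j: "j \<in> {1..K}" and i: "i \<in> V j"
    show "(\<integral>z. above z (z i) * c (\<Psi> ({1..n} - V j) z) (z i) \<partial>Mn) \<le> \<alpha> * ?R"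
      using expected_loss_held_out[OF fold_complement(1,2)[OF j], of i g] V(1)[OF j] i g
      by (auto simp: fold_complement(3)[OF j])
  qed (use \<alpha>_pos in auto)
  also have "\<dots> = 1 / real K * (\<Sum>j=1..K. ?R)"
    using \<alpha>_pos nV V(2) by (intro arg_cong2[where f = "(*)"] sum.cong) auto
  also have "\<dots> = ?R" using K by simp
  finally show ?thesis .
qed

text \<open>On the validation set the full-sample rule does at least as well as the fold rule: it does so on the whole
  sample, and the converse holds on the training set. Balancedness of the folds turns the average over
  validation sets into the full sample.\<close>

lemma cv_ge_training_risk:
  assumes z: "z \<in> space Mn"
  shows "1 / (\<alpha> * real n) * (\<Sum>i=1..n. above z (z i) * c (\<Psi> {1..n} z) (z i)) \<le> cv K V z"
proof -
  define w where "w = (\<lambda>g i. above z (z i) * c g (z i))"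
  let ?g = "\<Psi> {1..n} z"
  have fold: "(\<Sum>i\<in>V j. w ?g i) \<le> (\<Sum>i\<in>V j. w (\<Psi> ({1..n} - V j) z) i)" if j: "j \<in> {1..K}" for j
  proof -
    let ?T = "{1..n} - V j"
    have split: "(\<Sum>i=1..n. f i) = (\<Sum>i\<in>?T. f i) + (\<Sum>i\<in>V j. f i)" for f :: "nat \<Rightarrow> real"
      using V(1)[OF j] by (intro sum.subset_diff) auto
    have "(\<Sum>i=1..n. w ?g i) \<le> (\<Sum>i=1..n. w (\<Psi> ?T z) i)"
      unfolding w_def by (rule \<Psi>_minimal[OF order_refl z \<Psi>_in[OF fold_complement(1)[OF j] z]])
    moreover have "(\<Sum>i\<in>?T. w (\<Psi> ?T z) i) \<le> (\<Sum>i\<in>?T. w ?g i)"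
      unfolding w_def by (rule \<Psi>_minimal[OF fold_complement(1)[OF j] z \<Psi>_in[OF order_refl z]])
    ultimately show ?thesis using split[of "w ?g"] split[of "w (\<Psi> ?T z)"] by linarith
  qed
  have "1 / (\<alpha> * real n) * (\<Sum>i=1..n. w ?g i) = 1 / (\<alpha> * real nV) * (\<Sum>i=1..n. w ?g i * (real nV / real n))"
    using nV \<alpha>_pos by (simp only: sum_distrib_right[symmetric]) simp
  also have "(\<Sum>i=1..n. w ?g i * (real nV / real n)) = (\<Sum>i=1..n. w ?g i * (1 / real K * (\<Sum>j=1..K. of_bool (i \<in> V j))))"
    using balanced by (intro sum.cong) auto
  also have "\<dots> = 1 / real K * (\<Sum>i=1..n. \<Sum>j=1..K. w ?g i * of_bool (i \<in> V j))"
    unfolding sum_distrib_left by (intro sum.cong refl mult.left_commute)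
  also have "(\<Sum>i=1..n. \<Sum>j=1..K. w ?g i * of_bool (i \<in> V j)) = (\<Sum>j=1..K. \<Sum>i=1..n. w ?g i * of_bool (i \<in> V j))"
    by (rule sum.swap)
  also have "\<dots> = (\<Sum>j=1..K. \<Sum>i\<in>V j. w ?g i)"
    using V(1) by (intro sum.cong refl sum_restrict_of_bool[symmetric]) auto
  also have "1 / (\<alpha> * real nV) * (1 / real K * (\<Sum>j=1..K. \<Sum>i\<in>V j. w ?g i)) \<le>
      1 / (\<alpha> * real nV) * (1 / real K * (\<Sum>j=1..K. \<Sum>i\<in>V j. w (\<Psi> ({1..n} - V j) z) i))"
  proof -
    have "(\<Sum>j=1..K. \<Sum>i\<in>V j. w ?g i) \<le> (\<Sum>j=1..K. \<Sum>i\<in>V j. w (\<Psi> ({1..n} - V j) z) i)"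
      by (rule sum_mono) (rule fold)
    thus ?thesis using \<alpha>_pos by (intro mult_left_mono) auto
  qed
  also have "\<dots> = 1 / real K * (1 / (\<alpha> * real nV) * (\<Sum>j=1..K. \<Sum>i\<in>V j. w (\<Psi> ({1..n} - V j) z) i))"
    by (rule mult.left_commute)
  also have "\<dots> = 1 / real K * (\<Sum>j=1..K. 1 / (\<alpha> * real nV) * (\<Sum>i\<in>V j. w (\<Psi> ({1..n} - V j) z) i))"
    by (simp only: sum_distrib_left)
  also have "\<dots> = cv K V z"
  proof -
    have "(\<Sum>j=1..K. 1 / (\<alpha> * real nV) * (\<Sum>i\<in>V j. w (\<Psi> ({1..n} - V j) z) i)) =
        (\<Sum>j=1..K. 1 / (\<alpha> * real (card (V j))) * (\<Sum>i\<in>V j. w (\<Psi> ({1..n} - V j) z) i))"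
    proof (rule sum.cong[OF refl])
      fix j assume "j \<in> {1..K}"
      hence "card (V j) = nV" by (rule V(2))
      thus "1 / (\<alpha> * real nV) * (\<Sum>i\<in>V j. w (\<Psi> ({1..n} - V j) z) i) =
        1 / (\<alpha> * real (card (V j))) * (\<Sum>i\<in>V j. w (\<Psi> ({1..n} - V j) z) i)" by (simp only:)
    qed
    thus ?thesis by (simp only: cv_def w_def)
  qed
  finally show ?thesis by (simp add: w_def)
qed

lemma cv_error_ge:
  assumes z: "z \<in> space Mn"
    and dev: "\<bar>(\<Sum>i=1..n. c (\<Psi> {1..n} z) (z i) * in_tail (z i)) - real n * (\<alpha> * risk (\<Psi> {1..n} z))\<bar> \<le> d"
  shows "risk (\<Psi> {1..n} z) - (d + total_disc z) / (\<alpha> * real n) \<le> cv K V z"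
proof -
  let ?g = "\<Psi> {1..n} z"
  have g: "?g \<in> G" by (rule \<Psi>_in[OF order_refl z])
  have \<alpha>n: "0 < \<alpha> * real n" using \<alpha>_pos n_pos by simp
  have "(\<Sum>i=1..n. c ?g (z i) * in_tail (z i)) \<le> (\<Sum>i=1..n. above z (z i) * c ?g (z i) + disc z (z i))"
  proof (rule sum_mono)
    fix i assume "i \<in> {1..n}"
    thus "c ?g (z i) * in_tail (z i) \<le> above z (z i) * c ?g (z i) + disc z (z i)"
      using c_bounds[OF g coordinate_in_space[OF z]] by (auto simp: disc_def above_def in_tail_def)
  qed
  hence "real n * (\<alpha> * risk ?g) - d - total_disc z \<le> (\<Sum>i=1..n. above z (z i) * c ?g (z i))"
    using dev by (simp add: sum.distrib total_disc_def abs_le_iff)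
  hence "(real n * (\<alpha> * risk ?g) - d - total_disc z) / (\<alpha> * real n) \<le> (\<Sum>i=1..n. above z (z i) * c ?g (z i)) / (\<alpha> * real n)"
    using \<alpha>n by (intro divide_right_mono) auto
  also have "\<dots> \<le> cv K V z" using cv_ge_training_risk[OF z] by simp
  also have "(real n * (\<alpha> * risk ?g) - d - total_disc z) / (\<alpha> * real n) = risk ?g - (d + total_disc z) / (\<alpha> * real n)"
  proof -
    have "real n * (\<alpha> * risk ?g) - d - total_disc z = (\<alpha> * real n) * risk ?g - (d + total_disc z)" by simp
    moreover have "(x * y - u) / x = y - u / x" if "0 < x" for x y u :: real
      using that by (simp add: field_simps)
    ultimately show ?thesis using \<alpha>n by (simp only:)
  qed
  finally show ?thesis .
qed

text \<open>From \<open>\<bar>w\<bar> \<le> w + 2 * l\<close> whenever \<open>- l \<le> w\<close> and \<open>0 \<le> l\<close>: the mean of the error is bounded above by comparison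
  with a nearly optimal \<open>g\<close>, and the error itself is bounded below by the uniform deviation on the full sample.\<close>

lemma expectation_cv_error:
  "integrable Mn (\<lambda>z. \<bar>cv K V z - risk (\<Psi> {1..n} z)\<bar>)"
  "(\<integral>z. \<bar>cv K V z - risk (\<Psi> {1..n} z)\<bar> \<partial>Mn) \<le> 504 * rate (n - nV)"
proof -
  define r where "r = rate (n - nV)"
  have r: "0 < r" unfolding r_def using nV by (intro rate_pos) simp
  have \<alpha>n: "0 < \<alpha> * real n" using \<alpha>_pos n_pos by simp
  define R where "R = (\<lambda>z. risk (\<Psi> {1..n} z))"
  have R_bounds: "0 \<le> R z" "R z \<le> 1" if "z \<in> space Mn" for z
    using risk_bounds[OF \<Psi>_in[OF order_refl that]] by (simp_all add: R_def)
  have R_int: "integrable Mn R"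
    using risk_measurable[OF order_refl] R_bounds by (intro Mn.integrable_in_interval) (auto simp: R_def[abs_def])
  have W_int: "integrable Mn (\<lambda>z. cv K V z - R z)" using cv_integrable R_int by simp
  thus "integrable Mn (\<lambda>z. \<bar>cv K V z - risk (\<Psi> {1..n} z)\<bar>)" by (simp add: R_def)
  have G: "G \<noteq> {}"
  proof -
    obtain z where "z \<in> space Mn" using Mn.not_empty by blast
    thus ?thesis using \<Psi>_in[of "{}" z] by auto
  qed
  have bdd: "bdd_below (risk ` G)" using risk_bounds(1) by (intro bdd_belowI2[of _ 0])
  have "\<exists>g\<in>G. risk g < (INF g\<in>G. risk g) + r"
    using cInf_lessD[of "risk ` G" "(INF g\<in>G. risk g) + r"] G r by auto
  then obtain g where g: "g \<in> G" "risk g < (INF g\<in>G. risk g) + r" by auto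
  have "(\<integral>z. risk g - r \<partial>Mn) \<le> (\<integral>z. R z \<partial>Mn)"
  proof (rule integral_mono[OF Mn.integrable_const R_int])
    fix z assume z: "z \<in> space Mn"
    have "(INF g\<in>G. risk g) \<le> R z" unfolding R_def by (rule cINF_lower[OF bdd \<Psi>_in[OF order_refl z]])
    thus "risk g - r \<le> R z" using g(2) by linarith
  qed
  hence "risk g - r \<le> (\<integral>z. R z \<partial>Mn)" by (simp add: Mn.prob_space)
  hence W_exp: "(\<integral>z. cv K V z - R z \<partial>Mn) \<le> 350 * r"
    using expectation_cv[OF g(1)] cv_integrable R_int by (simp add: r_def)
  have n_ne: "{1..n} \<noteq> {}" using n_pos by simp
  obtain D where D: "D \<in> borel_measurable Mn"
    "\<forall>z\<in>space Mn. 0 \<le> D z \<and> D z \<le> 2 * real (card {1..n}) \<and>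
      (\<forall>g\<in>G. \<bar>(\<Sum>i=1..n. c g (z i) * in_tail (z i)) - real (card {1..n}) * (\<alpha> * risk g)\<bar> \<le> D z)"
    "(\<integral>z. D z \<partial>Mn) \<le> 38 * sqrt ((real v + 1) * (real (card {1..n}) * \<alpha>))"
    using tail_deviation_majorant[OF order_refl n_ne] by (elim bexE conjE) simp
  have D_int: "integrable Mn D" using D(1,2) by (intro Mn.integrable_in_interval) auto
  define L where "L = (\<lambda>z. (D z + total_disc z) / (\<alpha> * real n))"
  have L_int: "integrable Mn L" unfolding L_def using D_int total_disc_integrable by simp
  have L0: "0 \<le> L z" if "z \<in> space Mn" for z
    unfolding L_def using D(2) that total_disc_bounds(1)[of z] \<alpha>n by (intro divide_nonneg_nonneg add_nonneg_nonneg) auto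
  have L_exp: "(\<integral>z. L z \<partial>Mn) \<le> 77 * r"
  proof -
    have "(\<integral>z. L z \<partial>Mn) = ((\<integral>z. D z \<partial>Mn) + (\<integral>z. total_disc z \<partial>Mn)) / (\<alpha> * real n)"
      unfolding L_def using D_int total_disc_integrable by simp
    also have "\<dots> \<le> (38 * sqrt ((real v + 1) * (real n * \<alpha>)) + 39 * sqrt (real k)) / (\<alpha> * real n)"
      using D(3) expectation_total_disc \<alpha>n by (intro divide_right_mono add_mono) auto
    also have "\<dots> = 38 * (sqrt ((real v + 1) * (real n * \<alpha>)) / (real n * \<alpha>)) + 39 * (sqrt (real k) / real n) / \<alpha>"
      by (simp add: add_divide_distrib mult.commute)
    also have "\<dots> \<le> 38 * r + 39 * (\<alpha> * r) / \<alpha>"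
    proof (intro add_mono mult_left_mono divide_right_mono)
      show "sqrt ((real v + 1) * (real n * \<alpha>)) / (real n * \<alpha>) \<le> r"
        unfolding sqrt_majorant_eq_rate[OF n_pos] r_def rate_def using nV \<alpha>_pos n_pos
        by (intro divide_left_mono real_sqrt_le_mono mult_left_mono mult_pos_pos) auto
      show "sqrt (real k) / real n \<le> \<alpha> * r"
        unfolding r_def using nV by (intro sqrt_k_div_n_le_rate) auto
    qed (use \<alpha>_pos in auto)
    also have "\<dots> = 77 * r" using \<alpha>_pos by simp
    finally show ?thesis .
  qed
  have "(\<integral>z. \<bar>cv K V z - R z\<bar> \<partial>Mn) \<le> (\<integral>z. (cv K V z - R z) + 2 * L z \<partial>Mn)"
  proof (rule integral_mono)
    show "integrable Mn (\<lambda>z. \<bar>cv K V z - R z\<bar>)" using W_int by simp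
    show "integrable Mn (\<lambda>z. (cv K V z - R z) + 2 * L z)" using W_int L_int by simp
    fix z assume z: "z \<in> space Mn"
    have "R z - L z \<le> cv K V z"
      unfolding R_def L_def using D(2) z \<Psi>_in[OF order_refl z] by (intro cv_error_ge) auto
    thus "\<bar>cv K V z - R z\<bar> \<le> (cv K V z - R z) + 2 * L z" using L0[OF z] by linarith
  qed
  also have "\<dots> = (\<integral>z. cv K V z - R z \<partial>Mn) + 2 * (\<integral>z. L z \<partial>Mn)"
    using W_int L_int by (subst Bochner_Integration.integral_add) auto
  also have "\<dots> \<le> 504 * r" using W_exp L_exp by linarith
  finally show "(\<integral>z. \<bar>cv K V z - risk (\<Psi> {1..n} z)\<bar> \<partial>Mn) \<le> 504 * rate (n - nV)"
    by (simp add: R_def r_def)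
qed

lemma cv_error_probability:
  assumes \<delta>: "0 < \<delta>" and b: "504 * rate (n - nV) \<le> \<delta> * b"
  shows "1 - \<delta> \<le> Mn.prob {z \<in> space Mn. \<bar>cv K V z - risk (\<Psi> {1..n} z)\<bar> \<le> b}"
proof -
  define W where "W = (\<lambda>z. \<bar>cv K V z - risk (\<Psi> {1..n} z)\<bar>)"
  have W_int: "integrable Mn W" using expectation_cv_error(1) by (simp add: W_def)
  have W_meas [measurable]: "W \<in> borel_measurable Mn" using W_int by (rule borel_measurable_integrable)
  have "0 < 504 * rate (n - nV)" using rate_pos[of "n - nV"] nV by simp
  hence b0: "0 < b" using b \<delta> by (metis less_le_trans zero_less_mult_pos)
  have "Mn.prob {z \<in> space Mn. b < W z} \<le> Mn.prob {z \<in> space Mn. b \<le> W z}"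
    by (intro Mn.finite_measure_mono) auto
  also have "\<dots> \<le> (\<integral>z. W z \<partial>Mn) / b"
    using W_int b0 by (intro integral_Markov_inequality_measure[where A = "space Mn"]) (auto simp: W_def)
  also have "\<dots> \<le> (\<delta> * b) / b"
    using expectation_cv_error(2) b b0 by (intro divide_right_mono) (auto simp: W_def)
  also have "\<dots> = \<delta>" using b0 by simp
  finally have "Mn.prob {z \<in> space Mn. b < W z} \<le> \<delta>" .
  moreover have "Mn.prob {z \<in> space Mn. b < W z} = 1 - Mn.prob {z \<in> space Mn. W z \<le> b}"
  proof -
    have "{z \<in> space Mn. b < W z} = space Mn - {z \<in> space Mn. W z \<le> b}" by auto
    moreover have "{z \<in> space Mn. W z \<le> b} \<in> sets Mn" by measurable
    ultimately show ?thesis by (simp only: Mn.prob_compl)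
  qed
  ultimately show ?thesis by (simp add: W_def)
qed

end

end

section \<open>Norms are Borel measurable\<close>

lemma norm_on_points_sum_le:
  assumes N: "norm_on_points d N"
  shows "N (\<lambda>i\<in>{..<d}. s i) \<le> (\<Sum>i<d. \<bar>s i\<bar> * N (\<lambda>j\<in>{..<d}. of_bool (j = i)))"
proof -
  have space: "(\<lambda>i\<in>{..<d}. f i) \<in> space (point_space d)" for f by (simp add: point_space_def space_PiM)
  have tri: "N (\<lambda>i\<in>{..<d}. x i + y i) \<le> N x + N y"
    if "x \<in> space (point_space d)" "y \<in> space (point_space d)" for x y
    using N that unfolding norm_on_points_def by blast
  have hom: "N (\<lambda>i\<in>{..<d}. a * x i) = \<bar>a\<bar> * N x" if "x \<in> space (point_space d)" for x a
    using N that unfolding norm_on_points_def by blast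
  have zero: "N (\<lambda>i\<in>{..<d}. 0) = 0"
    using N space[of "\<lambda>_. 0"] unfolding norm_on_points_def by blast
  have "N (\<lambda>i\<in>{..<d}. if i < m then s i else 0) \<le> (\<Sum>i<m. \<bar>s i\<bar> * N (\<lambda>j\<in>{..<d}. of_bool (j = i)))" for m
  proof (induction m)
    case 0
    show ?case using zero by (simp only: not_less0 if_False lessThan_0 sum.empty order_refl)
  next
    case (Suc m)
    let ?x = "\<lambda>i\<in>{..<d}. if i < m then s i else 0" and ?e = "\<lambda>j\<in>{..<d}. of_bool (j = m) :: real"
    define u where "u = (\<lambda>i\<in>{..<d}. s m * ?e i)"
    have mem: "?x \<in> space (point_space d)" "?e \<in> space (point_space d)" "u \<in> space (point_space d)"
      unfolding u_def by (rule space)+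
    have split: "(\<lambda>i\<in>{..<d}. if i < Suc m then s i else 0) = (\<lambda>i\<in>{..<d}. ?x i + u i)"
      by (auto simp: u_def fun_eq_iff restrict_def less_Suc_eq)
    have "N u = \<bar>s m\<bar> * N ?e" unfolding u_def by (rule hom[OF mem(2)])
    moreover have "N (\<lambda>i\<in>{..<d}. ?x i + u i) \<le> N ?x + N u" by (rule tri[OF mem(1,3)])
    ultimately show ?case using Suc.IH unfolding split sum.lessThan_Suc by linarith
  qed
  from this[of d] show ?thesis by (simp cong: restrict_cong)
qed

text \<open>The triangle inequality makes \<open>N\<close> Lipschitz with respect to finitely many coordinates, hence continuous for
  the product topology, whose Borel sets are those of the product \<open>\<sigma>\<close>-algebra.\<close>

lemma norm_on_points_measurable:
  assumes N: "norm_on_points d N"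
  shows "N \<in> borel_measurable (point_space d)"
proof -
  define C where "C = (\<lambda>i. N (\<lambda>j\<in>{..<d}. of_bool (j = i)))"
  define N' where "N' = (\<lambda>x :: nat \<Rightarrow> real. N (\<lambda>i\<in>{..<d}. x i))"
  have space: "(\<lambda>i\<in>{..<d}. f i) \<in> space (point_space d)" for f by (simp add: point_space_def space_PiM)
  have lip1: "N' x - N' y \<le> (\<Sum>i<d. \<bar>x i - y i\<bar> * C i)" for x y
  proof -
    have "(\<lambda>i\<in>{..<d}. x i) = (\<lambda>i\<in>{..<d}. (\<lambda>i\<in>{..<d}. y i) i + (\<lambda>i\<in>{..<d}. x i - y i) i)"
      by (auto simp: fun_eq_iff)
    hence "N' x \<le> N' y + N (\<lambda>i\<in>{..<d}. x i - y i)"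
      using N space[of y] space[of "\<lambda>i. x i - y i"] unfolding norm_on_points_def N'_def by metis
    also have "N (\<lambda>i\<in>{..<d}. x i - y i) \<le> (\<Sum>i<d. \<bar>x i - y i\<bar> * C i)"
      unfolding C_def by (rule norm_on_points_sum_le[OF N])
    finally show ?thesis by simp
  qed
  have lip: "norm (N' y - N' x) \<le> (\<Sum>i<d. \<bar>y i - x i\<bar> * C i)" for x y
    using lip1[of x y] lip1[of y x] by (simp add: abs_minus_commute abs_le_iff)
  have "isCont N' x" for x
  proof -
    have coord: "((\<lambda>y. y i) \<longlongrightarrow> x i) (at x)" for i
      using continuous_on_product_coordinates[of i] unfolding continuous_on_def by blast
    have "((\<lambda>y. \<Sum>i<d. \<bar>y i - x i\<bar> * C i) \<longlongrightarrow> (\<Sum>i<d. \<bar>x i - x i\<bar> * C i)) (at x)"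
      by (intro tendsto_intros coord)
    hence lim0: "((\<lambda>y. \<Sum>i<d. \<bar>y i - x i\<bar> * C i) \<longlongrightarrow> 0) (at x)" by simp
    have "((\<lambda>y. N' y - N' x) \<longlongrightarrow> 0) (at x)"
      by (rule Lim_null_comparison[OF always_eventually lim0]) (use lip in blast)
    thus ?thesis unfolding isCont_def by (rule LIM_zero_cancel)
  qed
  hence "continuous_on UNIV N'" by (intro continuous_at_imp_continuous_on) auto
  hence N'_meas: "N' \<in> borel_measurable borel" by (rule borel_measurable_continuous_onI)
  define ext where "ext = (\<lambda>(x :: nat \<Rightarrow> real) i. if i < d then x i else 0)"
  have "ext \<in> point_space d \<rightarrow>\<^sub>M borel"
  proof (rule measurable_coordinatewise_then_product)
    fix i
    show "(\<lambda>x. ext x i) \<in> borel_measurable (point_space d)"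
      unfolding ext_def point_space_def by (cases "i < d") auto
  qed
  from measurable_compose[OF this N'_meas] have "(\<lambda>x. N' (ext x)) \<in> borel_measurable (point_space d)" .
  moreover have "N' (ext x) = N x" if "x \<in> space (point_space d)" for x
  proof -
    have "(\<lambda>i\<in>{..<d}. ext x i) = x"
      using that by (auto simp: ext_def point_space_def space_PiM PiE_def extensional_def fun_eq_iff)
    thus ?thesis by (simp add: N'_def)
  qed
  ultimately show ?thesis by (simp cong: measurable_cong)
qed

section \<open>The error bound\<close>

text \<open>Both universal constants are taken to be \<open>504\<close>, the constant of \<open>expectation_cv_error\<close>, and
  \<open>sqrt (v + 1) \<le> sqrt v + 1\<close> splits the rate into the part with the VC dimension and a constant part.\<close>

lemma error_bound_ge_rate:
  fixes a \<delta> :: real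
  assumes a: "0 < a" and \<delta>: "0 < \<delta>" "\<delta> < 1"
  shows "504 * (sqrt (real v + 1) / sqrt a) \<le> \<delta> * ((9 * 504 * sqrt (real v) / sqrt a + 9 / a)
    + 1 / (\<delta> * sqrt a) * (5 * 504 * sqrt (real v) + 504))"
proof -
  have "504 * (sqrt (real v + 1) / sqrt a) \<le> 1 / sqrt a * (5 * 504 * sqrt (real v) + 504)"
  proof -
    have "sqrt (real v + 1) \<le> sqrt (real v) + sqrt 1" by (rule sqrt_add_le_add_sqrt) auto
    hence "sqrt (real v + 1) \<le> sqrt (real v) + 1" by (simp only: real_sqrt_one)
    moreover have "0 \<le> sqrt (real v)" by simp
    ultimately have "504 * sqrt (real v + 1) \<le> 5 * 504 * sqrt (real v) + 504" by linarith
    hence "504 * sqrt (real v + 1) / sqrt a \<le> (5 * 504 * sqrt (real v) + 504) / sqrt a"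
      using a by (intro divide_right_mono) auto
    thus ?thesis by simp
  qed
  also have "\<dots> = \<delta> * (1 / (\<delta> * sqrt a) * (5 * 504 * sqrt (real v) + 504))"
    using \<delta> by simp
  also have "\<dots> \<le> \<delta> * ((9 * 504 * sqrt (real v) / sqrt a + 9 / a)
    + 1 / (\<delta> * sqrt a) * (5 * 504 * sqrt (real v) + 504))"
    using a \<delta> by (intro mult_left_mono) auto
  finally show ?thesis .
qed

theorem theorem4p1:
  shows "\<exists>M > (0::real). \<exists>M5 > (0::real).
    \<forall>(d::nat) (X :: point set) (N :: point \<Rightarrow> real) (P :: obs measure)
      (n::nat) (k::nat) (\<alpha>::real) (t::real)
      (G :: (point \<Rightarrow> real) set) (c :: (point \<Rightarrow> real) \<Rightarrow> obs \<Rightarrow> real) (\<Psi> :: learning_rule)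
      (K::nat) (V :: nat \<Rightarrow> nat set) (n\<^sub>V::nat) (n\<^sub>T::nat) (v::nat) (\<delta>::real).
      X \<subseteq> space (point_space d) \<and> norm_on_points d N \<and>
      prob_space P \<and> sets P = sets (obs_space d X) \<and>
      1 \<le> k \<and> k \<le> n \<and> \<alpha> = real k / real n \<and>
      tail_quantile P N \<alpha> t \<and> no_tail_atoms P N t \<and>
      (\<forall>g\<in>G. \<forall>g'\<in>G. \<forall>x\<in>X. \<forall>y\<in>{-1, 1}. g x = g' x \<longrightarrow> c g (x, y) = c g' (x, y)) \<and>
      P_measurable_class P (c ` G) \<and>
      trained_on_subsample P N n \<alpha> \<Psi> \<and> measurable_rule P n c \<Psi> \<and>
      cond_erm P N n \<alpha> G c \<Psi> \<and>
      1 \<le> K \<and> 1 \<le> n\<^sub>V \<and> n\<^sub>V < n \<and> n\<^sub>T = n - n\<^sub>V \<and>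
      (\<forall>j\<in>{1..K}. V j \<subseteq> {1..n} \<and> card (V j) = n\<^sub>V) \<and>
      (\<forall>l\<in>{1..n}. 1 / real K * (\<Sum>j=1..K. of_bool (l \<in> V j)) = real n\<^sub>V / real n) \<and>
      vc_dim (subgraphs (X \<times> {-1, 1}) (c ` G)) = enat v \<and>
      (\<forall>g\<in>G. \<forall>z \<in> X \<times> {-1, 1}. 0 \<le> c g z \<and> c g z \<le> 1) \<and>
      0 < \<delta> \<and> \<delta> < 1
      \<longrightarrow>
      \<P>(z in sample_law P n.
          \<bar>cv_risk N n \<alpha> c \<Psi> K V z - cond_risk P N t c (\<Psi> {1..n} z)\<bar>
            \<le> (9 * M * sqrt (real v) / sqrt (\<alpha> * real n\<^sub>T) + 9 / (real n\<^sub>T * \<alpha>))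
              + 1 / (\<delta> * sqrt (real n\<^sub>T * \<alpha>)) * (5 * M * sqrt (real v) + M5))
        \<ge> 1 - 17 * \<delta>"
proof (rule exI[of _ 504], rule conjI, simp, rule exI[of _ 504], rule conjI, simp, intro allI impI, elim conjE)
  fix d :: nat and X :: "point set" and N :: "point \<Rightarrow> real" and P :: "obs measure"
    and n k :: nat and \<alpha> t :: real and G :: "(point \<Rightarrow> real) set" and c :: "(point \<Rightarrow> real) \<Rightarrow> obs \<Rightarrow> real"
    and \<Psi> :: learning_rule and K :: nat and V :: "nat \<Rightarrow> nat set" and n\<^sub>V n\<^sub>T v :: nat and \<delta> :: real
  assume X: "X \<subseteq> space (point_space d)" and N: "norm_on_points d N"
    and P: "prob_space P" "sets P = sets (obs_space d X)"
    and k: "1 \<le> k" "k \<le> n" and \<alpha>: "\<alpha> = real k / real n"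
    and t: "tail_quantile P N \<alpha> t" "no_tail_atoms P N t"
    and cost: "\<forall>g\<in>G. \<forall>g'\<in>G. \<forall>x\<in>X. \<forall>y\<in>{-1, 1}. g x = g' x \<longrightarrow> c g (x, y) = c g' (x, y)"
    and class_meas: "P_measurable_class P (c ` G)"
    and rule: "trained_on_subsample P N n \<alpha> \<Psi>" "measurable_rule P n c \<Psi>" "cond_erm P N n \<alpha> G c \<Psi>"
    and K: "1 \<le> K" and nV: "1 \<le> n\<^sub>V" "n\<^sub>V < n" and nT: "n\<^sub>T = n - n\<^sub>V"
    and V: "\<forall>j\<in>{1..K}. V j \<subseteq> {1..n} \<and> card (V j) = n\<^sub>V"
    and balanced: "\<forall>l\<in>{1..n}. 1 / real K * (\<Sum>j=1..K. of_bool (l \<in> V j)) = real n\<^sub>V / real n"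
    and vc: "vc_dim (subgraphs (X \<times> {-1, 1}) (c ` G)) = enat v"
    and bounds: "\<forall>g\<in>G. \<forall>z\<in>X \<times> {-1, 1}. 0 \<le> c g z \<and> c g z \<le> 1"
    and \<delta>: "0 < \<delta>" "\<delta> < 1"
  interpret P: prob_space P by (rule P(1))
  have spaceP: "space P = X \<times> {-1, 1}"
    using sets_eq_imp_space_eq[OF P(2)] X
    by (simp add: obs_space_def space_pair_measure space_restrict_space Int_absorb2)
  have N_meas: "(\<lambda>z. N (fst z)) \<in> borel_measurable P"
  proof -
    have "N \<in> borel_measurable (restrict_space (point_space d) X)"
      using norm_on_points_measurable[OF N] by (rule measurable_restrict_space1)
    hence "(\<lambda>z. N (fst z)) \<in> borel_measurable (obs_space d X)"
      unfolding obs_space_def by (rule measurable_compose[OF measurable_fst])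
    thus ?thesis by (simp only: measurable_cong_sets[OF P(2) refl])
  qed
  have \<alpha>_pos: "0 < \<alpha>" using k by (simp add: \<alpha>)
  interpret T: tail_sample P "\<lambda>z. N (fst z)" t n k
  proof
    show "P.prob {x \<in> space P. t \<le> N (fst x)} = real k / real n"
      using t(1) by (simp add: tail_quantile_def \<alpha>)
    show "P.prob {x \<in> space P. N (fst x) = r} = 0" if "t \<le> r" for r
      using t(2) that by (simp add: no_tail_atoms_def)
  qed (use N_meas k in auto)
  have threshold: "emp_threshold N n \<alpha> z = T.thr z" for z
    using k by (simp add: emp_threshold_def T.thr_def \<alpha>)
  have emp_risk: "emp_risk N n \<alpha> c z g S = 1 / (\<alpha> * real (card S)) * (\<Sum>i\<in>S. T.above z (z i) * c g (z i))" for z g S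
    by (simp add: emp_risk_def threshold T.above_def mult.commute)
  interpret E: tail_erm P "\<lambda>z. N (fst z)" t n k G c v \<Psi>
  proof
    show "P_measurable_class P (c ` G)" by (rule class_meas)
    show "0 \<le> c g x \<and> c g x \<le> 1" if "g \<in> G" "x \<in> space P" for g x using bounds that unfolding spaceP by blast
    show "vc_dim (subgraphs (space P) (c ` G)) \<le> enat v" using vc by (simp add: spaceP)
    fix S assume S: "S \<subseteq> {1..n}"
    show "(\<lambda>p. c (\<Psi> S (fst p)) (snd p)) \<in> borel_measurable (T.Mn \<Otimes>\<^sub>M P)"
      using rule(2) S by (simp add: measurable_rule_def case_prod_unfold)
    fix z assume z: "z \<in> space T.Mn"
    have arg: "is_arg_min (\<lambda>g. emp_risk N n \<alpha> c z g S) (\<lambda>g. g \<in> G) (\<Psi> S z)"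
      using rule(3) S z unfolding cond_erm_def by blast
    thus "\<Psi> S z \<in> G" by (simp add: is_arg_min_def)
    show "(\<Sum>i\<in>S. T.above z (z i) * c (\<Psi> S z) (z i)) \<le> (\<Sum>i\<in>S. T.above z (z i) * c g (z i))" if g: "g \<in> G" for g
    proof (cases "S = {}")
      case False
      have "finite S" using S by (rule finite_subset) simp
      hence "0 < 1 / (\<alpha> * real (card S))" using False \<alpha>_pos by (simp add: card_gt_0_iff)
      moreover have "emp_risk N n \<alpha> c z (\<Psi> S z) S \<le> emp_risk N n \<alpha> c z g S"
        using arg g by (auto simp: is_arg_min_linorder)
      ultimately show ?thesis unfolding emp_risk by (simp only: mult_le_cancel_left_pos)
    qed simp
    fix z' assume z': "z' \<in> space T.Mn" and eq: "\<forall>i\<in>S. z i = z' i" and thr: "T.thr z = T.thr z'"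
    have "emp_threshold N n \<alpha> z = emp_threshold N n \<alpha> z'" using thr by (simp only: threshold)
    thus "\<Psi> S z = \<Psi> S z'" using rule(1) S z z' eq unfolding trained_on_subsample_def by blast
  qed
  have E\<alpha>: "E.\<alpha> = \<alpha>" by (simp add: E.\<alpha>_def \<alpha>)
  have cv: "cv_risk N n \<alpha> c \<Psi> K V z = E.cv K V z" for z
    unfolding cv_risk_def E.cv_def emp_risk E\<alpha> ..
  have risk: "cond_risk P N t c g = E.risk g" for g
  proof -
    have "set_lebesgue_integral P {z \<in> space P. t \<le> N (fst z)} (c g) = (\<integral>x. c g x * T.in_tail x \<partial>P)"
      unfolding set_lebesgue_integral_def
      by (intro Bochner_Integration.integral_cong) (auto simp: T.in_tail_def indicator_def)
    moreover have "P.prob {z \<in> space P. t \<le> N (fst z)} = \<alpha>" using T.tail_prob by (simp add: \<alpha>)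
    ultimately show ?thesis by (simp add: cond_risk_def E.risk_def E\<alpha>)
  qed
  let ?b = "(9 * 504 * sqrt (real v) / sqrt (\<alpha> * real n\<^sub>T) + 9 / (real n\<^sub>T * \<alpha>))
    + 1 / (\<delta> * sqrt (real n\<^sub>T * \<alpha>)) * (5 * 504 * sqrt (real v) + 504)"
  have "0 < \<alpha> * real n\<^sub>T" using \<alpha>_pos nV by (simp add: nT)
  from error_bound_ge_rate[OF this \<delta>, of v]
  have "504 * E.rate (n - n\<^sub>V) \<le> \<delta> * ?b"
    by (simp add: E.rate_def E\<alpha> nT mult.commute)
  hence "1 - \<delta> \<le> T.Mn.prob {z \<in> space T.Mn. \<bar>E.cv K V z - E.risk (\<Psi> {1..n} z)\<bar> \<le> ?b}"
    using K nV V balanced \<delta> by (intro E.cv_error_probability) auto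
  moreover have "1 - 17 * \<delta> \<le> 1 - \<delta>" using \<delta> by simp
  ultimately show "1 - 17 * \<delta> \<le> \<P>(z in sample_law P n.
      \<bar>cv_risk N n \<alpha> c \<Psi> K V z - cond_risk P N t c (\<Psi> {1..n} z)\<bar> \<le> ?b)"
    unfolding cv risk by (rule order_trans[rotated])
qed

end
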